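(* Let $G:X\to R:=[-0.4,0.4]$ be real-analytic and S-shaped, and assume (I) $G'(x)\le 25-50|G(x)|$ for all $x\in X$; (II) the function $H:(-\frac23,\frac23)\to R$, $H(r)=G(\phi(u_r))$, is S-shaped. Consider the self-consistent Perron-Frobenius operator $\widetilde P:\mathcal D\to\mathcal D$, with $\mathcal D$ equipped with the metric inherited from $L_1(X,\lambda)$. Then: 1) In the stable regime, $u_0$ is the unique fixed point of $\widetilde P$, and attracts all densities, that is, $\lim_{n\to\infty}\widetilde P^n u=u_0$ for all $u\in\mathcal D$. 2) In the bistable regime, $u_{-r_*},u_0,u_{r_*}$ are the only fixed points of $\widetilde P$. Now $u_0$ is unstable, while $u_{-r_*}$ and $u_{r_*}$ are stable. More precisely: a) $u_{\pm r_*}$ are stable fixed points for $\widetilde P$ in the sense that their respective basins of attraction are $L_1$-open. b) If $u\in\mathcal D$ is not attracted by $u_{-r_*}$ or $u_{r_*}$, then it is attracted by $u_0$. c) $u_0$ is not stable. Indeed, $u_0$ can be $L_1$-approximated by convex analytic densities from either basin (that of $u_{r_*}$ and that of $u_{-r_*}$). It is a hyperbolic fixed point of $\widetilde P$ restricted to $\mathcal D\cap\mathrm{BV}(X)$ in the following sense: the derivative of $\widetilde P:\mathcal D\cap\mathrm{BV}(X)\to L_1(X,\lambda)$ at $u_0\equiv1$ has a one-dimensional unstable subspace and a codimension $1$ stable subspace.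
   Context: $X=[-\frac12,\frac12]$, $\lambda$ is Lebesgue measure on $X$, $\mathcal D=\{u\in L_1(X,\lambda):u\ge0,\int_X u\,d\lambda=1\}$. $\mathrm{BV}(X)$ is the space of functions of bounded variation on $X$. For $|r|<\frac23$ let $f_r(x)=\dfrac{(r+4)x+(r+1)}{2rx+2}$, $\alpha_r=-\frac r4$, and $T_r:X\to X$, $T_r(x)=f_r(x)$ on $[-\frac12,\alpha_r)$, $T_r(x)=f_r(x)-1$ on $(\alpha_r,\frac12]$ (the value at $\alpha_r$ is irrelevant here). $T_r$ is uniformly expanding and has a unique invariant probability density $u_r\in\mathcal D$; explicitly $u_0\equiv1$ and, for $r\neq0$, $u_r(x)=\Big(\log\frac{4-r^2}{4-9r^2}\Big)^{-1}\frac{2r^2}{(1-r-rx)(1+r-rx)}$. $P_r$ denotes the Perron-Frobenius operator of $T_r$ w.r.t. $\lambda$: $\int (P_ru)\,\psi\,d\lambda=\int u\cdot(\psi\circ T_r)\,d\lambda$ for bounded measurable $\psi$. For a density $u$ put $\phi(u)=\int_X x\,u(x)\,dx$ and $\widetilde Pu=P_{G(\phi(u))}u$. A density $u$ is attracted by a fixed point $v$ of $\widetilde P$ if $\widetilde P^nu\to v$ in $L_1(X,\lambda)$; the basin of attraction of $v$ is the set of $u\in\mathcal D$ attracted by $v$. A function $F$ on a symmetric interval is S-shaped if $F'(x)>0$ and $F(-x)=-F(x)$ for all $x$ in its domain, and $F''(x)<0$ for $x>0$. Assumption (II) entails the following dichotomy: either $H$ has a unique fixed point at $r=0$ (the stable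 regime, with $H'(0)\le1$), or $H$ has exactly three fixed points $-r_*<0<r_*$ (the bistable regime, with $H'(0)>1$). Since $H'(0)=G'(0)/6$, the stable regime corresponds to $G'(0)\le6$. *)

theory Defs
  imports "HOL-Analysis.Analysis"
begin

definition X :: "real set" where
  "X = {-1/2..1/2}"

definition lam :: "real measure" where
  "lam = restrict_space lborel X"

text \<open>
  Elements of \<open>L\<^sub>1(X, \<lambda>)\<close> are represented by integrable functions (whose values outside \<open>X\<close>
  are irrelevant); equality in \<open>L\<^sub>1\<close> is \<^term>\<open>ae_eq\<close>, and \<open>L1_norm\<close> is a seminorm on representatives.
\<close>

definition ae_eq :: "(real \<Rightarrow> real) \<Rightarrow> (real \<Rightarrow> real) \<Rightarrow> bool" where
  "ae_eq u v \<longleftrightarrow> (AE x in lam. u x = v x)"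

definition L1_norm :: "(real \<Rightarrow> real) \<Rightarrow> real" where
  "L1_norm u = (LINT x|lam. \<bar>u x\<bar>)"

definition L1_dist :: "(real \<Rightarrow> real) \<Rightarrow> (real \<Rightarrow> real) \<Rightarrow> real" where
  "L1_dist u v = L1_norm (\<lambda>x. u x - v x)"

definition densities :: "(real \<Rightarrow> real) set" where
  "densities = {u. integrable lam u \<and> (AE x in lam. 0 \<le> u x) \<and> (LINT x|lam. u x) = 1}"

definition L1_open_in_densities :: "(real \<Rightarrow> real) set \<Rightarrow> bool" where
  "L1_open_in_densities A \<longleftrightarrow> A \<subseteq> densities \<and>
     (\<forall>u\<in>A. \<exists>\<epsilon>>0. \<forall>w\<in>densities. L1_dist u w < \<epsilon> \<longrightarrow> w \<in> A)"

subsection \<open>Real-analytic and S-shaped functions\<close>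

text \<open>
  Intended for nondegenerate intervals \<open>S\<close>. At an endpoint belonging to \<open>S\<close> the power series is
  compared with \<open>F\<close> on one side only, which amounts to an analytic extension beyond the endpoint.
\<close>

definition real_analytic_on :: "(real \<Rightarrow> real) \<Rightarrow> real set \<Rightarrow> bool" where
  "real_analytic_on F S \<longleftrightarrow>
     (\<forall>x\<in>S. \<exists>\<epsilon>>0. \<exists>a. \<forall>y\<in>S. \<bar>y - x\<bar> < \<epsilon> \<longrightarrow> (\<lambda>n. a n * (y - x) ^ n) sums F y)"

text \<open>The derivative relative to \<open>S\<close>, hence one-sided at endpoints belonging to \<open>S\<close>.\<close>

definition deriv_in :: "real set \<Rightarrow> (real \<Rightarrow> real) \<Rightarrow> real \<Rightarrow> real" where
  "deriv_in S F x = vector_derivative F (at x within S)"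

definition S_shaped_on :: "(real \<Rightarrow> real) \<Rightarrow> real set \<Rightarrow> bool" where
  "S_shaped_on F S \<longleftrightarrow>
     F differentiable_on S \<and> deriv_in S F differentiable_on S \<and>
     (\<forall>x\<in>S. deriv_in S F x > 0 \<and> F (- x) = - F x) \<and>
     (\<forall>x\<in>S. x > 0 \<longrightarrow> deriv_in S (deriv_in S F) x < 0)"

subsection \<open>The maps and their Perron-Frobenius operators\<close>

definition f_map :: "real \<Rightarrow> real \<Rightarrow> real" where
  "f_map r x = ((r + 4) * x + (r + 1)) / (2 * r * x + 2)"

definition T_map :: "real \<Rightarrow> real \<Rightarrow> real" where
  "T_map r x = (if x < - r / 4 then f_map r x else f_map r x - 1)"

definition inv_dens :: "real \<Rightarrow> real \<Rightarrow> real" where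
  "inv_dens r x =
     (if r = 0 then 1
      else inverse (ln ((4 - r\<^sup>2) / (4 - 9 * r\<^sup>2))) *
           (2 * r\<^sup>2 / ((1 - r - r * x) * (1 + r - r * x))))"

definition is_PF_image :: "real \<Rightarrow> (real \<Rightarrow> real) \<Rightarrow> (real \<Rightarrow> real) \<Rightarrow> bool" where
  "is_PF_image r u w \<longleftrightarrow> integrable lam w \<and>
     (\<forall>\<psi>\<in>borel_measurable lam. bounded (\<psi> ` X) \<longrightarrow>
        (LINT x|lam. w x * \<psi> x) = (LINT x|lam. u x * \<psi> (T_map r x)))"

text \<open>
  The defining duality determines the image up to a null set. The representative chosen by
  \<open>SOME\<close> depends on \<open>u\<close> only through its equivalence class.
\<close>

definition PF :: "real \<Rightarrow> (real \<Rightarrow> real) \<Rightarrow> (real \<Rightarrow> real)" where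
  "PF r u = (SOME w. is_PF_image r u w)"

definition phi :: "(real \<Rightarrow> real) \<Rightarrow> real" where
  "phi u = (LINT x|lam. x * u x)"

definition PF_sc :: "(real \<Rightarrow> real) \<Rightarrow> (real \<Rightarrow> real) \<Rightarrow> (real \<Rightarrow> real)" where
  "PF_sc G u = PF (G (phi u)) u"

definition H_fun :: "(real \<Rightarrow> real) \<Rightarrow> real \<Rightarrow> real" where
  "H_fun G r = G (phi (inv_dens r))"

definition H_fixed_points :: "(real \<Rightarrow> real) \<Rightarrow> real set" where
  "H_fixed_points G = {r \<in> {-2/3<..<2/3}. H_fun G r = r}"

definition stable_regime :: "(real \<Rightarrow> real) \<Rightarrow> bool" where
  "stable_regime G \<longleftrightarrow> H_fixed_points G = {0}"

definition bistable_regime :: "(real \<Rightarrow> real) \<Rightarrow> real \<Rightarrow> bool" where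
  "bistable_regime G rs \<longleftrightarrow> 0 < rs \<and> H_fixed_points G = {- rs, 0, rs}"

definition fixed_density :: "(real \<Rightarrow> real) \<Rightarrow> (real \<Rightarrow> real) \<Rightarrow> bool" where
  "fixed_density G v \<longleftrightarrow> v \<in> densities \<and> ae_eq (PF_sc G v) v"

definition basin :: "(real \<Rightarrow> real) \<Rightarrow> (real \<Rightarrow> real) \<Rightarrow> (real \<Rightarrow> real) set" where
  "basin G v = {u \<in> densities. (\<lambda>n. L1_dist ((PF_sc G ^^ n) u) v) \<longlonglongrightarrow> 0}"

subsection \<open>Bounded variation\<close>

definition pointwise_var :: "(real \<Rightarrow> real) \<Rightarrow> ennreal" where
  "pointwise_var w =
     (SUP t\<in>{t :: real list. sorted t \<and> set t \<subseteq> X}.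
        \<Sum>i<length t - 1. ennreal \<bar>w (t ! Suc i) - w (t ! i)\<bar>)"

text \<open>The variation of an \<open>L\<^sub>1\<close>-class is the least variation among all its representatives.\<close>

definition ess_var :: "(real \<Rightarrow> real) \<Rightarrow> ennreal" where
  "ess_var u = (INF w\<in>{w. ae_eq w u}. pointwise_var w)"

definition BV :: "(real \<Rightarrow> real) set" where
  "BV = {u. integrable lam u \<and> ess_var u < \<infinity>}"

definition BV_norm :: "(real \<Rightarrow> real) \<Rightarrow> real" where
  "BV_norm u = L1_norm u + enn2real (ess_var u)"

text \<open>The direction space of the affine hull of the densities of bounded variation.\<close>

definition BV0 :: "(real \<Rightarrow> real) set" where
  "BV0 = {g \<in> BV. (LINT x|lam. g x) = 0}"

text \<open>
  \<open>Q\<close> is the Frechet derivative at \<open>u\<close> of \<open>F\<close>, defined on the densities of bounded variation with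
  the \<open>BV\<close>-norm and taking values in \<open>L\<^sub>1\<close>. Linearity is that of a map between spaces of
  equivalence classes.
\<close>

definition has_BV_L1_derivative ::
  "((real \<Rightarrow> real) \<Rightarrow> real \<Rightarrow> real) \<Rightarrow> ((real \<Rightarrow> real) \<Rightarrow> real \<Rightarrow> real) \<Rightarrow> (real \<Rightarrow> real) \<Rightarrow> bool" where
  "has_BV_L1_derivative F Q u \<longleftrightarrow>
     (\<forall>g\<in>BV0. integrable lam (Q g)) \<and>
     (\<forall>g\<in>BV0. \<forall>h\<in>BV0. ae_eq g h \<longrightarrow> ae_eq (Q g) (Q h)) \<and>
     (\<forall>g\<in>BV0. \<forall>h\<in>BV0. \<forall>a b. ae_eq (Q (\<lambda>x. a * g x + b * h x)) (\<lambda>x. a * Q g x + b * Q h x)) \<and>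
     (\<exists>K. \<forall>g\<in>BV0. L1_norm (Q g) \<le> K * BV_norm g) \<and>
     (\<forall>\<epsilon>>0. \<exists>\<delta>>0. \<forall>g\<in>BV0. (\<lambda>x. u x + g x) \<in> densities \<longrightarrow> BV_norm g < \<delta> \<longrightarrow>
        L1_norm (\<lambda>x. F (\<lambda>y. u y + g y) x - F u x - Q g x) \<le> \<epsilon> * BV_norm g)"

text \<open>
  Invariant splitting of \<open>BV0\<close> into the line spanned by \<open>e\<close>, on which \<open>Q\<close> is expanding, and a
  closed hyperplane \<open>Es\<close>, on which the powers of \<open>Q\<close> contract exponentially. Closedness makes \<open>Es\<close>
  a union of equivalence classes.
\<close>

definition hyperbolic_one_dim_unstable :: "((real \<Rightarrow> real) \<Rightarrow> real \<Rightarrow> real) \<Rightarrow> bool" where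
  "hyperbolic_one_dim_unstable Q \<longleftrightarrow>
     (\<exists>e Es \<mu> C \<kappa>.
        e \<in> BV0 \<and> \<bar>\<mu>\<bar> > 1 \<and> ae_eq (Q e) (\<lambda>x. \<mu> * e x) \<and>
        Es \<subseteq> BV0 \<and> (\<lambda>x. 0) \<in> Es \<and>
        (\<forall>g\<in>Es. \<forall>h\<in>Es. \<forall>a b. (\<lambda>x. a * g x + b * h x) \<in> Es) \<and>
        (\<forall>g\<in>BV0. (\<forall>\<epsilon>>0. \<exists>h\<in>Es. BV_norm (\<lambda>x. g x - h x) < \<epsilon>) \<longrightarrow> g \<in> Es) \<and>
        (\<forall>g\<in>BV0. \<exists>!c. (\<lambda>x. g x - c * e x) \<in> Es) \<and>
        (\<forall>g\<in>Es. Q g \<in> Es) \<and>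
        0 \<le> \<kappa> \<and> \<kappa> < 1 \<and> (\<forall>g\<in>Es. \<forall>n. BV_norm ((Q ^^ n) g) \<le> C * \<kappa> ^ n * BV_norm g))"

end

theory Submission
  imports Defs
begin

text \<open>Everything is Moebius: for \<open>r > 0\<close> the density \<open>inv_dens r\<close>
  is, up to normalization, the integral of \<open>1 / (1 - x * y)^2\<close> over \<open>y\<close>
  between \<open>r / (1 + r)\<close> and \<open>r / (1 - r)\<close>, which are the fixed points of
  the left and right branches acting on \<open>y\<close>. This suggests the kernels, and it makes
  \<open>a / (1 - a)\<close> and \<open>b / (1 + b)\<close> the critical parameters for trapping a
  support to the right of \<open>a\<close> or to the left of \<open>b\<close>. The obstacle is that
  an arbitrary initial density need not be a mixture of kernels, so monotonicity does not apply to
  it. Loss of memory replaces it by the uniform density at the price of an error in the mean that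
  tends to zero; hence every comparison must survive small errors, through continuity of
  \<open>G\<close> and strict inequalities. For open basins the error must be controlled uniformly
  in time, which follows since transfer operators do not expand L1 distances. The slope of
  \<open>G\<close> at 0 is found by comparison: \<open>kern_mean\<close> has slope 1/6 at 0, and
  bounding the mean of \<open>inv_dens r\<close> by \<open>kern_mean (r / (1 - r))\<close> turns
  \<open>H'(0) > 1\<close> into \<open>G'(0) > 6\<close>, which feeds both the trapping and the
  unstable eigenvalue.\<close>

text \<open>
  The densities \<open>kern y x = (1 - y\<^sup>2/4) / (1 - x y)\<^sup>2\<close> with \<open>\<bar>y\<bar> \<le> 2/3\<close> span a cone that every \<open>P\<^sub>r\<close> with
  \<open>\<bar>r\<bar> \<le> 2/5\<close> preserves: \<open>P\<^sub>r\<close> maps \<open>kern y\<close> to a convex combination of two such kernels, with parameters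
  and weights increasing in both \<open>r\<close> and \<open>y\<close>. The dual Markov operator on functions of \<open>y\<close> is therefore
  monotone, and it contracts Lipschitz constants. As the kernels span a dense subspace of \<open>L\<^sub>1\<close>, any
  composition of operators \<open>P\<^sub>r\<close> forgets its initial density, uniformly in the choice of the parameters.

  Hence a self-consistent orbit is asymptotically determined by its parameters \<open>r\<^sub>n\<close> alone, and these
  satisfy \<open>limsup r\<^sub>n \<le> H (limsup r\<^sub>n)\<close> and \<open>H (liminf r\<^sub>n) \<le> liminf r\<^sub>n\<close>, by comparison with constant parameters.
  In the stable regime this forces \<open>r\<^sub>n \<longlonglongrightarrow> 0\<close>. In the bistable regime, a representing measure that lies to the
  right of a small \<open>a > 0\<close> at some late time does so for ever, which forces \<open>r\<^sub>n \<longlonglongrightarrow> r\<^sub>*\<close>, even under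
  small perturbations; if this never happens on either side of \<open>0\<close>, the length of the support contracts and \<open>r\<^sub>n \<longlonglongrightarrow> 0\<close>.

  The derivative at the uniform density is the rank-one perturbation \<open>g \<mapsto> P\<^sub>0 g + G'(0) \<phi>(g) x\<close> of \<open>P\<^sub>0\<close>. The
  function \<open>x\<close> is an eigenvector with eigenvalue \<open>1/2 + G'(0)/12 > 1\<close>, and on the kernel of the corresponding
  left eigenfunctional the powers of the derivative are projections of \<open>P\<^sub>0\<^sup>n\<close>, which decays like \<open>2\<^sup>-\<^sup>n\<close>
  on functions of bounded variation and mean zero.
\<close>

section \<open>The dual iterated function system\<close>

definition Pars :: "real set" where
  "Pars = {-2/5..2/5}"

text \<open>The ends are the fixed points of the extreme branches \<open>left_branch (-2/5)\<close>
  and \<open>right_branch (2/5)\<close>, so all branches with parameters in \<open>Pars\<close> map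
  this interval into itself.\<close>

definition Y :: "real set" where
  "Y = {-2/3..2/3}"

definition left_branch :: "real \<Rightarrow> real \<Rightarrow> real" where
  "left_branch r y = 2 * (r + y) / (4 + r * y + (r + y))"

definition right_branch :: "real \<Rightarrow> real \<Rightarrow> real" where
  "right_branch r y = 2 * (r + y) / (4 + r * y - (r + y))"

text \<open>The mass that \<open>kern y\<close> gives to the domain of the right branch of
  \<open>T_map r\<close>.\<close>

definition right_weight :: "real \<Rightarrow> real \<Rightarrow> real" where
  "right_weight r y = (2 + y) * (2 + r) / (2 * (4 + r * y))"

definition dual_op :: "real \<Rightarrow> (real \<Rightarrow> real) \<Rightarrow> real \<Rightarrow> real" where
  "dual_op r h y = (1 - right_weight r y) * h (left_branch r y) + right_weight r y * h (right_branch r y)"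

text \<open>The operator with parameter \<open>r 0\<close> is outermost: the value at
  \<open>y\<close> is the integral of \<open>h\<close> against the measure into which the point mass
  at \<open>y\<close> evolves when \<open>r 0\<close> acts first.\<close>

primrec dual_iter :: "(nat \<Rightarrow> real) \<Rightarrow> nat \<Rightarrow> (real \<Rightarrow> real) \<Rightarrow> real \<Rightarrow> real" where
  "dual_iter r 0 h = h"
| "dual_iter r (Suc n) h = dual_op (r 0) (dual_iter (\<lambda>i. r (Suc i)) n h)"

definition mono_Y :: "(real \<Rightarrow> real) \<Rightarrow> bool" where
  "mono_Y h \<longleftrightarrow> (\<forall>y\<in>Y. \<forall>z\<in>Y. y \<le> z \<longrightarrow> h y \<le> h z)"

definition lip_Y :: "real \<Rightarrow> (real \<Rightarrow> real) \<Rightarrow> bool" where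
  "lip_Y C h \<longleftrightarrow> 0 \<le> C \<and> (\<forall>y\<in>Y. \<forall>z\<in>Y. \<bar>h y - h z\<bar> \<le> C * \<bar>y - z\<bar>)"

lemma mono_YD: "mono_Y h \<Longrightarrow> y \<in> Y \<Longrightarrow> z \<in> Y \<Longrightarrow> y \<le> z \<Longrightarrow> h y \<le> h z"
  by (simp add: mono_Y_def)

lemma zero_in_Y [simp]: "0 \<in> Y"
  and zero_in_Pars [simp]: "0 \<in> Pars"
  by (auto simp: Y_def Pars_def)

lemma uminus_Y_iff [simp]: "- y \<in> Y \<longleftrightarrow> y \<in> Y"
  and uminus_Pars_iff [simp]: "- r \<in> Pars \<longleftrightarrow> r \<in> Pars"
  by (auto simp: Y_def Pars_def)

lemma denom_bounds:
  assumes "r \<in> Pars" "y \<in> Y"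
  shows "16/5 \<le> 4 + r * y + (r + y)" "16/5 \<le> 4 + r * y - (r + y)" "18/5 \<le> 4 + r * y"
    "4 + r * y + (r + y) \<le> 6" "4 + r * y - (r + y) \<le> 6"
proof -
  have r: "-2/5 \<le> r" "r \<le> 2/5" and y: "-2/3 \<le> y" "y \<le> 2/3"
    using assms by (auto simp: Pars_def Y_def)
  \<comment> \<open>The two denominators are \<open>3 + (1 + r) * (1 + y)\<close> and
    \<open>3 + (1 - r) * (1 - y)\<close>.\<close>
  have "3/5 * (1/3) \<le> (1 + r) * (1 + y)" "3/5 * (1/3) \<le> (1 - r) * (1 - y)"
    using r y by (intro mult_mono; simp)+
  then show "16/5 \<le> 4 + r * y + (r + y)" "16/5 \<le> 4 + r * y - (r + y)"
    by (simp_all add: algebra_simps)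
  have "(1 + r) * (1 + y) \<le> 7/5 * (5/3)" "(1 - r) * (1 - y) \<le> 7/5 * (5/3)"
    using r y by (intro mult_mono; simp)+
  then show "4 + r * y + (r + y) \<le> 6" "4 + r * y - (r + y) \<le> 6"
    by (simp_all add: algebra_simps)
  have "\<bar>r * y\<bar> \<le> 2/5 * (2/3)"
    unfolding abs_mult using r y by (intro mult_mono) auto
  then show "18/5 \<le> 4 + r * y"
    by (simp add: abs_le_iff)
qed

lemma denom_pos:
  assumes "r \<in> Pars" "y \<in> Y"
  shows "0 < 4 + r * y + (r + y)" "0 < 4 + r * y - (r + y)" "0 < 4 + r * y"
  using denom_bounds[OF assms] by linarith+

text \<open>The reflection of \<open>x\<close> conjugates the map with parameter \<open>r\<close> to
  the one with parameter \<open>- r\<close> and exchanges the branches. Through it, statements about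
  right ends follow from those about left ends.\<close>

lemma branch_reflect:
  "left_branch (- r) (- y) = - right_branch r y"
  "right_branch (- r) (- y) = - left_branch r y"
  unfolding left_branch_def right_branch_def minus_divide_left
  by (rule arg_cong2[where f = "(/)"]; simp)+

lemma weight_reflect:
  assumes "r \<in> Pars" "y \<in> Y"
  shows "right_weight (- r) (- y) = 1 - right_weight r y"
  using denom_pos[OF assms] by (simp add: right_weight_def field_simps)

text \<open>The symmetry in \<open>r\<close> and \<open>y\<close> yields monotonicity in the
  parameter from the difference formulas in \<open>y\<close>, with the roles exchanged.\<close>

lemma branch_commute:
  "left_branch r y = left_branch y r" "right_branch r y = right_branch y r"
  "right_weight r y = right_weight y r"
  by (simp_all add: left_branch_def right_branch_def right_weight_def algebra_simps)

lemma left_branch_diff: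
  assumes "4 + r * y + (r + y) \<noteq> 0" "4 + r * z + (r + z) \<noteq> 0"
  shows "left_branch r z - left_branch r y =
    2 * (4 - r\<^sup>2) * (z - y) / ((4 + r * y + (r + y)) * (4 + r * z + (r + z)))"
  using assms unfolding left_branch_def
  by (simp add: diff_frac_eq) (simp add: algebra_simps power2_eq_square)

lemma right_branch_diff:
  assumes "4 + r * y - (r + y) \<noteq> 0" "4 + r * z - (r + z) \<noteq> 0"
  shows "right_branch r z - right_branch r y =
    2 * (4 - r\<^sup>2) * (z - y) / ((4 + r * y - (r + y)) * (4 + r * z - (r + z)))"
  using assms unfolding right_branch_def
  by (simp add: diff_frac_eq) (simp add: algebra_simps power2_eq_square)

lemma right_weight_diff:
  assumes "4 + r * y \<noteq> 0" "4 + r * z \<noteq> 0"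
  shows "right_weight r z - right_weight r y = (4 - r\<^sup>2) * (z - y) / ((4 + r * y) * (4 + r * z))"
proof -
  have "right_weight r u = (2 + u) * (2 + r) / (4 + r * u) / 2" for u
    by (simp add: right_weight_def)
  then have "right_weight r z - right_weight r y =
      ((2 + z) * (2 + r) / (4 + r * z) - (2 + y) * (2 + r) / (4 + r * y)) / 2"
    by (simp add: diff_divide_distrib)
  also have "\<dots> = (4 - r\<^sup>2) * (z - y) / ((4 + r * y) * (4 + r * z))"
    using assms by (simp add: diff_frac_eq) (simp add: divide_simps, simp add: algebra_simps power2_eq_square)
  finally show ?thesis .
qed

lemma branch_gap:
  assumes "4 + r * y + (r + y) \<noteq> 0" "4 + r * y - (r + y) \<noteq> 0"
  shows "right_branch r y - left_branch r y =
    4 * (r + y)\<^sup>2 / ((4 + r * y - (r + y)) * (4 + r * y + (r + y)))"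
  using assms unfolding left_branch_def right_branch_def
  by (simp add: diff_frac_eq) (simp add: algebra_simps power2_eq_square)

lemma Pars_sq: "r \<in> Pars \<Longrightarrow> r\<^sup>2 \<le> 4/25"
  using abs_le_square_iff[of r "2/5"] by (auto simp: Pars_def power2_eq_square abs_le_iff)

lemma branches_mono:
  assumes "r \<in> Pars" "y \<in> Y" "z \<in> Y" "y \<le> z"
  shows "left_branch r y \<le> left_branch r z" "right_branch r y \<le> right_branch r z"
    "right_weight r y \<le> right_weight r z"
proof -
  note d = denom_pos[OF assms(1,2)] denom_pos[OF assms(1,3)]
  have p: "0 \<le> 2 * (4 - r\<^sup>2) * (z - y)" "0 \<le> (4 - r\<^sup>2) * (z - y)"
    using Pars_sq[OF assms(1)] assms(4) by (intro mult_nonneg_nonneg; simp)+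
  have "0 \<le> left_branch r z - left_branch r y"
    using d p by (subst left_branch_diff) (auto intro!: divide_nonneg_pos mult_pos_pos simp del: mult_le_0_iff zero_le_mult_iff right_diff_distrib_numeral left_diff_distrib_numeral)
  then show "left_branch r y \<le> left_branch r z" by simp
  have "0 \<le> right_branch r z - right_branch r y"
    using d p by (subst right_branch_diff) (auto intro!: divide_nonneg_pos mult_pos_pos simp del: mult_le_0_iff zero_le_mult_iff right_diff_distrib_numeral left_diff_distrib_numeral)
  then show "right_branch r y \<le> right_branch r z" by simp
  have "0 \<le> right_weight r z - right_weight r y"
    using d p by (subst right_weight_diff) (auto intro!: divide_nonneg_pos mult_pos_pos simp del: mult_le_0_iff zero_le_mult_iff right_diff_distrib_numeral left_diff_distrib_numeral)
  then show "right_weight r y \<le> right_weight r z" by simp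
qed

lemma Y_sq: "y \<in> Y \<Longrightarrow> y\<^sup>2 \<le> 4/9"
  using abs_le_square_iff[of y "2/3"] by (auto simp: Y_def power2_eq_square abs_le_iff)

lemma branches_mono_par:
  assumes "r \<in> Pars" "s \<in> Pars" "y \<in> Y" "r \<le> s"
  shows "left_branch r y \<le> left_branch s y" "right_branch r y \<le> right_branch s y"
    "right_weight r y \<le> right_weight s y"
proof -
  note d = denom_pos[OF assms(1,3)] denom_pos[OF assms(2,3)]
  have d': "0 < 4 + y * r + (y + r)" "0 < 4 + y * r - (y + r)" "0 < 4 + y * r"
    "0 < 4 + y * s + (y + s)" "0 < 4 + y * s - (y + s)" "0 < 4 + y * s"
    using d by (simp_all add: algebra_simps)
  have p: "0 \<le> 2 * (4 - y\<^sup>2) * (s - r)" "0 \<le> (4 - y\<^sup>2) * (s - r)"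
    using Y_sq[OF assms(3)] assms(4) by (intro mult_nonneg_nonneg; simp)+
  have "0 \<le> left_branch y s - left_branch y r"
    using d' p by (subst left_branch_diff) (auto intro!: divide_nonneg_pos mult_pos_pos simp del: mult_le_0_iff zero_le_mult_iff right_diff_distrib_numeral left_diff_distrib_numeral)
  then show "left_branch r y \<le> left_branch s y" by (simp add: branch_commute[of y])
  have "0 \<le> right_branch y s - right_branch y r"
    using d' p by (subst right_branch_diff) (auto intro!: divide_nonneg_pos mult_pos_pos simp del: mult_le_0_iff zero_le_mult_iff right_diff_distrib_numeral left_diff_distrib_numeral)
  then show "right_branch r y \<le> right_branch s y" by (simp add: branch_commute[of y])
  have "0 \<le> right_weight y s - right_weight y r"
    using d' p by (subst right_weight_diff) (auto intro!: divide_nonneg_pos mult_pos_pos simp del: mult_le_0_iff zero_le_mult_iff right_diff_distrib_numeral left_diff_distrib_numeral)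
  then show "right_weight r y \<le> right_weight s y" by (simp add: branch_commute[of y])
qed

lemma left_le_right:
  assumes "r \<in> Pars" "y \<in> Y"
  shows "left_branch r y \<le> right_branch r y"
proof -
  note d = denom_pos[OF assms]
  have "0 \<le> right_branch r y - left_branch r y"
    using d by (subst branch_gap) (auto intro!: divide_nonneg_pos mult_pos_pos)
  then show ?thesis by simp
qed

lemma right_branch_le:
  assumes "r \<in> Pars" "y \<in> Y"
  shows "right_branch r y \<le> 2/3"
proof -
  have "right_branch r y \<le> right_branch (2/5) y"
    using assms by (intro branches_mono_par) (auto simp: Pars_def)
  also have "\<dots> \<le> right_branch (2/5) (2/3)"
    using assms by (intro branches_mono) (auto simp: Y_def Pars_def)
  also have "\<dots> = 2/3" by (simp add: right_branch_def)
  finally show ?thesis .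
qed

lemma branches_in_Y:
  assumes "r \<in> Pars" "y \<in> Y"
  shows "left_branch r y \<in> Y" "right_branch r y \<in> Y"
proof -
  have "left_branch r y \<ge> - 2/3"
    using right_branch_le[of "-r" "-y"] assms by (simp add: branch_reflect)
  then show "left_branch r y \<in> Y" "right_branch r y \<in> Y"
    using left_le_right[OF assms] right_branch_le[OF assms] by (auto simp: Y_def)
qed

lemma right_weight_bounds:
  assumes "r \<in> Pars" "y \<in> Y"
  shows "0 \<le> right_weight r y" "right_weight r y \<le> 1"
proof -
  have *: "0 \<le> right_weight r y" if "r \<in> Pars" "y \<in> Y" for r y
    using denom_pos[OF that] that unfolding right_weight_def
    by (intro divide_nonneg_pos mult_nonneg_nonneg) (auto simp: Pars_def Y_def)
  show "0 \<le> right_weight r y" using * assms .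
  show "right_weight r y \<le> 1"
    using *[of "-r" "-y"] assms by (simp add: weight_reflect)
qed

section \<open>Monotonicity and contraction of the dual operator\<close>

lemma convex_comb_mono:
  fixes p q :: real
  assumes "0 \<le> p" "p \<le> 1" "0 \<le> q" "q \<le> 1" "p \<le> q" "a \<le> c" "b \<le> d" "c \<le> d"
  shows "(1 - p) * a + p * b \<le> (1 - q) * c + q * d"
proof -
  have "(1 - p) * a + p * b \<le> (1 - p) * c + p * d"
    using assms by (intro add_mono mult_left_mono) auto
  also have "\<dots> = c + p * (d - c)" by (simp add: algebra_simps)
  also have "\<dots> \<le> c + q * (d - c)"
    using assms by (intro add_left_mono mult_right_mono) auto
  also have "\<dots> = (1 - q) * c + q * d" by (simp add: algebra_simps)
  finally show ?thesis .
qed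

text \<open>Raising \<open>r\<close> or \<open>y\<close> moves both image points to the right and
  shifts weight from the left image point to the right one; as the latter is the larger point, each
  change can only raise the average of an increasing function.\<close>

lemma dual_op_mono:
  assumes "r \<in> Pars" "s \<in> Pars" "y \<in> Y" "z \<in> Y" "r \<le> s" "y \<le> z" "mono_Y h"
    and gh: "\<And>u. u \<in> Y \<Longrightarrow> g u \<le> h u"
  shows "dual_op r g y \<le> dual_op s h z"
proof -
  note iY = branches_in_Y[OF assms(1,3)] branches_in_Y[OF assms(2,4)] branches_in_Y[OF assms(2,3)]
  have "left_branch r y \<le> left_branch s z" "right_branch r y \<le> right_branch s z"
    "right_weight r y \<le> right_weight s z"
    using branches_mono[OF assms(2,3,4,6)] branches_mono_par[OF assms(1,2,3,5)] by linarith+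
  then show ?thesis
    unfolding dual_op_def
    using right_weight_bounds[OF assms(1,3)] right_weight_bounds[OF assms(2,4)]
      left_le_right[OF assms(2,4)] iY
    by (intro convex_comb_mono) (auto intro: mono_YD[OF assms(7)] order_trans[OF gh mono_YD[OF assms(7)]])
qed

lemma dual_op_bounds:
  assumes "r \<in> Pars" "y \<in> Y" "\<And>u. u \<in> Y \<Longrightarrow> \<bar>h u - c\<bar> \<le> d"
  shows "\<bar>dual_op r h y - c\<bar> \<le> d"
proof -
  let ?q = "right_weight r y"
  note q = right_weight_bounds[OF assms(1,2)] and iY = branches_in_Y[OF assms(1,2)]
  have "dual_op r h y - c = (1 - ?q) * (h (left_branch r y) - c) + ?q * (h (right_branch r y) - c)"
    by (simp add: dual_op_def algebra_simps)
  also have "\<bar>\<dots>\<bar> \<le> (1 - ?q) * \<bar>h (left_branch r y) - c\<bar> + ?q * \<bar>h (right_branch r y) - c\<bar>"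
    using q by (intro order_trans[OF abs_triangle_ineq]) (simp add: abs_mult)
  also have "\<dots> \<le> (1 - ?q) * d + ?q * d"
    using q iY by (intro add_mono mult_left_mono assms(3)) auto
  finally show ?thesis by (simp add: algebra_simps)
qed

text \<open>Two effects add up. Each branch contracts by 25/32, while weight moves between the image
  points at rate at most 25/81 and then costs the increment of \<open>h\<close> across their gap,
  which is at most 4/9. The total 25/32 + 100/729 is about 0.92, below 19/20.\<close>

lemma dual_op_lip:
  assumes r: "r \<in> Pars" and "lip_Y C h"
  shows "lip_Y (19/20 * C) (dual_op r h)"
proof -
  have C: "0 \<le> C" and h: "\<And>y z. y \<in> Y \<Longrightarrow> z \<in> Y \<Longrightarrow> \<bar>h y - h z\<bar> \<le> C * \<bar>y - z\<bar>"
    using assms by (auto simp: lip_Y_def)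
  have key: "\<bar>dual_op r h z - dual_op r h y\<bar> \<le> 19/20 * C * (z - y)"
    if y: "y \<in> Y" and z: "z \<in> Y" and le: "y \<le> z" for y z
  proof -
    let ?q = "right_weight r"
    note d = denom_pos[OF r y] denom_pos[OF r z] and b = denom_bounds[OF r y] denom_bounds[OF r z]
    have n: "4 + r * y + (r + y) \<noteq> 0" "4 + r * y - (r + y) \<noteq> 0" "4 + r * y \<noteq> 0"
      "4 + r * z + (r + z) \<noteq> 0" "4 + r * z - (r + z) \<noteq> 0" "4 + r * z \<noteq> 0"
      using d by linarith+
    have z1: "0 \<le> 8 * (z - y)" "0 \<le> 4 * (z - y)" and c: "0 < (16/5 :: real)" "0 < (18/5 :: real)"
      using le by simp_all
    note m = branches_mono[OF r y z le]
    note iY = branches_in_Y[OF r y] branches_in_Y[OF r z]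
    note q = right_weight_bounds[OF r y] right_weight_bounds[OF r z]
    have r2: "0 \<le> r\<^sup>2" "r\<^sup>2 \<le> 4/25" using Pars_sq[OF r] by auto
    have num: "2 * (4 - r\<^sup>2) * (z - y) \<le> 8 * (z - y)" "(4 - r\<^sup>2) * (z - y) \<le> 4 * (z - y)"
      using r2 le by (intro mult_right_mono; simp)+
    have frac: "u / (a * b) \<le> v / (c * c)"
      if "u \<le> v" "0 \<le> v" "0 < c" "c \<le> a" "c \<le> b" for u v a b c :: real
      using that by (intro frac_le mult_mono) auto
    have lb: "left_branch r z - left_branch r y \<le> 8 * (z - y) / (16/5 * (16/5))"
      by (rule order_trans[OF eq_refl[OF left_branch_diff[OF n(1) n(4)]] frac[OF num(1) z1(1) c(1) b(1,6)]])
    have rb: "right_branch r z - right_branch r y \<le> 8 * (z - y) / (16/5 * (16/5))"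
      by (rule order_trans[OF eq_refl[OF right_branch_diff[OF n(2) n(5)]] frac[OF num(1) z1(1) c(1) b(2,7)]])
    have qb: "?q z - ?q y \<le> 4 * (z - y) / (18/5 * (18/5))"
      by (rule order_trans[OF eq_refl[OF right_weight_diff[OF n(3) n(6)]] frac[OF num(2) z1(2) c(2) b(3,8)]])
    have "\<bar>r + z\<bar> \<le> 16/15"
      using r z unfolding abs_le_iff Pars_def Y_def by auto
    then have "(r + z)\<^sup>2 \<le> (16/15)\<^sup>2"
      by (metis abs_ge_zero power2_abs power_mono)
    then have gb: "right_branch r z - left_branch r z \<le> 4 * (16/15)\<^sup>2 / (16/5 * (16/5))"
      
      by (intro order_trans[OF eq_refl[OF branch_gap[OF n(4,5)]] frac[OF _ _ c(1) b(7,6)]]) auto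
    have lb': "left_branch r z - left_branch r y \<le> 25/32 * (z - y)"
      and rb': "right_branch r z - right_branch r y \<le> 25/32 * (z - y)"
      and qb': "?q z - ?q y \<le> 25/81 * (z - y)"
      and gb': "right_branch r z - left_branch r z \<le> 4/9"
      using lb rb qb gb by (simp_all add: power2_eq_square)
    have hb: "\<bar>h u - h v\<bar> \<le> C * K" if "u \<in> Y" "v \<in> Y" "v \<le> u" "u - v \<le> K" for u v K
      using order_trans[OF h[OF that(1,2)] mult_left_mono[of _ K, OF _ C]] that(3,4) by simp
    have "dual_op r h z - dual_op r h y =
        (1 - ?q y) * (h (left_branch r z) - h (left_branch r y))
        + ?q y * (h (right_branch r z) - h (right_branch r y))
        + (?q z - ?q y) * (h (right_branch r z) - h (left_branch r z))"
      by (simp add: dual_op_def algebra_simps)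
    also have "\<bar>\<dots>\<bar> \<le> (1 - ?q y) * \<bar>h (left_branch r z) - h (left_branch r y)\<bar>
        + ?q y * \<bar>h (right_branch r z) - h (right_branch r y)\<bar>
        + (?q z - ?q y) * \<bar>h (right_branch r z) - h (left_branch r z)\<bar>"
      using q m by (intro order_trans[OF abs_triangle_ineq] add_mono) (auto simp: abs_mult)
    also have "\<dots> \<le> (1 - ?q y) * (C * (25/32 * (z - y))) + ?q y * (C * (25/32 * (z - y)))
        + (25/81 * (z - y)) * (C * (4/9))"
      using q m le C by (intro add_mono mult_mono mult_left_mono qb'
          hb[OF iY(3,1) m(1) lb'] hb[OF iY(4,2) m(2) rb'] hb[OF iY(4,3) left_le_right[OF r z] gb']) auto
    also have "\<dots> = (25/32 + 100/729) * (C * (z - y))"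
      by (simp add: field_simps)
    also have "\<dots> \<le> 19/20 * (C * (z - y))"
      using C le by (intro mult_right_mono) auto
    finally show ?thesis by simp
  qed
  have "\<bar>dual_op r h y - dual_op r h z\<bar> \<le> 19/20 * C * \<bar>y - z\<bar>" if "y \<in> Y" "z \<in> Y" for y z
    using key[of y z] key[of z y] that by (cases "y \<le> z") (auto simp: abs_minus_commute)
  then show ?thesis using C by (simp add: lip_Y_def)
qed

lemma dual_op_mono_Y: "r \<in> Pars \<Longrightarrow> mono_Y h \<Longrightarrow> mono_Y (dual_op r h)"
  unfolding mono_Y_def[of "dual_op r h"] by (auto intro: dual_op_mono)

lemma dual_iter_mono_Y: "(\<And>i. r i \<in> Pars) \<Longrightarrow> mono_Y h \<Longrightarrow> mono_Y (dual_iter r n h)"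
  by (induction n arbitrary: r) (auto intro: dual_op_mono_Y)

lemma dual_iter_lip:
  "(\<And>i. r i \<in> Pars) \<Longrightarrow> lip_Y C h \<Longrightarrow> lip_Y ((19/20)^n * C) (dual_iter r n h)"
proof (induction n arbitrary: r)
  case (Suc n)
  have "lip_Y (19/20 * ((19/20)^n * C)) (dual_op (r 0) (dual_iter (\<lambda>i. r (Suc i)) n h))"
    using Suc by (intro dual_op_lip Suc.IH) auto
  then show ?case by (simp add: mult.assoc)
qed simp

lemma dual_iter_osc:
  assumes "\<And>i. r i \<in> Pars" "lip_Y C h" "y \<in> Y" "z \<in> Y"
  shows "\<bar>dual_iter r n h y - dual_iter r n h z\<bar> \<le> (19/20)^n * (4/3 * C)"
proof -
  have l: "lip_Y ((19/20)^n * C) (dual_iter r n h)"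
    using assms by (intro dual_iter_lip)
  then have "\<bar>dual_iter r n h y - dual_iter r n h z\<bar> \<le> (19/20)^n * C * \<bar>y - z\<bar>"
    using assms by (auto simp: lip_Y_def)
  also have "\<dots> \<le> (19/20)^n * C * (4/3)"
  proof (rule mult_left_mono)
    show "\<bar>y - z\<bar> \<le> 4/3"
      using \<open>y \<in> Y\<close> \<open>z \<in> Y\<close> unfolding Y_def abs_le_iff by auto
  qed (use l in \<open>auto simp: lip_Y_def\<close>)
  finally show ?thesis by (simp add: mult_ac)
qed

lemma dual_iter_bounds:
  assumes "\<And>i. r i \<in> Pars" "y \<in> Y" "\<And>u. u \<in> Y \<Longrightarrow> \<bar>h u - c\<bar> \<le> d"
  shows "\<bar>dual_iter r n h y - c\<bar> \<le> d"
  using assms by (induction n arbitrary: r y) (auto intro!: dual_op_bounds)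

lemma dual_iter_add:
  "dual_iter r (n + m) h = dual_iter r n (dual_iter (\<lambda>i. r (n + i)) m h)"
  by (induction n arbitrary: r) auto

lemma dual_iter_mono_par:
  assumes "\<And>i. r i \<in> Pars" "\<And>i. s i \<in> Pars" "\<And>i. i < n \<Longrightarrow> r i \<le> s i" "mono_Y h" "y \<in> Y"
  shows "dual_iter r n h y \<le> dual_iter s n h y"
  using assms
proof (induction n arbitrary: r s y)
  case (Suc n)
  show ?case
    unfolding dual_iter.simps
    using Suc.prems by (intro dual_op_mono Suc.IH dual_iter_mono_Y) auto
qed simp

lemma dual_op_reflect:
  assumes "r \<in> Pars" "y \<in> Y"
  shows "dual_op (- r) h (- y) = dual_op r (\<lambda>u. h (- u)) y"
  using assms by (simp add: dual_op_def branch_reflect weight_reflect algebra_simps)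

lemma dual_op_cong:
  assumes "r \<in> Pars" "y \<in> Y" "\<And>u. u \<in> Y \<Longrightarrow> g u = h u"
  shows "dual_op r g y = dual_op r h y"
  using assms branches_in_Y[OF assms(1,2)] by (simp add: dual_op_def)

lemma dual_iter_odd:
  assumes "\<And>i. r i \<in> Pars" "y \<in> Y" and odd: "\<And>u. u \<in> Y \<Longrightarrow> h (- u) = - h u"
  shows "dual_iter (\<lambda>i. - r i) n h (- y) = - dual_iter r n h y"
  using assms(1,2)
proof (induction n arbitrary: r y)
  case 0
  then show ?case using odd by simp
next
  case (Suc n)
  let ?r = "\<lambda>i. r (Suc i)"
  have "dual_iter (\<lambda>i. - r i) (Suc n) h (- y) = dual_op (- r 0) (dual_iter (\<lambda>i. - ?r i) n h) (- y)"
    by simp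
  also have "\<dots> = dual_op (r 0) (\<lambda>u. dual_iter (\<lambda>i. - ?r i) n h (- u)) y"
    using Suc.prems by (intro dual_op_reflect) auto
  also have "\<dots> = dual_op (r 0) (\<lambda>u. - dual_iter ?r n h u) y"
    using Suc.prems by (intro dual_op_cong Suc.IH) auto
  also have "\<dots> = - dual_iter r (Suc n) h y"
    by (simp add: dual_op_def)
  finally show ?case .
qed

text \<open>The point \<open>a\<close> is fixed by \<open>left_branch s\<close> when
  \<open>s = a / (1 - a)\<close>; larger parameters and larger starting points move the image
  further right.\<close>

lemma left_branch_ge:
  assumes "s \<in> Pars" "y \<in> Y" "0 \<le> a" "a \<le> y" "a / (1 - a) \<le> s"
  shows "a \<le> left_branch s y"
proof -
  have a: "a \<in> Y" "a < 1" using assms by (auto simp: Y_def)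
  have "a \<le> s * (1 - a)"
    using assms a by (simp add: divide_le_eq)
  then have "a * (2 + a) \<le> s * (1 - a) * (2 + a)"
    using assms by (intro mult_right_mono) auto
  then have "a * (4 + s * a + (s + a)) \<le> 2 * (s + a)"
    by (simp add: algebra_simps)
  then have "a \<le> left_branch s a"
    using denom_pos[OF assms(1) a(1)] by (simp add: left_branch_def pos_le_divide_eq)
  also have "\<dots> \<le> left_branch s y"
    using assms a by (intro branches_mono)
  finally show ?thesis .
qed

text \<open>The counterpart for right ends: \<open>b\<close> is fixed by
  \<open>right_branch s\<close> when \<open>s = b / (1 + b)\<close>.\<close>

lemma right_branch_le_trap:
  assumes "s \<in> Pars" "y \<in> Y" "b \<in> Y" "0 \<le> b" "y \<le> b" "s \<le> b / (1 + b)"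
  shows "right_branch s y \<le> b"
proof -
  have "s * (1 + b) \<le> b"
    using assms by (simp add: le_divide_eq)
  then have "s * (1 + b) * (2 - b) \<le> b * (2 - b)"
    using assms by (intro mult_right_mono) (auto simp: Y_def)
  then have "2 * (s + b) \<le> b * (4 + s * b - (s + b))"
    by (simp add: algebra_simps)
  then have "right_branch s b \<le> b"
    using denom_pos[OF assms(1,3)] by (simp add: right_branch_def pos_divide_le_eq)
  then show ?thesis
    using branches_mono(2)[OF assms(1,2,3,5)] by simp
qed

lemma dual_op_ge_left:
  assumes "r \<in> Pars" "y \<in> Y" "mono_Y h"
  shows "h (left_branch r y) \<le> dual_op r h y"
proof -
  have "h (left_branch r y) \<le> h (right_branch r y)"
    by (rule mono_YD[OF assms(3) branches_in_Y[OF assms(1,2)] left_le_right[OF assms(1,2)]])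
  then have "right_weight r y * h (left_branch r y) \<le> right_weight r y * h (right_branch r y)"
    using right_weight_bounds[OF assms(1,2)] by (intro mult_left_mono)
  then show ?thesis by (simp add: dual_op_def algebra_simps)
qed

lemma dual_op_le_right:
  assumes "r \<in> Pars" "y \<in> Y" "mono_Y h"
  shows "dual_op r h y \<le> h (right_branch r y)"
proof -
  have "h (left_branch r y) \<le> h (right_branch r y)"
    by (rule mono_YD[OF assms(3) branches_in_Y[OF assms(1,2)] left_le_right[OF assms(1,2)]])
  then have "(1 - right_weight r y) * h (left_branch r y) \<le> (1 - right_weight r y) * h (right_branch r y)"
    using right_weight_bounds[OF assms(1,2)] by (intro mult_left_mono) auto
  then show ?thesis by (simp add: dual_op_def algebra_simps)
qed

text \<open>The evolving measure stays to the right of \<open>a\<close>. It suffices to follow the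
  left branch at each step, as it gives the smaller of the two image points.\<close>

lemma dual_iter_ge_trap:
  assumes "\<And>i. s i \<in> Pars" "y \<in> Y" "0 \<le> a" "a \<le> y" "mono_Y h"
    and "\<And>i. i < n \<Longrightarrow> a / (1 - a) \<le> s i"
  shows "h a \<le> dual_iter s n h y"
  using assms
proof (induction n arbitrary: s y)
  case 0
  then have "a \<in> Y" by (auto simp: Y_def)
  with 0 show ?case by (simp add: mono_Y_def)
next
  case (Suc n)
  have "h a \<le> dual_iter (\<lambda>i. s (Suc i)) n h (left_branch (s 0) y)"
    using Suc.prems by (intro Suc.IH left_branch_ge branches_in_Y) auto
  also have "\<dots> \<le> dual_iter s (Suc n) h y"
    using Suc.prems by (simp add: dual_op_ge_left dual_iter_mono_Y)
  finally show ?case .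
qed

lemma dual_iter_le_trap:
  assumes "\<And>i. s i \<in> Pars" "y \<in> Y" "b \<in> Y" "0 \<le> b" "y \<le> b" "mono_Y h"
    and "\<And>i. i < n \<Longrightarrow> s i \<le> b / (1 + b)"
  shows "dual_iter s n h y \<le> h b"
  using assms
proof (induction n arbitrary: s y)
  case 0
  then show ?case by (simp add: mono_Y_def)
next
  case (Suc n)
  have "dual_iter s (Suc n) h y \<le> dual_iter (\<lambda>i. s (Suc i)) n h (right_branch (s 0) y)"
    using Suc.prems by (simp add: dual_op_le_right dual_iter_mono_Y)
  also have "\<dots> \<le> h b"
    using Suc.prems by (intro Suc.IH right_branch_le_trap branches_in_Y) auto
  finally show ?case .
qed

text \<open>The left end of the support of the measure on kernel parameters that represents the image of
  the uniform density.\<close>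

primrec low_orbit :: "(nat \<Rightarrow> real) \<Rightarrow> nat \<Rightarrow> real" where
  "low_orbit r 0 = 0"
| "low_orbit r (Suc n) = left_branch (r n) (low_orbit r n)"

lemma low_orbit_in_Y: "(\<And>i. r i \<in> Pars) \<Longrightarrow> low_orbit r n \<in> Y"
  by (induction n) (simp_all add: branches_in_Y)

lemma dual_iter_Suc_right:
  "dual_iter r (Suc n) h = dual_iter r n (dual_op (r n) h)"
  using dual_iter_add[of r n "Suc 0" h] by (simp only: add_Suc_right add_0_right dual_iter.simps)

text \<open>The induction peels off the last operator instead of the first, because the left end of
  the support is updated at the late end of the parameter sequence.\<close>

lemma dual_iter_ge_low_orbit:
  assumes r: "\<And>i. r i \<in> Pars"
  shows "mono_Y h \<Longrightarrow> h (low_orbit r n) \<le> dual_iter r n h 0"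
proof (induction n arbitrary: h)
  case 0
  show ?case by simp
next
  case (Suc n)
  have "h (left_branch (r n) (low_orbit r n)) \<le> dual_op (r n) h (low_orbit r n)"
    by (rule dual_op_ge_left[OF r low_orbit_in_Y[OF r] Suc.prems])
  moreover have "dual_op (r n) h (low_orbit r n) \<le> dual_iter r n (dual_op (r n) h) 0"
    by (rule Suc.IH[OF dual_op_mono_Y[OF r Suc.prems]])
  ultimately show ?case
    by (simp only: dual_iter_Suc_right low_orbit.simps)
qed

section \<open>Integration on \<open>X\<close> and the transfer operators\<close>

lemma X_sets [measurable]: "X \<in> sets borel"
  by (simp add: X_def)

lemma space_lam [simp]: "space lam = X"
  by (simp add: lam_def space_restrict_space)

lemma sets_lam: "sets lam = sets (restrict_space borel X)"
  by (auto simp: lam_def sets_restrict_space)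

lemma measurable_lam_cong: "measurable lam N = measurable (restrict_space borel X) N"
  by (rule measurable_cong_sets[OF sets_lam refl])

lemma borel_measurable_lam [measurable (raw)]: "f \<in> borel_measurable borel \<Longrightarrow> f \<in> borel_measurable lam"
  unfolding measurable_lam_cong by (rule measurable_restrict_space1)

lemma X_inter_space [simp]: "X \<inter> space lborel \<in> sets lborel"
  by simp

lemma emeasure_lam_X: "emeasure lam X = 1"
  unfolding lam_def by (subst emeasure_restrict_space) (auto simp: X_def)

interpretation lam: finite_measure lam
  by (rule finite_measureI) (simp add: emeasure_lam_X)

lemma measure_lam_X [simp]: "measure lam X = 1"
  by (simp add: measure_def emeasure_lam_X)

lemma integrable_lam_iff:
  fixes f :: "real \<Rightarrow> real"
  shows "integrable lam f \<longleftrightarrow> set_integrable lborel X f"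
  unfolding lam_def set_integrable_def by (rule integrable_restrict_space) simp

lemma integral_lam:
  fixes f :: "real \<Rightarrow> real"
  shows "(LINT x|lam. f x) = (LBINT x. indicator X x * f x)"
  unfolding lam_def by (subst integral_restrict_space) auto

lemma integrable_lam_bounded:
  fixes f :: "real \<Rightarrow> real"
  assumes "f \<in> borel_measurable lam" "\<And>x. x \<in> X \<Longrightarrow> \<bar>f x\<bar> \<le> B"
  shows "integrable lam f"
  using assms by (intro lam.integrable_const_bound[of f B]) (auto intro!: AE_I2)

lemma integrable_lam_continuous:
  fixes f :: "real \<Rightarrow> real"
  assumes "continuous_on X f"
  shows "integrable lam f"
  unfolding integrable_lam_iff X_def
  using assms unfolding X_def by (rule borel_integrable_atLeastAtMost')

lemma integral_lam_FTC:
  fixes F f :: "real \<Rightarrow> real"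
  assumes "\<And>x. x \<in> X \<Longrightarrow> DERIV F x :> f x" "\<And>x. x \<in> X \<Longrightarrow> isCont f x"
  shows "(LINT x|lam. f x) = F (1/2) - F (-1/2)"
proof -
  have "(LINT x|lam. f x) = (LBINT x. f x * indicator {-1/2..1/2} x)"
    by (simp add: integral_lam X_def mult.commute)
  also have "\<dots> = F (1/2) - F (-1/2)"
    by (rule integral_FTC_Icc_real) (use assms in \<open>auto simp: X_def\<close>)
  finally show ?thesis .
qed

section \<open>The L1 seminorm, the mean and densities\<close>

lemma L1_norm_nonneg [simp]: "0 \<le> L1_norm u"
  by (simp add: L1_norm_def)

lemma L1_norm_cong: "(\<And>x. x \<in> X \<Longrightarrow> u x = v x) \<Longrightarrow> L1_norm u = L1_norm v"
  unfolding L1_norm_def by (intro Bochner_Integration.integral_cong) auto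

lemma L1_norm_le_bound:
  assumes "integrable lam u" "\<And>x. x \<in> X \<Longrightarrow> \<bar>u x\<bar> \<le> B"
  shows "L1_norm u \<le> B"
proof -
  have "L1_norm u \<le> (LINT x|lam. B)"
    unfolding L1_norm_def using assms by (intro integral_mono lam.integrable_const) auto
  also have "\<dots> = B" by simp
  finally show ?thesis .
qed

lemma L1_norm_cong_AE:
  assumes "integrable lam u" "integrable lam v" "ae_eq u v"
  shows "L1_norm u = L1_norm v"
  unfolding L1_norm_def using assms(3)
  by (intro integral_cong_AE) (use assms in \<open>auto simp: ae_eq_def\<close>)

lemma L1_norm_triangle:
  assumes "integrable lam u" "integrable lam v"
  shows "L1_norm (\<lambda>x. u x + v x) \<le> L1_norm u + L1_norm v"
proof -
  have "L1_norm (\<lambda>x. u x + v x) \<le> (LINT x|lam. \<bar>u x\<bar> + \<bar>v x\<bar>)"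
    unfolding L1_norm_def using assms by (intro integral_mono) auto
  then show ?thesis using assms by (simp add: L1_norm_def)
qed

lemma L1_norm_cmult: "L1_norm (\<lambda>x. c * u x) = \<bar>c\<bar> * L1_norm u"
  by (simp add: L1_norm_def abs_mult)

lemma L1_norm_eq_0_iff: "integrable lam u \<Longrightarrow> L1_norm u = 0 \<longleftrightarrow> ae_eq u (\<lambda>x. 0)"
  unfolding L1_norm_def ae_eq_def
  by (subst integral_nonneg_eq_0_iff_AE) auto

lemma L1_dist_eq_0_iff: "integrable lam u \<Longrightarrow> integrable lam v \<Longrightarrow> L1_dist u v = 0 \<longleftrightarrow> ae_eq u v"
  unfolding L1_dist_def by (subst L1_norm_eq_0_iff) (auto simp: ae_eq_def)

lemma L1_dist_nonneg [simp]: "0 \<le> L1_dist u v"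
  by (simp add: L1_dist_def)

lemma L1_dist_commute: "L1_dist u v = L1_dist v u"
  by (simp add: L1_dist_def L1_norm_def abs_minus_commute)

lemma L1_dist_triangle:
  assumes "integrable lam u" "integrable lam v" "integrable lam w"
  shows "L1_dist u w \<le> L1_dist u v + L1_dist v w"
  using L1_norm_triangle[of "\<lambda>x. u x - v x" "\<lambda>x. v x - w x"] assms by (simp add: L1_dist_def)

lemma L1_dist_cong_AE:
  assumes "integrable lam u" "integrable lam v" "integrable lam u'" "integrable lam v'" "ae_eq u u'" "ae_eq v v'"
  shows "L1_dist u v = L1_dist u' v'"
  unfolding L1_dist_def using assms(5,6) unfolding ae_eq_def
  by (intro L1_norm_cong_AE) (use assms in \<open>auto simp: ae_eq_def\<close>)

lemma ae_eq_refl [simp]: "ae_eq u u"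
  by (simp add: ae_eq_def)

lemma ae_eq_sym: "ae_eq u v \<Longrightarrow> ae_eq v u"
  by (auto simp: ae_eq_def elim: eventually_mono)

lemma ae_eq_trans: "ae_eq u v \<Longrightarrow> ae_eq v w \<Longrightarrow> ae_eq u w"
  unfolding ae_eq_def by (erule (1) eventually_elim2) simp

lemma integral_diff_le_L1:
  assumes "integrable lam u" "integrable lam v"
  shows "\<bar>(LINT x|lam. u x) - (LINT x|lam. v x)\<bar> \<le> L1_dist u v"
proof -
  have "(LINT x|lam. u x) - (LINT x|lam. v x) = (LINT x|lam. u x - v x)"
    using assms by simp
  also have "\<bar>\<dots>\<bar> \<le> L1_dist u v"
    unfolding L1_dist_def L1_norm_def by (rule integral_abs_bound)
  finally show ?thesis .
qed

lemma integrable_lam_ident_mult: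
  assumes "integrable lam u"
  shows "integrable lam (\<lambda>x. x * u x)"
proof (rule Bochner_Integration.integrable_bound[OF assms])
  show "AE x in lam. norm (x * u x) \<le> norm (u x)"
  proof (rule AE_I2)
    fix x assume "x \<in> space lam"
    then have "\<bar>x\<bar> \<le> 1" by (auto simp: X_def)
    then show "norm (x * u x) \<le> norm (u x)" by (simp add: abs_mult mult_left_le_one_le)
  qed
qed (use assms in measurable)

lemma phi_lin:
  assumes "integrable lam u" "integrable lam v"
  shows "phi (\<lambda>x. a * u x + b * v x) = a * phi u + b * phi v"
  using assms[THEN integrable_lam_ident_mult] unfolding phi_def
  by (simp add: distrib_left mult.left_commute[of _ a] mult.left_commute[of _ b])

lemma phi_abs_le:
  assumes "integrable lam u"
  shows "\<bar>phi u\<bar> \<le> L1_norm u / 2"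
proof -
  have "\<bar>phi u\<bar> \<le> (LINT x|lam. \<bar>x * u x\<bar>)"
    unfolding phi_def by (rule integral_abs_bound)
  also have "\<dots> \<le> (LINT x|lam. \<bar>u x\<bar> / 2)"
  proof (rule integral_mono)
    fix x assume "x \<in> space lam"
    then have "\<bar>x\<bar> \<le> 1/2" by (auto simp: X_def)
    then have "\<bar>x\<bar> * \<bar>u x\<bar> \<le> 1/2 * \<bar>u x\<bar>" by (intro mult_right_mono) auto
    then show "\<bar>x * u x\<bar> \<le> \<bar>u x\<bar> / 2" by (simp add: abs_mult)
  qed (use assms integrable_lam_ident_mult[OF assms] in auto)
  finally show ?thesis by (simp add: L1_norm_def)
qed

lemma phi_diff_le:
  assumes "integrable lam u" "integrable lam v"
  shows "\<bar>phi u - phi v\<bar> \<le> L1_dist u v / 2"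
  using phi_abs_le[of "\<lambda>x. u x - v x"] phi_lin[OF assms, of 1 "-1"] assms by (simp add: L1_dist_def)

lemma phi_cong: "(\<And>x. x \<in> X \<Longrightarrow> u x = v x) \<Longrightarrow> phi u = phi v"
  unfolding phi_def by (intro Bochner_Integration.integral_cong) auto

lemma phi_cong_AE:
  assumes "integrable lam u" "integrable lam v" "ae_eq u v"
  shows "phi u = phi v"
  using phi_diff_le[OF assms(1,2)] L1_dist_eq_0_iff[OF assms(1,2)] assms(3) by simp

lemma densitiesD:
  assumes "u \<in> densities"
  shows "integrable lam u" "(LINT x|lam. u x) = 1" "L1_norm u = 1"
proof -
  show "integrable lam u" "(LINT x|lam. u x) = 1" using assms by (auto simp: densities_def)
  have "L1_norm u = (LINT x|lam. u x)"
    unfolding L1_norm_def using assms by (intro integral_cong_AE) (auto simp: densities_def)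
  then show "L1_norm u = 1" using assms by (simp add: densities_def)
qed

lemma phi_density_in_X: "u \<in> densities \<Longrightarrow> phi u \<in> X"
  using phi_abs_le[of u] densitiesD[of u] by (auto simp: X_def)

section \<open>Inverse branches and the explicit transfer operator\<close>

definition inv_left :: "real \<Rightarrow> real \<Rightarrow> real" where
  "inv_left r x = (2 * x - r - 1) / (r + 4 - 2 * r * x)"

definition inv_right :: "real \<Rightarrow> real \<Rightarrow> real" where
  "inv_right r x = (2 * x + 1 - r) / (4 - r - 2 * r * x)"

definition jac_left :: "real \<Rightarrow> real \<Rightarrow> real" where
  "jac_left r x = (8 - 2 * r\<^sup>2) / (r + 4 - 2 * r * x)\<^sup>2"

definition jac_right :: "real \<Rightarrow> real \<Rightarrow> real" where
  "jac_right r x = (8 - 2 * r\<^sup>2) / (4 - r - 2 * r * x)\<^sup>2"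

text \<open>A concrete representative of the Perron-Frobenius image. Linearity and the action on
  kernels hold for it at every point of \<open>X\<close>, whereas \<open>PF\<close> is known only up
  to null sets.\<close>

definition transfer_op :: "real \<Rightarrow> (real \<Rightarrow> real) \<Rightarrow> real \<Rightarrow> real" where
  "transfer_op r u x = jac_left r x * u (inv_left r x) + jac_right r x * u (inv_right r x)"

lemma transfer_denoms:
  assumes "r \<in> Pars" "x \<in> X"
  shows "3 \<le> r + 4 - 2 * r * x" "3 \<le> 4 - r - 2 * r * x"
proof -
  have "\<bar>r * x\<bar> \<le> 2/5 * (1/2)"
    unfolding abs_mult using assms by (intro mult_mono) (auto simp: X_def Pars_def)
  then have "\<bar>r * x\<bar> \<le> 1/5" by simp
  then show "3 \<le> r + 4 - 2 * r * x" "3 \<le> 4 - r - 2 * r * x"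
    using assms(1) by (auto simp: abs_le_iff Pars_def)
qed

lemma jac_nonneg:
  assumes "r \<in> Pars"
  shows "0 \<le> jac_left r x" "0 \<le> jac_right r x"
  using Pars_sq[OF assms] by (auto simp: jac_left_def jac_right_def)

lemma inv_left_deriv:
  assumes "r + 4 - 2 * r * x \<noteq> 0"
  shows "(inv_left r has_real_derivative jac_left r x) (at x)"
  unfolding inv_left_def jac_left_def using assms
  by (auto intro!: derivative_eq_intros simp: power2_eq_square field_simps)

lemma inv_right_deriv:
  assumes "4 - r - 2 * r * x \<noteq> 0"
  shows "(inv_right r has_real_derivative jac_right r x) (at x)"
  unfolding inv_right_def jac_right_def using assms
  by (auto intro!: derivative_eq_intros simp: power2_eq_square field_simps)

lemma inv_endpoints:
  assumes "r \<in> Pars"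
  shows "inv_left r (-1/2) = -1/2" "inv_left r (1/2) = - r/4"
    "inv_right r (-1/2) = - r/4" "inv_right r (1/2) = 1/2"
  using assms by (auto simp: inv_left_def inv_right_def Pars_def field_simps)

lemma inv_mono:
  assumes "r \<in> Pars" "x \<in> X" "y \<in> X" "x \<le> y"
  shows "inv_left r x \<le> inv_left r y" "inv_right r x \<le> inv_right r y"
proof -
  have d: "r + 4 - 2 * r * z \<noteq> 0" "4 - r - 2 * r * z \<noteq> 0" if "z \<in> {x..y}" for z
    using transfer_denoms[OF assms(1), of z] that assms by (auto simp: X_def)
  show "inv_left r x \<le> inv_left r y"
    by (rule deriv_nonneg_imp_mono[of x y "inv_left r" "jac_left r"])
      (use assms d in \<open>auto intro: inv_left_deriv jac_nonneg\<close>)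
  show "inv_right r x \<le> inv_right r y"
    by (rule deriv_nonneg_imp_mono[of x y "inv_right r" "jac_right r"])
      (use assms d in \<open>auto intro: inv_right_deriv jac_nonneg\<close>)
qed

lemma inv_range:
  assumes "r \<in> Pars" "x \<in> X"
  shows "inv_left r x \<in> {-1/2..-r/4}" "inv_right r x \<in> {-r/4..1/2}"
  using inv_mono[OF assms(1), of "-1/2" x, unfolded inv_endpoints[OF assms(1)]]
    inv_mono[OF assms(1), of x "1/2", unfolded inv_endpoints[OF assms(1)]] assms(2)
  by (auto simp: X_def)

lemma inv_in_X:
  assumes "r \<in> Pars" "x \<in> X"
  shows "inv_left r x \<in> X" "inv_right r x \<in> X"
  using inv_range[OF assms] assms(1) by (auto simp: X_def Pars_def)

lemma continuous_on_jac:
  assumes "r \<in> Pars"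
  shows "continuous_on X (jac_left r)" "continuous_on X (jac_right r)"
  unfolding jac_left_def jac_right_def
  using transfer_denoms[OF assms] by (auto intro!: continuous_intros; fastforce)+

text \<open>Change of variables on each branch; the ranges of the two inverse branches cover
  \<open>X\<close> and overlap only in the branch point \<open>- r/4\<close>.\<close>

lemma transfer_op_integral:
  assumes r: "r \<in> Pars" and u: "integrable lam u"
  shows "integrable lam (transfer_op r u)" "(LINT x|lam. transfer_op r u x) = (LINT x|lam. u x)"
proof -
  have int: "set_integrable lborel {-1/2..-r/4} u" "set_integrable lborel {-r/4..1/2} u"
    using u r unfolding integrable_lam_iff
    by (auto elim!: set_integrable_subset simp: X_def Pars_def)
  have der: "\<And>x. x \<in> {-1/2..1/2} \<Longrightarrow> (inv_left r has_real_derivative jac_left r x) (at x)"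
    "\<And>x. x \<in> {-1/2..1/2} \<Longrightarrow> (inv_right r has_real_derivative jac_right r x) (at x)"
    using transfer_denoms[OF r] unfolding X_def by (intro inv_left_deriv inv_right_deriv; fastforce)+
  note sl = integral_substitution[of "inv_left r" "-1/2" "1/2" u "jac_left r",
      unfolded inv_endpoints[OF r], OF int(1) der(1) continuous_on_jac(1)[OF r, unfolded X_def] jac_nonneg(1)[OF r]]
  note sr = integral_substitution[of "inv_right r" "-1/2" "1/2" u "jac_right r",
      unfolded inv_endpoints[OF r], OF int(2) der(2) continuous_on_jac(2)[OF r, unfolded X_def] jac_nonneg(2)[OF r]]
  have i: "integrable lam (\<lambda>x. u (inv_left r x) * jac_left r x)"
    "integrable lam (\<lambda>x. u (inv_right r x) * jac_right r x)"
    using sl(1) sr(1) by (auto simp: integrable_lam_iff X_def)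
  then show "integrable lam (transfer_op r u)"
    unfolding transfer_op_def by (simp add: mult.commute)
  have "(LINT x|lam. transfer_op r u x) =
      (LINT x|lam. u (inv_left r x) * jac_left r x) + (LINT x|lam. u (inv_right r x) * jac_right r x)"
    using i by (simp add: transfer_op_def mult.commute)
  also have "\<dots> = (LBINT x. u x * indicator {-1/2..-r/4} x) + (LBINT x. u x * indicator {-r/4..1/2} x)"
    using sl(2) sr(2) by (simp add: integral_lam X_def mult_ac)
  also have "\<dots> = (LBINT x. u x * indicator {-1/2..-r/4} x + u x * indicator {-r/4..1/2} x)"
    using int by (intro Bochner_Integration.integral_add[symmetric]) (auto simp: set_integrable_def mult.commute)
  also have "\<dots> = (LBINT x. indicator X x * u x)"
  proof (rule integral_cong_AE)
    show "AE x in lborel. u x * indicator {-1/2..-r/4} x + u x * indicator {-r/4..1/2} x = indicator X x * u x"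
      using AE_lborel_singleton[of "-r/4"]
      by eventually_elim (use r in \<open>auto simp: X_def Pars_def indicator_def\<close>)
    show "(\<lambda>x. u x * indicator {-1/2..-r/4} x + u x * indicator {-r/4..1/2} x) \<in> borel_measurable lborel"
      using int by (auto simp: set_integrable_def mult.commute intro!: borel_measurable_add dest: borel_measurable_integrable)
    show "(\<lambda>x. indicator X x * u x) \<in> borel_measurable lborel"
      using u unfolding integrable_lam_iff set_integrable_def by (auto dest: borel_measurable_integrable)
  qed
  finally show "(LINT x|lam. transfer_op r u x) = (LINT x|lam. u x)"
    by (simp add: integral_lam)
qed

lemma T_map_in_X:
  assumes "r \<in> Pars" "x \<in> X"
  shows "T_map r x \<in> X"
proof -
  have "\<bar>r * x\<bar> \<le> 2/5 * (1/2)"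
    unfolding abs_mult using assms by (intro mult_mono) (auto simp: X_def Pars_def)
  then have d: "0 < 2 * r * x + 2"
    by (auto simp: abs_le_iff)
  have p: "0 \<le> (r + 2) * (2 * x + 1)" "0 \<le> (2 - r) * (1 - 2 * x)"
    using assms by (auto simp: X_def Pars_def intro!: mult_nonneg_nonneg)
  have "- 1/2 \<le> f_map r x" "f_map r x \<le> 3/2"
    using d p by (auto simp: f_map_def field_simps)
  moreover have "x \<le> - r/4 \<Longrightarrow> f_map r x \<le> 1/2" "- r/4 \<le> x \<Longrightarrow> 1/2 \<le> f_map r x"
    using d by (auto simp: f_map_def field_simps)
  ultimately show ?thesis by (auto simp: T_map_def X_def)
qed

lemma T_map_measurable: "T_map r \<in> borel_measurable borel"
  unfolding T_map_def f_map_def by measurable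

lemma T_map_measurable_lam:
  assumes "r \<in> Pars"
  shows "T_map r \<in> measurable lam lam"
proof -
  have "T_map r \<in> measurable (restrict_space borel X) (restrict_space borel X)"
    using T_map_in_X[OF assms] by (intro measurable_restrict_space3 T_map_measurable) auto
  then show ?thesis
    using measurable_cong_sets[OF sets_lam sets_lam] by blast
qed

text \<open>The exception at \<open>1/2\<close> arises because \<open>inv_left r (1/2)\<close> is
  the branch point, which \<open>T_map\<close> assigns to the right branch.\<close>

lemma T_map_inv:
  assumes r: "r \<in> Pars" and x: "x \<in> X"
  shows "T_map r (inv_right r x) = x" "x \<noteq> 1/2 \<Longrightarrow> T_map r (inv_left r x) = x"
proof -
  note d = transfer_denoms[OF r x]
  have r2: "4 - r\<^sup>2 \<noteq> 0" using Pars_sq[OF r] by auto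
  have fr: "f_map r (inv_right r x) = x + 1"
  proof -
    have n: "(r + 4) * inv_right r x + (r + 1) = (x + 1) * (8 - 2 * r\<^sup>2) / (4 - r - 2 * r * x)"
      using d by (simp add: inv_right_def field_simps power2_eq_square)
    have m: "2 * r * inv_right r x + 2 = (8 - 2 * r\<^sup>2) / (4 - r - 2 * r * x)"
      using d by (simp add: inv_right_def field_simps power2_eq_square)
    show ?thesis unfolding f_map_def n m using d r2 by simp
  qed
  have fl: "f_map r (inv_left r x) = x"
  proof -
    have n: "(r + 4) * inv_left r x + (r + 1) = x * (8 - 2 * r\<^sup>2) / (r + 4 - 2 * r * x)"
      using d by (simp add: inv_left_def field_simps power2_eq_square)
    have m: "2 * r * inv_left r x + 2 = (8 - 2 * r\<^sup>2) / (r + 4 - 2 * r * x)"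
      using d by (simp add: inv_left_def field_simps power2_eq_square)
    show ?thesis unfolding f_map_def n m using d r2 by simp
  qed
  show "T_map r (inv_right r x) = x"
    using inv_range(2)[OF r x] by (simp add: T_map_def fr)
  have f4: "f_map r (- r/4) = 1/2"
    using r2 r by (auto simp: f_map_def field_simps power2_eq_square)
  show "x \<noteq> 1/2 \<Longrightarrow> T_map r (inv_left r x) = x"
    using inv_range(1)[OF r x] fl f4 by (auto simp: T_map_def order.order_iff_strict)
qed

text \<open>Off the point \<open>1/2\<close> the factor \<open>\<psi>\<close> can be moved inside:
  \<open>transfer_op r u * \<psi>\<close> is the transfer of \<open>u\<close> times
  \<open>\<psi>\<close> composed with \<open>T_map r\<close>. The duality then reduces to
  preservation of the integral.\<close>

lemma transfer_op_is_PF_image: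
  assumes r: "r \<in> Pars" and u: "integrable lam u"
  shows "is_PF_image r u (transfer_op r u)"
  unfolding is_PF_image_def
proof (intro conjI ballI impI)
  show "integrable lam (transfer_op r u)" using transfer_op_integral[OF r u] by simp
  fix \<psi> :: "real \<Rightarrow> real"
  assume m: "\<psi> \<in> borel_measurable lam" and "bounded (\<psi> ` X)"
  then obtain B where B: "\<And>x. x \<in> X \<Longrightarrow> \<bar>\<psi> x\<bar> \<le> B" by (auto simp: bounded_iff)
  have mT: "(\<lambda>x. \<psi> (T_map r x)) \<in> borel_measurable lam"
    using measurable_compose[OF T_map_measurable_lam[OF r] m] .
  let ?F = "\<lambda>x. u x * \<psi> (T_map r x)"
  have iF: "integrable lam ?F"
    using mT u B T_map_in_X[OF r]
    by (intro Bochner_Integration.integrable_bound[of lam "\<lambda>x. B * u x" ?F])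
      (auto intro!: AE_I2 simp: abs_mult mult.commute[of "\<bar>u _\<bar>"] intro!: mult_right_mono order_trans[OF B])
  have "(LINT x|lam. transfer_op r u x * \<psi> x) = (LINT x|lam. transfer_op r ?F x)"
  proof (rule integral_cong_AE)
    have "AE x in lam. x \<noteq> 1/2"
      unfolding lam_def by (subst AE_restrict_space_iff) (auto intro: eventually_mono[OF AE_lborel_singleton[of "1/2"]])
    moreover have "AE x in lam. x \<in> X" by (rule AE_I2) simp
    ultimately show "AE x in lam. transfer_op r u x * \<psi> x = transfer_op r ?F x"
      by eventually_elim (simp add: transfer_op_def T_map_inv[OF r] algebra_simps)
  qed (use m transfer_op_integral(1)[OF r iF] transfer_op_integral(1)[OF r u] in auto)
  also have "\<dots> = (LINT x|lam. ?F x)"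
    by (rule transfer_op_integral(2)[OF r iF])
  finally show "(LINT x|lam. transfer_op r u x * \<psi> x) = (LINT x|lam. u x * \<psi> (T_map r x))" .
qed

lemma is_PF_image_unique:
  assumes "is_PF_image r u v" "is_PF_image r u w"
  shows "ae_eq v w"
proof -
  have i: "integrable lam v" "integrable lam w" using assms by (auto simp: is_PF_image_def)
  \<comment> \<open>Tested against the sign of the difference, the duality computes the L1 distance
    of \<open>v\<close> and \<open>w\<close>.\<close>
  let ?\<psi> = "\<lambda>x. sgn (v x - w x)"
  have m: "?\<psi> \<in> borel_measurable lam" using i by measurable
  have b: "bounded (?\<psi> ` X)" by (rule boundedI[of _ 1]) (auto simp: sgn_real_def)
  have iv: "integrable lam (\<lambda>x. v x * ?\<psi> x)" "integrable lam (\<lambda>x. w x * ?\<psi> x)"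
    using i m
    by (auto intro!: Bochner_Integration.integrable_bound[OF i(1), of "\<lambda>x. v x * ?\<psi> x"]
        Bochner_Integration.integrable_bound[OF i(2), of "\<lambda>x. w x * ?\<psi> x"] AE_I2 simp: abs_mult abs_sgn_eq)
  have "L1_dist v w = (LINT x|lam. v x * ?\<psi> x - w x * ?\<psi> x)"
    unfolding L1_dist_def L1_norm_def
    by (intro Bochner_Integration.integral_cong) (auto simp: sgn_real_def)
  also have "\<dots> = 0"
    using assms m b iv by (simp add: is_PF_image_def)
  finally show ?thesis using L1_dist_eq_0_iff[OF i] by simp
qed

lemma PF_ae_transfer:
  assumes "r \<in> Pars" "integrable lam u"
  shows "integrable lam (PF r u)" "ae_eq (PF r u) (transfer_op r u)"
proof -
  have *: "is_PF_image r u (PF r u)"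
    unfolding PF_def by (rule someI[of "is_PF_image r u", OF transfer_op_is_PF_image[OF assms]])
  then show "integrable lam (PF r u)" by (simp add: is_PF_image_def)
  show "ae_eq (PF r u) (transfer_op r u)"
    by (rule is_PF_image_unique[OF * transfer_op_is_PF_image[OF assms]])
qed

lemma transfer_op_lin:
  "transfer_op r (\<lambda>x. a * u x + b * v x) x = a * transfer_op r u x + b * transfer_op r v x"
  by (simp add: transfer_op_def algebra_simps)

lemma transfer_op_diff: "transfer_op r (\<lambda>x. u x - v x) x = transfer_op r u x - transfer_op r v x"
  by (simp add: transfer_op_def algebra_simps)

lemma transfer_op_cong:
  assumes "r \<in> Pars" "\<And>x. x \<in> X \<Longrightarrow> u x = v x" "x \<in> X"
  shows "transfer_op r u x = transfer_op r v x"
  using assms by (simp add: transfer_op_def inv_in_X)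

lemma transfer_op_L1:
  assumes r: "r \<in> Pars" and u: "integrable lam u"
  shows "L1_norm (transfer_op r u) \<le> L1_norm u"
proof -
  have a: "integrable lam (\<lambda>x. \<bar>u x\<bar>)" using u by simp
  have "L1_norm (transfer_op r u) \<le> (LINT x|lam. transfer_op r (\<lambda>x. \<bar>u x\<bar>) x)"
    unfolding L1_norm_def
  proof (rule integral_mono)
    show "\<bar>transfer_op r u x\<bar> \<le> transfer_op r (\<lambda>x. \<bar>u x\<bar>) x" for x
      unfolding transfer_op_def using jac_nonneg[OF r, of x]
      by (intro order_trans[OF abs_triangle_ineq]) (simp add: abs_mult)
  qed (use transfer_op_integral(1)[OF r u] transfer_op_integral(1)[OF r a] in auto)
  also have "\<dots> = L1_norm u" unfolding transfer_op_integral(2)[OF r a] L1_norm_def ..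
  finally show ?thesis .
qed

lemma transfer_op_L1_dist:
  assumes "r \<in> Pars" "integrable lam u" "integrable lam v"
  shows "L1_dist (transfer_op r u) (transfer_op r v) \<le> L1_dist u v"
  using transfer_op_L1[of r "\<lambda>x. u x - v x"] assms by (simp add: L1_dist_def transfer_op_diff[abs_def])

lemma transfer_op_cong_AE:
  assumes "r \<in> Pars" "integrable lam u" "integrable lam v" "ae_eq u v"
  shows "ae_eq (transfer_op r u) (transfer_op r v)"
  using transfer_op_L1_dist[OF assms(1-3)] L1_dist_eq_0_iff[OF assms(2,3)] assms(4)
    L1_dist_eq_0_iff[of "transfer_op r u" "transfer_op r v"] transfer_op_integral(1)[OF assms(1)] assms(2,3)
  by (metis L1_dist_nonneg order_antisym)

lemma transfer_op_density:
  assumes "r \<in> Pars" "u \<in> densities"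
  shows "transfer_op r u \<in> densities"
proof -
  have i: "integrable lam u" using assms densitiesD by blast
  \<comment> \<open>As \<open>u\<close> is nonnegative only almost everywhere, positivity is read
    off from the representative given by its absolute value.\<close>
  have a: "integrable lam (\<lambda>x. \<bar>u x\<bar>)" using i by simp
  have "ae_eq u (\<lambda>x. \<bar>u x\<bar>)" using assms(2) by (auto simp: densities_def ae_eq_def elim: eventually_mono)
  then have "ae_eq (transfer_op r u) (transfer_op r (\<lambda>x. \<bar>u x\<bar>))"
    using assms i by (intro transfer_op_cong_AE) auto
  moreover have "0 \<le> transfer_op r (\<lambda>x. \<bar>u x\<bar>) x" for x
    using jac_nonneg[OF assms(1)] by (simp add: transfer_op_def)
  ultimately have "AE x in lam. 0 \<le> transfer_op r u x"
    unfolding ae_eq_def by (auto elim: eventually_mono)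
  then show ?thesis
    using transfer_op_integral[OF assms(1) i] densitiesD[OF assms(2)] by (simp add: densities_def)
qed

section \<open>The invariant cone of kernel densities\<close>

text \<open>The derivative of a Moebius map of \<open>X\<close> onto itself, whence its total mass
  1.\<close>

definition kern :: "real \<Rightarrow> real \<Rightarrow> real" where
  "kern y x = (1 - y\<^sup>2 / 4) / (1 - x * y)\<^sup>2"

definition kern_mean :: "real \<Rightarrow> real" where
  "kern_mean y = phi (kern y)"

lemma xy_bound:
  assumes "y \<in> Y" "x \<in> X"
  shows "\<bar>x * y\<bar> \<le> 1/3" "2/3 \<le> 1 - x * y" "\<bar>x * y\<bar> \<le> \<bar>y\<bar> / 2"
proof -
  have x: "\<bar>x\<bar> \<le> 1/2" and y: "\<bar>y\<bar> \<le> 2/3" using assms by (auto simp: X_def Y_def intro!: abs_leI)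
  have "\<bar>x * y\<bar> \<le> 1/2 * \<bar>y\<bar>"
    unfolding abs_mult using x by (intro mult_right_mono) auto
  then show "\<bar>x * y\<bar> \<le> 1/3" "2/3 \<le> 1 - x * y" "\<bar>x * y\<bar> \<le> \<bar>y\<bar> / 2"
    using y by linarith+
qed

lemma kern_0 [simp]: "kern 0 = (\<lambda>x. 1)"
  by (simp add: kern_def fun_eq_iff)

lemma kern_bounds:
  assumes "y \<in> Y" "x \<in> X"
  shows "0 \<le> kern y x" "kern y x \<le> 9/4"
proof -
  have y: "y\<^sup>2 \<le> 4/9" using Y_sq[OF assms(1)] .
  then show "0 \<le> kern y x" by (simp add: kern_def)
  have "(2/3)\<^sup>2 \<le> (1 - x * y)\<^sup>2"
    using xy_bound[OF assms] by (intro power_mono) auto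
  then have "kern y x \<le> 1 / (2/3)\<^sup>2"
    unfolding kern_def using y by (intro frac_le) auto
  then show "kern y x \<le> 9/4" by (simp add: power2_eq_square)
qed

lemma continuous_on_kern:
  assumes "y \<in> Y"
  shows "continuous_on X (kern y)"
  unfolding kern_def using xy_bound(2)[OF assms] by (auto intro!: continuous_intros; fastforce)

lemma integrable_kern: "y \<in> Y \<Longrightarrow> integrable lam (kern y)"
  by (intro integrable_lam_continuous continuous_on_kern)

lemma integral_kern:
  assumes "y \<in> Y"
  shows "(LINT x|lam. kern y x) = 1"
proof -
  have *: "1 - x * y \<noteq> 0" if "x \<in> X" for x using xy_bound(2)[OF assms that] by auto
  have "(LINT x|lam. kern y x) = (1 - y\<^sup>2 / 4) * (1/2) / (1 - (1/2) * y) - (1 - y\<^sup>2 / 4) * (-1/2) / (1 - (-1/2) * y)"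
  proof (rule integral_lam_FTC[where F = "\<lambda>x. (1 - y\<^sup>2 / 4) * x / (1 - x * y)"])
    fix x assume "x \<in> X"
    note n = *[OF this]
    show "((\<lambda>x. (1 - y\<^sup>2 / 4) * x / (1 - x * y)) has_real_derivative kern y x) (at x)"
      unfolding kern_def using n
      by (auto intro!: derivative_eq_intros simp: power2_eq_square divide_simps) (simp add: algebra_simps)
    show "isCont (kern y) x" unfolding kern_def using n by (auto intro!: continuous_intros)
  qed
  also have "\<dots> = 1"
    using *[of "1/2"] *[of "-1/2"] Y_sq[OF assms] by (simp add: X_def power2_eq_square field_simps)
  finally show ?thesis .
qed

lemma kern_density: "y \<in> Y \<Longrightarrow> kern y \<in> densities"
  using integral_kern integrable_kern kern_bounds by (auto simp: densities_def intro!: AE_I2)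

text \<open>A Moebius inverse branch carries \<open>1 - x * y\<close> to a quotient of affine
  functions, and its Jacobian cancels the denominator; what remains is the inverse square of an
  affine function, a multiple of a kernel. The normalizations agree because
  \<open>(4 - r^2) * (4 - y^2)\<close> equals \<open>(A - 2 * s) * (A + 2 * s)\<close> for
  \<open>A = 4 + r * y\<close> and \<open>s = r + y\<close>.\<close>

lemma transfer_kern:
  assumes r: "r \<in> Pars" and y: "y \<in> Y" and x: "x \<in> X"
  shows "transfer_op r (kern y) x = dual_op r (\<lambda>y. kern y x) y"
proof -
  define A where "A = 4 + r * y"
  define s where "s = r + y"
  note d = transfer_denoms[OF r x]
  note p = denom_pos[OF r y, folded A_def s_def]
  have As: "A - 2 * s = (2 - y) * (2 - r)" "A + 2 * s = (2 + y) * (2 + r)"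
    by (simp_all add: A_def s_def algebra_simps)
  have l: "jac_left r x * kern y (inv_left r x) = (4 - r\<^sup>2) * (4 - y\<^sup>2) / (2 * (A + s - 2 * s * x)\<^sup>2)"
  proof -
    have "1 - inv_left r x * y = (A + s - 2 * s * x) / (r + 4 - 2 * r * x)"
      using d by (simp add: inv_left_def field_simps A_def s_def)
    then show ?thesis
      unfolding jac_left_def kern_def using d
      by (simp add: power_divide) (simp add: algebra_simps divide_simps)
  qed
  have r': "jac_right r x * kern y (inv_right r x) = (4 - r\<^sup>2) * (4 - y\<^sup>2) / (2 * (A - s - 2 * s * x)\<^sup>2)"
  proof -
    have "1 - inv_right r x * y = (A - s - 2 * s * x) / (4 - r - 2 * r * x)"
      using d by (simp add: inv_right_def field_simps A_def s_def)
    then show ?thesis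
      unfolding jac_right_def kern_def using d
      by (simp add: power_divide) (simp add: algebra_simps divide_simps)
  qed
  have kl: "kern (left_branch r y) x = A * (A + 2 * s) / (A + s - 2 * s * x)\<^sup>2"
  proof -
    have lb: "left_branch r y = 2 * s / (A + s)" by (simp add: left_branch_def A_def s_def)
    have "1 - x * left_branch r y = (A + s - 2 * s * x) / (A + s)"
      unfolding lb using p by (simp add: field_simps)
    moreover have "1 - (left_branch r y)\<^sup>2 / 4 = A * (A + 2 * s) / (A + s)\<^sup>2"
    proof -
      have "1 - (left_branch r y)\<^sup>2 / 4 = ((A + s)\<^sup>2 - s\<^sup>2) / (A + s)\<^sup>2"
        unfolding lb using p by (simp add: power_divide power_mult_distrib diff_divide_distrib)
      then show ?thesis by (simp add: power2_eq_square algebra_simps)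
    qed
    ultimately show ?thesis
      unfolding kern_def using p by (simp add: power_divide)
  qed
  have kr: "kern (right_branch r y) x = A * (A - 2 * s) / (A - s - 2 * s * x)\<^sup>2"
  proof -
    have rb: "right_branch r y = 2 * s / (A - s)" by (simp add: right_branch_def A_def s_def)
    have "1 - x * right_branch r y = (A - s - 2 * s * x) / (A - s)"
      unfolding rb using p by (simp add: field_simps)
    moreover have "1 - (right_branch r y)\<^sup>2 / 4 = A * (A - 2 * s) / (A - s)\<^sup>2"
    proof -
      have "1 - (right_branch r y)\<^sup>2 / 4 = ((A - s)\<^sup>2 - s\<^sup>2) / (A - s)\<^sup>2"
        unfolding rb using p by (simp add: power_divide power_mult_distrib diff_divide_distrib)
      then show ?thesis by (simp add: power2_eq_square algebra_simps)
    qed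
    ultimately show ?thesis
      unfolding kern_def using p by (simp add: power_divide)
  qed
  have q: "right_weight r y = (A + 2 * s) / (2 * A)" "1 - right_weight r y = (A - 2 * s) / (2 * A)"
    using p unfolding right_weight_def by (simp_all add: A_def s_def field_simps)
  have num: "(4 - r\<^sup>2) * (4 - y\<^sup>2) = (A - 2 * s) * (A + 2 * s)"
    unfolding As by (simp add: algebra_simps power2_eq_square)
  have "(A - 2 * s) / (2 * A) * (A * (A + 2 * s) / L) = (A - 2 * s) * (A + 2 * s) / (2 * L)"
    "(A + 2 * s) / (2 * A) * (A * (A - 2 * s) / L) = (A - 2 * s) * (A + 2 * s) / (2 * L)" for L
    using p by (simp_all add: mult.commute)
  then show ?thesis
    unfolding transfer_op_def dual_op_def l r' kl kr num q(2) unfolding q(1) by (simp only:)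
qed

lemma kern_lip:
  assumes x: "x \<in> X"
  shows "lip_Y 5 (\<lambda>y. kern y x)"
  unfolding lip_Y_def
proof (intro conjI ballI)
  fix y z assume y: "y \<in> Y" and z: "z \<in> Y"
  define a where "a = 1 / (1 - x * y)"
  define b where "b = 1 / (1 - x * z)"
  note d = xy_bound[OF y x] xy_bound[OF z x]
  have ab: "0 \<le> a" "a \<le> 3/2" "0 \<le> b" "b \<le> 3/2"
    using d by (auto simp: a_def b_def field_simps)
  have ab': "a * b \<le> 3/2 * (3/2)" "b\<^sup>2 \<le> (3/2)\<^sup>2"
    using ab by (intro mult_mono power_mono; simp)+
  have yz: "\<bar>y + z\<bar> \<le> 4/3" using y z unfolding Y_def abs_le_iff by auto
  have xx: "\<bar>x\<bar> \<le> 1/2" using x unfolding X_def abs_le_iff by auto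
  have "a - b = x * (y - z) * (a * b)"
    using d by (simp add: a_def b_def field_simps)
  then have "\<bar>a - b\<bar> = \<bar>x\<bar> * \<bar>y - z\<bar> * (a * b)"
    using ab by (simp add: abs_mult)
  also have "\<dots> \<le> 1/2 * \<bar>y - z\<bar> * (9/4)"
    using xx ab ab' by (intro mult_mono) auto
  finally have d1: "\<bar>a - b\<bar> \<le> 9/8 * \<bar>y - z\<bar>" by simp
  have "a\<^sup>2 - b\<^sup>2 = (a + b) * (a - b)" by (simp add: algebra_simps power2_eq_square)
  then have "\<bar>a\<^sup>2 - b\<^sup>2\<bar> = (a + b) * \<bar>a - b\<bar>" using ab by (simp add: abs_mult)
  also have "\<dots> \<le> 3 * (9/8 * \<bar>y - z\<bar>)" using ab d1 by (intro mult_mono) auto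
  finally have d2: "\<bar>a\<^sup>2 - b\<^sup>2\<bar> \<le> 27/8 * \<bar>y - z\<bar>" by simp
  have y2: "0 \<le> 1 - y\<^sup>2/4" "1 - y\<^sup>2/4 \<le> 1" using Y_sq[OF y] by auto
  have "kern y x - kern z x = (1 - y\<^sup>2/4) * (a\<^sup>2 - b\<^sup>2) + (y + z) / 4 * (z - y) * b\<^sup>2"
    by (simp add: kern_def a_def b_def power_divide algebra_simps power2_eq_square add_divide_distrib diff_divide_distrib)
  also have "\<bar>\<dots>\<bar> \<le> (1 - y\<^sup>2/4) * \<bar>a\<^sup>2 - b\<^sup>2\<bar> + \<bar>y + z\<bar> / 4 * \<bar>y - z\<bar> * b\<^sup>2"
    using y2 by (intro order_trans[OF abs_triangle_ineq]) (simp add: abs_mult abs_minus_commute)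
  also have "\<dots> \<le> 1 * (27/8 * \<bar>y - z\<bar>) + (4/3) / 4 * \<bar>y - z\<bar> * (9/4)"
    using y2 d2 yz ab' by (intro add_mono mult_mono) (auto simp: power2_eq_square)
  also have "\<dots> \<le> 5 * \<bar>y - z\<bar>" by simp
  finally show "\<bar>kern y x - kern z x\<bar> \<le> 5 * \<bar>y - z\<bar>" .
qed simp

lemma kern_L1_dist:
  assumes "y \<in> Y" "z \<in> Y"
  shows "L1_dist (kern y) (kern z) \<le> 5 * \<bar>y - z\<bar>"
  unfolding L1_dist_def
  using assms kern_lip by (intro L1_norm_le_bound) (auto simp: integrable_kern lip_Y_def)

lemma kern_mean_lip: "lip_Y (5/2) kern_mean"
  unfolding lip_Y_def kern_mean_def
  using order_trans[OF phi_diff_le divide_right_mono[OF kern_L1_dist]] by (auto simp: integrable_kern)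

text \<open>A single-crossing argument: for \<open>y < z\<close> the difference of the kernels
  changes sign from minus to plus at one point \<open>x0\<close>, so its product with
  \<open>x - x0\<close> is nonnegative. As both kernels have mass 1, the integral of that product is
  the difference of the means.\<close>

lemma kern_mean_mono: "mono_Y kern_mean"
  unfolding mono_Y_def
proof (intro ballI impI)
  fix y z assume y: "y \<in> Y" and z: "z \<in> Y" and le: "y \<le> z"
  show "kern_mean y \<le> kern_mean z"
  proof (cases "y = z")
    case False
    with le have lt: "y < z" by simp
    define A where "A = sqrt (1 - z\<^sup>2/4)"
    define B where "B = sqrt (1 - y\<^sup>2/4)"
    have AB2: "A\<^sup>2 = 1 - z\<^sup>2/4" "B\<^sup>2 = 1 - y\<^sup>2/4" and AB: "0 < A" "0 < B"
      unfolding A_def B_def using Y_sq[OF y] Y_sq[OF z] by auto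
    define c where "c = B * z - A * y"
    \<comment> \<open>Equivalent to the monotonicity of \<open>y / sqrt (1 - y^2/4)\<close>; the
      cases are the possible signs of \<open>y\<close> and \<open>z\<close>.\<close>
    have "A * y < B * z"
    proof (cases "y < 0 \<and> 0 \<le> z")
      case True
      then have "A * y < 0" "0 \<le> B * z" using AB by (auto simp: mult_pos_neg)
      then show ?thesis by simp
    next
      case False
      have "A * y \<le> B * y"
      proof (cases "0 \<le> y")
        case True
        then have "A \<le> B" unfolding A_def B_def using lt by (simp add: power_mono)
        then show ?thesis using True by (intro mult_right_mono)
      next
        case neg: False
        then have "z < 0" using False by auto
        then have "(- z)\<^sup>2 \<le> (- y)\<^sup>2" using lt by (intro power_mono) auto
        then have "B \<le> A" unfolding A_def B_def by simp
        then show ?thesis using neg by (intro mult_right_mono_neg) auto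
      qed
      also have "B * y < B * z" using lt AB by simp
      finally show ?thesis .
    qed
    then have c: "0 < c" by (simp add: c_def)
    \<comment> \<open>The square roots of the kernels are \<open>A / (1 - x * z)\<close> and
      \<open>B / (1 - x * y)\<close>; the numerator of their difference is affine in
      \<open>x\<close> with slope \<open>c\<close> and zero \<open>x0\<close>.\<close>
    define x0 where "x0 = (B - A) / c"
    have i: "integrable lam (kern y)" "integrable lam (kern z)" "integrable lam (\<lambda>x. kern z x - kern y x)"
      using y z integrable_kern by auto
    note i' = i[THEN integrable_lam_ident_mult]
    have nn: "0 \<le> (x - x0) * (kern z x - kern y x)" if x: "x \<in> X" for x
    proof -
      define P where "P = A / (1 - x * z)"
      define Q where "Q = B / (1 - x * y)"
      note d = xy_bound[OF y x] xy_bound[OF z x]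
      have PQ: "0 \<le> P" "0 \<le> Q" using d AB by (auto simp: P_def Q_def)
      have "kern z x - kern y x = P\<^sup>2 - Q\<^sup>2"
        by (simp add: kern_def P_def Q_def power_divide AB2)
      also have "\<dots> = (P + Q) * (P - Q)" by (simp add: algebra_simps power2_eq_square)
      also have "P - Q = c * (x - x0) / ((1 - x * z) * (1 - x * y))"
      proof -
        have "c * x0 = B - A" using c by (simp add: x0_def)
        then have "c * (x - x0) = c * x - (B - A)" by (simp add: right_diff_distrib)
        also have "\<dots> = A * (1 - x * y) - B * (1 - x * z)" by (simp add: c_def algebra_simps)
        finally have "c * (x - x0) = A * (1 - x * y) - B * (1 - x * z)" .
        then show ?thesis
          using d unfolding P_def Q_def by (subst diff_frac_eq) auto
      qed
      finally have "(x - x0) * (kern z x - kern y x) =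
          (P + Q) * c * (x - x0)\<^sup>2 / ((1 - x * z) * (1 - x * y))"
        by (simp add: power2_eq_square mult_ac)
      then show ?thesis using PQ c d by simp
    qed
    have "0 \<le> (LINT x|lam. (x - x0) * (kern z x - kern y x))"
      using nn by (intro integral_nonneg_AE AE_I2) auto
    also have "\<dots> = (LINT x|lam. x * kern z x - x * kern y x - x0 * (kern z x - kern y x))"
      by (simp add: algebra_simps)
    also have "\<dots> = kern_mean z - kern_mean y - x0 * (1 - 1)"
      using i i' y z by (simp add: kern_mean_def phi_def integral_kern)
    finally show ?thesis by simp
  qed simp
qed

lemma integral_lam_reflect: "(LINT x|lam. f (- x)) = (LINT x|lam. f x :: real)"
proof -
  have "(LBINT x. indicator X x * f x) = (LBINT x. indicator X (- x) * f (- x))"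
    using lborel_integral_real_affine[of "-1" "\<lambda>x. indicator X x * f x" 0] by simp
  also have "\<dots> = (LBINT x. indicator X x * f (- x))"
    by (rule Bochner_Integration.integral_cong) (auto simp: X_def indicator_def)
  finally show ?thesis by (simp add: integral_lam)
qed

lemma kern_mean_odd: "kern_mean (- y) = - kern_mean y"
  using integral_lam_reflect[of "\<lambda>x. x * kern (- y) x"]
  by (simp add: kern_mean_def phi_def kern_def)

lemma kern_mean_0 [simp]: "kern_mean 0 = 0"
  using kern_mean_odd[of 0] by simp

lemma integral_lam_ident_sq: "(LINT x|lam. x\<^sup>2) = 1/12"
  by (subst integral_lam_FTC[where F = "\<lambda>x. x^3 / 3"])
    (auto intro!: derivative_eq_intros simp: power2_eq_square power3_eq_cube)

lemma integral_lam_ident: "(LINT x|lam. x) = 0"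
  by (subst integral_lam_FTC[where F = "\<lambda>x. x^2 / 2"])
    (auto intro!: derivative_eq_intros simp: power2_eq_square)

lemma kern_taylor:
  assumes y: "y \<in> Y" and x: "x \<in> X"
  shows "\<bar>kern y x - (1 + 2 * (x * y))\<bar> \<le> 3 * y\<^sup>2"
proof -
  define t where "t = x * y"
  note d = xy_bound[OF y x, folded t_def]
  have t2: "t\<^sup>2 \<le> y\<^sup>2 / 4"
    using power_mono[OF d(3), of 2] by (simp add: power_divide)
  have lb: "(2/3)\<^sup>2 \<le> (1 - t)\<^sup>2" using d by (intro power_mono) auto
  have n: "(1 - t)\<^sup>2 \<noteq> 0" using d by auto
  have "kern y x - (1 + 2 * t) = (t\<^sup>2 * (3 - 2 * t) - y\<^sup>2 / 4) / (1 - t)\<^sup>2"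
  proof -
    have "kern y x - (1 + 2 * t) = (1 - y\<^sup>2 / 4 - (1 + 2 * t) * (1 - t)\<^sup>2) / (1 - t)\<^sup>2"
      using n by (simp add: kern_def t_def diff_divide_distrib)
    also have "1 - y\<^sup>2 / 4 - (1 + 2 * t) * (1 - t)\<^sup>2 = t\<^sup>2 * (3 - 2 * t) - y\<^sup>2 / 4"
      by (simp add: algebra_simps power2_eq_square)
    finally show ?thesis .
  qed
  also have "\<bar>\<dots>\<bar> \<le> (y\<^sup>2 * (7/6)) / (2/3)\<^sup>2"
    unfolding abs_divide
  proof (intro frac_le)
    have "\<bar>t\<^sup>2 * (3 - 2 * t)\<bar> \<le> (y\<^sup>2 / 4) * (11/3)"
      unfolding abs_mult using t2 d by (intro mult_mono) auto
    then show "\<bar>t\<^sup>2 * (3 - 2 * t) - y\<^sup>2 / 4\<bar> \<le> y\<^sup>2 * (7/6)"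
      by (intro order_trans[OF abs_triangle_ineq4]) auto
  qed (use lb in auto)
  also have "\<dots> \<le> 3 * y\<^sup>2" by (simp add: power2_eq_square)
  finally show ?thesis by (simp add: t_def)
qed

text \<open>To first order the kernel is \<open>1 + 2 * x * y\<close>, and its mean is
  \<open>2 * y\<close> times the second moment 1/12. This supplies the slope of
  \<open>kern_mean\<close> at 0.\<close>

lemma kern_mean_taylor:
  assumes y: "y \<in> Y"
  shows "\<bar>kern_mean y - y/6\<bar> \<le> 3/2 * y\<^sup>2"
proof -
  have i: "integrable lam (\<lambda>x. 1 + 2 * (x * y))"
    by (intro integrable_lam_continuous continuous_intros)
  have i2: "integrable lam (\<lambda>x. x)" "integrable lam (\<lambda>x. x\<^sup>2)"
    by (intro integrable_lam_continuous continuous_intros)+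
  have "phi (\<lambda>x. 1 + 2 * (x * y)) = (LINT x|lam. x + (2 * y) * x\<^sup>2)"
    unfolding phi_def by (intro Bochner_Integration.integral_cong) (auto simp: algebra_simps power2_eq_square)
  also have "\<dots> = y/6"
    using i2 by (simp add: integral_lam_ident integral_lam_ident_sq)
  finally have e: "phi (\<lambda>x. 1 + 2 * (x * y)) = y/6" .
  have "\<bar>kern_mean y - y/6\<bar> \<le> L1_dist (kern y) (\<lambda>x. 1 + 2 * (x * y)) / 2"
    using phi_diff_le[OF integrable_kern[OF y] i] by (simp only: kern_mean_def e)
  also have "\<dots> \<le> 3 * y\<^sup>2 / 2"
    unfolding L1_dist_def using i integrable_kern[OF y] kern_taylor[OF y]
    by (intro divide_right_mono L1_norm_le_bound) auto
  finally show ?thesis by simp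
qed

section \<open>Compositions of transfer operators and their duality with
  \<open>dual_iter\<close>\<close>

primrec pf_iter :: "(nat \<Rightarrow> real) \<Rightarrow> nat \<Rightarrow> (real \<Rightarrow> real) \<Rightarrow> real \<Rightarrow> real" where
  "pf_iter r 0 u = u"
| "pf_iter r (Suc n) u = pf_iter (\<lambda>i. r (Suc i)) n (transfer_op (r 0) u)"

lemma pf_iter_add: "pf_iter r (n + m) u = pf_iter (\<lambda>i. r (n + i)) m (pf_iter r n u)"
  by (induction n arbitrary: r u) auto

lemma pf_iter_Suc_right: "pf_iter r (Suc n) u = transfer_op (r n) (pf_iter r n u)"
  using pf_iter_add[of r n "Suc 0" u] by (simp only: add_Suc_right add_0_right pf_iter.simps)

lemma pf_iter_integral:
  assumes "\<And>i. r i \<in> Pars" "integrable lam u"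
  shows "integrable lam (pf_iter r n u)" "(LINT x|lam. pf_iter r n u x) = (LINT x|lam. u x)"
  using assms by (induction n arbitrary: r u) (simp_all add: transfer_op_integral)

lemma pf_iter_density: "(\<And>i. r i \<in> Pars) \<Longrightarrow> u \<in> densities \<Longrightarrow> pf_iter r n u \<in> densities"
  by (induction n arbitrary: r u) (simp_all add: transfer_op_density)

lemma pf_iter_lin:
  "pf_iter r n (\<lambda>x. a * u x + b * v x) = (\<lambda>x. a * pf_iter r n u x + b * pf_iter r n v x)"
proof (induction n arbitrary: r u v)
  case (Suc n)
  have "transfer_op (r 0) (\<lambda>x. a * u x + b * v x) = (\<lambda>x. a * transfer_op (r 0) u x + b * transfer_op (r 0) v x)"
    by (rule ext, rule transfer_op_lin)
  then show ?case by (simp add: Suc.IH)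
qed simp

lemma pf_iter_L1_dist:
  assumes "\<And>i. r i \<in> Pars" "integrable lam u" "integrable lam v"
  shows "L1_dist (pf_iter r n u) (pf_iter r n v) \<le> L1_dist u v"
  using assms
proof (induction n arbitrary: r u v)
  case (Suc n)
  have "L1_dist (pf_iter r (Suc n) u) (pf_iter r (Suc n) v) \<le> L1_dist (transfer_op (r 0) u) (transfer_op (r 0) v)"
    using Suc.prems Suc.IH[of "\<lambda>i. r (Suc i)"] by (simp add: transfer_op_integral)
  also have "\<dots> \<le> L1_dist u v" using Suc.prems by (intro transfer_op_L1_dist)
  finally show ?case .
qed simp

lemma pf_iter_cong:
  assumes "\<And>i. r i \<in> Pars" "\<And>x. x \<in> X \<Longrightarrow> u x = v x" "x \<in> X"
  shows "pf_iter r n u x = pf_iter r n v x"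
  using assms
proof (induction n arbitrary: r u v x)
  case (Suc n)
  show ?case
    unfolding pf_iter.simps
    by (rule Suc.IH) (use Suc.prems in \<open>auto intro: transfer_op_cong\<close>)
qed simp

text \<open>For fixed \<open>x\<close> the kernel is a function of its parameter, and the estimates
  for \<open>dual_iter\<close> on such functions become pointwise estimates for densities.\<close>

lemma pf_iter_kern:
  assumes "\<And>i. r i \<in> Pars" "y \<in> Y" "x \<in> X"
  shows "pf_iter r n (kern y) x = dual_iter r n (\<lambda>y. kern y x) y"
  using assms
proof (induction n arbitrary: r y)
  case (Suc n)
  let ?q = "right_weight (r 0) y" and ?r = "\<lambda>i. r (Suc i)"
  have "pf_iter r (Suc n) (kern y) x =
      pf_iter ?r n (\<lambda>x. (1 - ?q) * kern (left_branch (r 0) y) x + ?q * kern (right_branch (r 0) y) x) x"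
    unfolding pf_iter.simps using Suc.prems
    by (intro pf_iter_cong) (auto simp: transfer_kern dual_op_def)
  also have "\<dots> = dual_iter r (Suc n) (\<lambda>y. kern y x) y"
    unfolding pf_iter_lin using Suc.prems Suc.IH[of ?r] by (simp add: dual_op_def branches_in_Y)
  finally show ?case .
qed simp

lemma phi_pf_iter_kern:
  assumes "\<And>i. r i \<in> Pars" "y \<in> Y"
  shows "phi (pf_iter r n (kern y)) = dual_iter r n kern_mean y"
  using assms
proof (induction n arbitrary: r y)
  case 0
  then show ?case by (simp add: kern_mean_def)
next
  case (Suc n)
  let ?q = "right_weight (r 0) y" and ?r = "\<lambda>i. r (Suc i)"
  note b = branches_in_Y[OF Suc.prems(1)[of 0] Suc.prems(2)]
  have "phi (pf_iter r (Suc n) (kern y)) =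
      phi (pf_iter ?r n (\<lambda>x. (1 - ?q) * kern (left_branch (r 0) y) x + ?q * kern (right_branch (r 0) y) x))"
    unfolding pf_iter.simps using Suc.prems
    by (intro phi_cong pf_iter_cong) (auto simp: transfer_kern dual_op_def)
  also have "\<dots> = dual_iter r (Suc n) kern_mean y"
    unfolding pf_iter_lin using Suc.prems Suc.IH[of ?r] b
    by (subst phi_lin) (simp_all add: dual_op_def pf_iter_integral integrable_kern)
  finally show ?case .
qed

text \<open>The constant 20/3 is the Lipschitz constant 5 of the kernels times the length 4/3 of
  \<open>Y\<close>.\<close>

lemma pf_iter_kern_dist:
  assumes "\<And>i. r i \<in> Pars" "y \<in> Y" "z \<in> Y"
  shows "L1_dist (pf_iter r n (kern y)) (pf_iter r n (kern z)) \<le> (19/20)^n * (20/3)"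
  unfolding L1_dist_def
proof (rule L1_norm_le_bound)
  show "\<bar>pf_iter r n (kern y) x - pf_iter r n (kern z) x\<bar> \<le> (19/20)^n * (20/3)" if x: "x \<in> X" for x
    using dual_iter_osc[OF assms(1) kern_lip[OF x] assms(2,3), where n = n] assms x by (simp add: pf_iter_kern)
qed (use assms in \<open>simp add: pf_iter_integral integrable_kern\<close>)

section \<open>Density of the span of the kernels\<close>

lemma sum_arith_geometric:
  fixes t :: real
  shows "(1 - t)\<^sup>2 * (\<Sum>k<n. real (Suc k) * t ^ k) = 1 - real (Suc n) * t ^ n + real n * t ^ Suc n"
  by (induction n) (simp_all add: distrib_left power2_eq_square algebra_simps)

text \<open>Up to its normalization, \<open>kern y x\<close> is the power series with terms
  \<open>(k + 1) * y^k * x^k\<close>. Removing the terms below \<open>n\<close> and dividing by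
  \<open>(n + 1) * y^n\<close> leaves \<open>x^n\<close> with an error linear in \<open>y\<close>,
  so small \<open>y\<close> recovers the monomial.\<close>

lemma monomial_from_kern:
  assumes y: "y \<in> Y" "0 < y" and x: "x \<in> X"
  shows "\<bar>x ^ n - 1 / (real (Suc n) * y ^ n) * (1 / (1 - y\<^sup>2/4) * kern y x - (\<Sum>k<n. real (Suc k) * y ^ k * x ^ k))\<bar> \<le> 4 * y"
proof -
  define t where "t = x * y"
  note d = xy_bound[OF y(1) x, folded t_def]
  have n: "(1 - t)\<^sup>2 \<noteq> 0" using d by auto
  have y2: "1 - y\<^sup>2/4 \<noteq> 0" using Y_sq[OF y(1)] by auto
  have "1 / (1 - y\<^sup>2/4) * kern y x - (\<Sum>k<n. real (Suc k) * y ^ k * x ^ k)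
      = 1 / (1 - t)\<^sup>2 - (\<Sum>k<n. real (Suc k) * t ^ k)"
    using y2 by (simp add: kern_def t_def power_mult_distrib mult_ac)
  also have "\<dots> = (1 - (1 - t)\<^sup>2 * (\<Sum>k<n. real (Suc k) * t ^ k)) / (1 - t)\<^sup>2"
    using n by (simp add: diff_divide_distrib)
  also have "\<dots> = (y ^ n * x ^ n) * ((real (Suc n) - real n * t) / (1 - t)\<^sup>2)"
    unfolding sum_arith_geometric by (simp add: t_def power_mult_distrib algebra_simps)
  finally have "1 / (real (Suc n) * y ^ n) * (1 / (1 - y\<^sup>2/4) * kern y x - (\<Sum>k<n. real (Suc k) * y ^ k * x ^ k))
      = x ^ n * ((real (Suc n) - real n * t) / (1 - t)\<^sup>2) / real (Suc n)"
    using y by simp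
  then have "x ^ n - 1 / (real (Suc n) * y ^ n) * (1 / (1 - y\<^sup>2/4) * kern y x - (\<Sum>k<n. real (Suc k) * y ^ k * x ^ k))
      = x ^ n * (1 - (real (Suc n) - real n * t) / (1 - t)\<^sup>2 / real (Suc n))"
    by (simp add: right_diff_distrib)
  also have "1 - (real (Suc n) - real n * t) / (1 - t)\<^sup>2 / real (Suc n)
      = (real (Suc n) * (1 - t)\<^sup>2 - (real (Suc n) - real n * t)) / real (Suc n) / (1 - t)\<^sup>2"
    using n by (simp add: diff_divide_distrib mult.commute)
  also have "(real (Suc n) * (1 - t)\<^sup>2 - (real (Suc n) - real n * t)) / real (Suc n)
      = t * t - (real n + 2) / (real n + 1) * t"
    by (simp add: field_simps power2_eq_square)
  also have "\<bar>x ^ n * ((t * t - (real n + 2) / (real n + 1) * t) / (1 - t)\<^sup>2)\<bar> \<le> 1 * (3 * \<bar>t\<bar> / (2/3)\<^sup>2)"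
    unfolding abs_mult[of "x ^ n"] abs_divide
  proof (intro mult_mono frac_le)
    have "\<bar>x\<bar> \<le> 1" using x by (auto simp: X_def)
    then show "\<bar>x ^ n\<bar> \<le> 1" by (simp add: power_abs power_le_one)
    have "(real n + 2) / (real n + 1) \<le> 2" by (simp add: field_simps)
    then have h1: "(real n + 2) / (real n + 1) * \<bar>t\<bar> \<le> 2 * \<bar>t\<bar>" by (intro mult_right_mono) auto
    have h2: "\<bar>t * t\<bar> \<le> 1 * \<bar>t\<bar>" unfolding abs_mult using d by (intro mult_right_mono) auto
    have "\<bar>t * t - (real n + 2) / (real n + 1) * t\<bar> \<le> \<bar>t * t\<bar> + (real n + 2) / (real n + 1) * \<bar>t\<bar>"
      by (intro order_trans[OF abs_triangle_ineq4]) (simp add: abs_mult)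
    also have "\<dots> \<le> 1 * \<bar>t\<bar> + 2 * \<bar>t\<bar>" using h2 h1 by (rule add_mono)
    finally show "\<bar>t * t - (real n + 2) / (real n + 1) * t\<bar> \<le> 3 * \<bar>t\<bar>" by simp
    show "(2/3)\<^sup>2 \<le> \<bar>(1 - t)\<^sup>2\<bar>" using d by (simp add: power_mono)
  qed auto
  also have "\<dots> \<le> 4 * y" using d(3) y by (simp add: power2_eq_square)
  finally show ?thesis .
qed

text \<open>Density of the span of the kernels, phrased as an induction rule. The property spreads
  to monomials, by Weierstrass to continuous functions, by a pi-lambda argument to indicators of
  Borel sets, and so to all integrable functions.\<close>

lemma kern_span_induct [consumes 1, case_names kern lin closed]:
  assumes u: "integrable lam u"
    and kern: "\<And>y. y \<in> Y \<Longrightarrow> Q (kern y)"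
    and lin: "\<And>u v a b. integrable lam u \<Longrightarrow> integrable lam v \<Longrightarrow> Q u \<Longrightarrow> Q v \<Longrightarrow> Q (\<lambda>x. a * u x + b * v x)"
    and closed: "\<And>u. integrable lam u \<Longrightarrow> (\<And>\<epsilon>. 0 < \<epsilon> \<Longrightarrow> \<exists>v. integrable lam v \<and> Q v \<and> L1_dist u v < \<epsilon>) \<Longrightarrow> Q u"
  shows "Q u"
proof -
  have zero: "Q (\<lambda>x. 0)"
    using lin[of "kern 0" "kern 0" 0 0] kern[of 0] integrable_kern[of 0] by simp
  have ipow: "integrable lam (\<lambda>x. x ^ n)" for n :: nat
    by (intro integrable_lam_continuous continuous_intros)
  have psum: "Q (\<lambda>x. \<Sum>k<m. c k * x ^ k)" if "\<And>k. k < m \<Longrightarrow> Q (\<lambda>x. x ^ k)" for m :: nat and c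
    using that
  proof (induction m)
    case 0
    then show ?case using zero by simp
  next
    case (Suc m)
    have "integrable lam (\<lambda>x. \<Sum>k<m. c k * x ^ k)"
      by (intro integrable_lam_continuous continuous_intros)
    then show ?case
      using lin[of "\<lambda>x. \<Sum>k<m. c k * x ^ k" "\<lambda>x. x ^ m" 1 "c m"] Suc ipow[of m] by simp
  qed
  have mono: "Q (\<lambda>x. x ^ n)" for n :: nat
  proof (induction n rule: less_induct)
    case (less n)
    show ?case
    proof (rule closed[OF ipow])
      fix \<epsilon> :: real assume e: "0 < \<epsilon>"
      \<comment> \<open>Makes the error \<open>4 * y\<close> of \<open>monomial_from_kern\<close>
        smaller than \<open>\<epsilon>\<close>; the lower monomials subtracted there are available
        by the strong induction.\<close>
      define y where "y = min (1/2) (\<epsilon> / 8)"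
      have y: "y \<in> Y" "0 < y" "4 * y < \<epsilon>" using e by (auto simp: y_def Y_def)
      let ?s = "\<lambda>x::real. \<Sum>k<n. (real (Suc k) * y ^ k) * x ^ k"
      let ?v = "\<lambda>x. (1 / (real (Suc n) * y ^ n) * (1 / (1 - y\<^sup>2/4))) * kern y x + (- (1 / (real (Suc n) * y ^ n))) * ?s x"
      have isum: "integrable lam ?s"
        by (intro integrable_lam_continuous continuous_intros)
      have iv: "integrable lam ?v" using isum integrable_kern[OF y(1)] by simp
      have "Q ?s" using less by (intro psum)
      then have "Q ?v" by (intro lin isum integrable_kern kern y)
      moreover have "L1_dist (\<lambda>x. x ^ n) ?v \<le> 4 * y"
        unfolding L1_dist_def
      proof (rule L1_norm_le_bound)
        fix x assume "x \<in> X"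
        have *: "(a * b) * k + (- a) * c = a * (b * k - c)" for a b k c :: real
          by (simp add: algebra_simps)
        from \<open>x \<in> X\<close> monomial_from_kern[OF y(1,2), of x n]
        show "\<bar>x ^ n - ?v x\<bar> \<le> 4 * y" by (simp only: *)
      qed (use iv ipow in auto)
      ultimately show "\<exists>v. integrable lam v \<and> Q v \<and> L1_dist (\<lambda>x. x ^ n) v < \<epsilon>"
        using iv y(3) by (intro exI[of _ ?v]) auto
    qed
  qed
  have cont: "Q f" if f: "continuous_on X f" for f
  proof (rule closed)
    show "integrable lam f" using f by (rule integrable_lam_continuous)
    fix \<epsilon> :: real assume e: "0 < \<epsilon>"
    have cX: "compact X" unfolding X_def by simp
    obtain g where g: "real_polynomial_function g" "\<And>x. x \<in> X \<Longrightarrow> \<bar>f x - g x\<bar> < \<epsilon> / 2"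
      using Stone_Weierstrass_real_polynomial_function[OF cX f, of "\<epsilon>/2"] e by auto
    obtain a n where ga: "g = (\<lambda>x. \<Sum>i\<le>n. a i * x ^ i)"
      using g(1) unfolding real_polynomial_function_iff_sum by auto
    have "Q g" unfolding ga lessThan_Suc_atMost[symmetric] by (intro psum mono)
    moreover have ig: "integrable lam g" unfolding ga by (intro integrable_lam_continuous continuous_intros)
    moreover have "L1_dist f g \<le> \<epsilon> / 2"
      unfolding L1_dist_def using g(2) ig integrable_lam_continuous[OF f]
      by (intro L1_norm_le_bound) (auto intro: less_imp_le)
    ultimately show "\<exists>v. integrable lam v \<and> Q v \<and> L1_dist f v < \<epsilon>" using e by (intro exI[of _ g]) auto
  qed
  \<comment> \<open>Dominated convergence turns pointwise limits into L1 limits, to which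
    \<open>closed\<close> applies.\<close>
  have dct: "Q f" if "integrable lam f" "\<And>i. integrable lam (s i)" "\<And>i. Q (s i)" "integrable lam w"
    "\<And>x. x \<in> X \<Longrightarrow> (\<lambda>i. s i x) \<longlonglongrightarrow> f x" "\<And>i x. x \<in> X \<Longrightarrow> \<bar>f x - s i x\<bar> \<le> w x" for f w and s :: "nat \<Rightarrow> real \<Rightarrow> real"
  proof (rule closed[OF that(1)])
    fix \<epsilon> :: real assume e: "0 < \<epsilon>"
    have "(\<lambda>i. LINT x|lam. \<bar>f x - s i x\<bar>) \<longlonglongrightarrow> (LINT x|lam. 0)"
    proof (rule integral_dominated_convergence[where w = w])
      show "AE x in lam. (\<lambda>i. \<bar>f x - s i x\<bar>) \<longlonglongrightarrow> 0"
        using that(5) by (intro AE_I2 tendsto_rabs_zero) (auto intro!: tendsto_eq_intros)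
    qed (use that in auto)
    then have "(\<lambda>i. L1_dist f (s i)) \<longlonglongrightarrow> 0" by (simp add: L1_dist_def L1_norm_def)
    then have "eventually (\<lambda>i. L1_dist f (s i) < \<epsilon>) sequentially"
      using e by (rule order_tendstoD)
    then obtain i where "L1_dist f (s i) < \<epsilon>" by (auto simp: eventually_sequentially)
    then show "\<exists>v. integrable lam v \<and> Q v \<and> L1_dist f v < \<epsilon>" using that by blast
  qed
  have ind: "Q (indicator A)" if A: "A \<in> sets borel" for A :: "real set"
  proof -
    have im: "integrable lam (indicator B :: real \<Rightarrow> real)" if "B \<in> sets borel" for B
      using that by (intro integrable_lam_bounded[where B = 1] borel_measurable_lam) (auto simp: indicator_def)
    have eq: "sets borel = sigma_sets UNIV (range (\<lambda>a::real. {..a}))"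
      unfolding borel_eq_atMost by simp
    have G: "range (\<lambda>a::real. {..a}) \<subseteq> Pow UNIV" "Int_stable (range (\<lambda>a::real. {..a}))"
      by (auto simp: Int_stable_def)
    show ?thesis
      using G(2,1) A[unfolded eq]
    proof (induction rule: sigma_sets_induct_disjoint)
      case (basic A)
      then obtain a where a: "A = {..a}" by auto
      \<comment> \<open>Continuous ramps that equal 1 up to \<open>a\<close> and then descend with
        slope \<open>- i\<close>.\<close>
      let ?s = "\<lambda>i::nat. \<lambda>x::real. max 0 (min 1 (1 + (a - x) * real i))"
      have lim: "(\<lambda>i. ?s i x) \<longlonglongrightarrow> indicator {..a} x" for x
      proof (cases "x \<le> a")
        case True
        then show ?thesis by (simp add: max_def min_def)
      next
        case False
        have "eventually (\<lambda>i::nat. 1 / (x - a) \<le> real i) sequentially"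
          using filterlim_real_sequentially by (simp add: filterlim_at_top)
        then have "eventually (\<lambda>i::nat. 1 + (a - x) * real i \<le> 0) sequentially"
          by eventually_elim (use False in \<open>simp add: field_simps\<close>)
        then have "eventually (\<lambda>i::nat. ?s i x = indicator {..a} x) sequentially"
          by eventually_elim (use False in \<open>auto simp: max_def min_def\<close>)
        then show ?thesis by (rule tendsto_eventually)
      qed
      have c: "continuous_on X (?s i)" for i
        by (intro continuous_intros)
      show "Q (indicator A)"
        unfolding a
      proof (rule dct[where s = ?s and w = "\<lambda>x. 1"])
        show "\<bar>indicator {..a} x - ?s i x\<bar> \<le> 1" for i x by (auto simp: indicator_def)
      qed (use lim c im[of "{..a}"] in \<open>simp_all add: integrable_lam_continuous cont\<close>)
    next
      case empty
      show ?case using zero by simp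
    next
      case (compl A)
      note QA = compl(2)
      have "integrable lam (indicator A :: real \<Rightarrow> real)" using eq im compl(1) by blast
      then have "Q (\<lambda>x. 1 * kern 0 x + (-1) * indicator A x)"
        using QA kern[of 0] integrable_kern[of 0] by (intro lin) auto
      also have "(\<lambda>x. 1 * kern 0 x + (-1) * indicator A x) = (indicator (UNIV - A) :: real \<Rightarrow> real)"
        by (auto simp: indicator_def)
      finally show "Q (indicator (UNIV - A))" .
    next
      case (union A)
      note dj = union(1) and QA = union(3)
      have Ab: "A i \<in> sets borel" for i using eq union(2) by auto
      let ?s = "\<lambda>n x. \<Sum>i<n. indicator (A i) x :: real"
      have sU: "?s n = indicator (\<Union>i<n. A i)" for n
        by (rule ext, rule indicator_UN_disjoint[symmetric])
          (use dj in \<open>auto simp: disjoint_family_on_def\<close>)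
      then have sU': "?s n x = indicator (\<Union>i<n. A i) x" for n x by (rule fun_cong)
      have Us: "(\<Union>i<n. A i) \<in> sets borel" for n using Ab by auto
      have iU: "integrable lam (?s n)" for n unfolding sU using Us by (rule im)
      have Qs: "Q (?s n)" for n
      proof (induction n)
        case (Suc n)
        then show ?case
          using lin[where a = 1 and b = 1, OF iU im[OF Ab] Suc QA, of n] by simp
      qed (use zero in simp)
      have lim: "(\<lambda>n. ?s n x) \<longlonglongrightarrow> indicator (\<Union>i. A i) x" for x
        unfolding sU' by (rule LIMSEQ_indicator_UN)
      show "Q (indicator (\<Union>i. A i))"
      proof (rule dct[where s = ?s and w = "\<lambda>x. 1"])
        show "\<bar>indicator (\<Union>i. A i) x - ?s n x\<bar> \<le> 1" for n x
          unfolding sU' by (auto simp: indicator_def)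
        show "(\<lambda>n. ?s n x) \<longlonglongrightarrow> indicator (\<Union>i. A i) x" for x by (rule lim)
        show "integrable lam (indicator (\<Union>i. A i) :: real \<Rightarrow> real)" using Ab by (intro im) auto
      qed (use iU Qs in simp_all)
    qed
  qed
  show ?thesis
    using u
  proof (induction rule: integrable_induct)
    case (base A c)
    then obtain B where B: "B \<in> sets borel" "A = B \<inter> X"
      by (auto simp: sets_lam sets_restrict_space)
    then have Ab: "A \<in> sets borel" by simp
    have "integrable lam (indicator A :: real \<Rightarrow> real)"
      using base by (intro integrable_lam_bounded[where B = 1]) (auto simp: indicator_def)
    then show ?case
      using lin[OF _ _ ind[OF Ab] ind[OF Ab], of c 0] by (simp add: mult.commute)
  next
    case (add f g)
    then show ?case using lin[of f g 1 1] by simp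
  next
    case (lim f s)
    show ?case
    proof (rule dct[OF lim(4,1,5)])
      show "integrable lam (\<lambda>x. 3 * \<bar>f x\<bar>)" using lim(4) by simp
      fix x i assume "x \<in> X"
      then show "(\<lambda>i. s i x) \<longlonglongrightarrow> f x" "\<bar>f x - s i x\<bar> \<le> 3 * \<bar>f x\<bar>"
        using lim(2)[of x] lim(3)[of x i] by auto
    qed
  qed
qed

section \<open>Loss of memory and invariant densities\<close>

lemma null_sandwich:
  fixes f g :: "nat \<Rightarrow> real"
  assumes "\<And>n. f n \<le> g n" "g \<longlonglongrightarrow> 0" "\<And>n. 0 \<le> f n"
  shows "f \<longlonglongrightarrow> 0"
  by (rule tendsto_sandwich[OF _ _ tendsto_const assms(2)]) (use assms in auto)

text \<open>The easy half of the Banach-Steinhaus principle: with a uniform norm bound, convergence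
  to zero on the kernels extends to the closure of their span. The bound 2 suits differences of two
  L1 contractions.\<close>

lemma operator_seq_null:
  fixes D :: "nat \<Rightarrow> (real \<Rightarrow> real) \<Rightarrow> real \<Rightarrow> real"
  assumes u: "integrable lam u"
    and lin: "\<And>n u v a b x. integrable lam u \<Longrightarrow> integrable lam v \<Longrightarrow>
      D n (\<lambda>x. a * u x + b * v x) x = a * D n u x + b * D n v x"
    and int: "\<And>n u. integrable lam u \<Longrightarrow> integrable lam (D n u)"
    and bnd: "\<And>n u. integrable lam u \<Longrightarrow> L1_norm (D n u) \<le> 2 * L1_norm u"
    and kern: "\<And>y. y \<in> Y \<Longrightarrow> (\<lambda>n. L1_norm (D n (kern y))) \<longlonglongrightarrow> 0"
  shows "(\<lambda>n. L1_norm (D n u)) \<longlonglongrightarrow> 0"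
  using u
proof (induction rule: kern_span_induct)
  case (kern y)
  then show ?case by (rule assms(5))
next
  case (lin u v a b)
  have lim: "(\<lambda>n. \<bar>a\<bar> * L1_norm (D n u) + \<bar>b\<bar> * L1_norm (D n v)) \<longlonglongrightarrow> 0"
    using lin(3,4) by (auto intro!: tendsto_eq_intros)
  have "L1_norm (D n (\<lambda>x. a * u x + b * v x)) \<le> \<bar>a\<bar> * L1_norm (D n u) + \<bar>b\<bar> * L1_norm (D n v)" for n
  proof -
    have "D n (\<lambda>x. a * u x + b * v x) = (\<lambda>x. a * D n u x + b * D n v x)"
      by (rule ext) (rule assms(2)[OF lin(1,2)])
    then show ?thesis
      using L1_norm_triangle[of "\<lambda>x. a * D n u x" "\<lambda>x. b * D n v x"] int[OF lin(1)] int[OF lin(2)]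
      by (simp add: L1_norm_cmult)
  qed
  from this lim show ?case
    by (rule null_sandwich) simp
next
  case (closed u)
  show ?case
  proof (rule LIMSEQ_I)
    fix \<epsilon> :: real assume e: "0 < \<epsilon>"
    obtain v where v: "integrable lam v" "(\<lambda>n. L1_norm (D n v)) \<longlonglongrightarrow> 0" "L1_dist u v < \<epsilon> / 4"
      using closed(2)[of "\<epsilon>/4"] e by auto
    obtain N where N: "\<And>n. n \<ge> N \<Longrightarrow> L1_norm (D n v) < \<epsilon> / 2"
      using LIMSEQ_D[OF v(2), of "\<epsilon>/2"] e by auto
    have "norm (L1_norm (D n u) - 0) < \<epsilon>" if "n \<ge> N" for n
    proof -
      have i: "integrable lam (\<lambda>x. u x - v x)" using closed(1) v(1) by simp
      have "D n u = (\<lambda>x. D n v x + D n (\<lambda>x. u x - v x) x)"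
        using assms(2)[OF v(1) i, of n 1 1] by (intro ext) simp
      then have "L1_norm (D n u) \<le> L1_norm (D n v) + L1_norm (D n (\<lambda>x. u x - v x))"
        using L1_norm_triangle[OF int[OF v(1)] int[OF i]] by simp
      also have "L1_norm (D n (\<lambda>x. u x - v x)) \<le> 2 * L1_dist u v"
        unfolding L1_dist_def by (rule bnd[OF i])
      finally show ?thesis using N[OF that] v(3) by simp
    qed
    then show "\<exists>N. \<forall>n\<ge>N. norm (L1_norm (D n u) - 0) < \<epsilon>" by blast
  qed
qed

lemma L1_norm_diff_le:
  assumes "integrable lam u" "integrable lam v"
  shows "L1_norm (\<lambda>x. u x - v x) \<le> L1_norm u + L1_norm v"
  using L1_norm_triangle[of u "\<lambda>x. - v x"] L1_norm_cmult[of "-1" v] assms by simp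

lemma kern_contraction_null: "(\<lambda>n. (19/20 :: real)^n * c) \<longlonglongrightarrow> 0"
  by (auto intro!: tendsto_eq_intros LIMSEQ_power_zero)

lemma pf_iter_L1:
  assumes "\<And>i. r i \<in> Pars" "integrable lam u"
  shows "L1_norm (pf_iter r n u) \<le> L1_norm u"
  using assms
proof (induction n arbitrary: r u)
  case (Suc n)
  then show ?case
    using order_trans[OF Suc.IH[of "\<lambda>i. r (Suc i)" "transfer_op (r 0) u"] transfer_op_L1[of "r 0" u]]
    by (simp add: transfer_op_integral)
qed simp

lemma memory_loss:
  assumes r: "\<And>i. r i \<in> Pars" and u: "u \<in> densities" and v: "v \<in> densities"
  shows "(\<lambda>n. L1_dist (pf_iter r n u) (pf_iter r n v)) \<longlonglongrightarrow> 0"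
proof -
  \<comment> \<open>Subtracting the image of the uniform density with the same total mass makes the
    operator small on each kernel while keeping it linear on all of L1.\<close>
  let ?D = "\<lambda>n u x. pf_iter r n u x - (LINT x|lam. u x) * pf_iter r n (kern 0) x"
  have *: "(\<lambda>n. L1_norm (?D n u)) \<longlonglongrightarrow> 0" if "integrable lam u" for u :: "real \<Rightarrow> real"
    using that
  proof (rule operator_seq_null[where D = ?D])
    fix n and u :: "real \<Rightarrow> real" assume u: "integrable lam u"
    have k: "integrable lam (pf_iter r n (kern 0))"
      by (intro pf_iter_integral r integrable_kern) simp
    then show "integrable lam (?D n u)" using u r by (simp add: pf_iter_integral)
    have "L1_norm (?D n u) \<le> L1_norm (pf_iter r n u) + L1_norm (\<lambda>x. (LINT x|lam. u x) * pf_iter r n (kern 0) x)"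
      using u r k by (intro L1_norm_diff_le) (auto simp: pf_iter_integral)
    also have "\<dots> \<le> L1_norm u + L1_norm u * 1"
      unfolding L1_norm_cmult
    proof (intro add_mono mult_mono)
      show "\<bar>LINT x|lam. u x\<bar> \<le> L1_norm u" unfolding L1_norm_def by (rule integral_abs_bound)
      show "L1_norm (pf_iter r n (kern 0)) \<le> 1"
        using densitiesD(3)[OF pf_iter_density[OF r kern_density[OF zero_in_Y], where n = n]] by simp
    qed (use r u in \<open>auto intro: pf_iter_L1\<close>)
    finally show "L1_norm (?D n u) \<le> 2 * L1_norm u" by simp
  next
    fix y assume y: "y \<in> Y"
    have "L1_norm (?D n (kern y)) \<le> (19/20)^n * (20/3)" for n
      using pf_iter_kern_dist[OF r y zero_in_Y, where n = n] y by (simp add: L1_dist_def integral_kern)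
    then show "(\<lambda>n. L1_norm (?D n (kern y))) \<longlonglongrightarrow> 0"
      by (rule null_sandwich) (simp_all add: kern_contraction_null)
  qed (simp add: pf_iter_lin algebra_simps)
  have "L1_dist (pf_iter r n u) (pf_iter r n v) \<le> L1_norm (?D n u) + L1_norm (?D n v)" for n
  proof -
    have i: "integrable lam (pf_iter r n w)" if "w \<in> densities" for w
      using that r densitiesD by (simp add: pf_iter_integral)
    have "L1_dist (pf_iter r n u) (pf_iter r n v) = L1_norm (\<lambda>x. ?D n u x - ?D n v x)"
      using u v by (simp add: L1_dist_def densitiesD)
    also have "\<dots> \<le> L1_norm (?D n u) + L1_norm (?D n v)"
      using i[OF u] i[OF v] i[OF kern_density[OF zero_in_Y]] by (intro L1_norm_diff_le) auto
    finally show ?thesis .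
  qed
  moreover have "(\<lambda>n. L1_norm (?D n u) + L1_norm (?D n v)) \<longlonglongrightarrow> 0"
    using *[of u] *[of v] u v densitiesD by (auto intro!: tendsto_eq_intros)
  ultimately show ?thesis
    by (rule null_sandwich) simp
qed

text \<open>Strong continuity in the parameter: on a kernel the images converge pointwise and
  boundedly, and \<open>operator_seq_null\<close> extends this to L1.\<close>

lemma transfer_op_continuous_par:
  assumes s: "\<And>i. s i \<in> Pars" and rho: "\<rho> \<in> Pars" and lim: "s \<longlonglongrightarrow> \<rho>" and u: "integrable lam u"
  shows "(\<lambda>n. L1_dist (transfer_op (s n) u) (transfer_op \<rho> u)) \<longlonglongrightarrow> 0"
proof -
  let ?D = "\<lambda>n u x. transfer_op (s n) u x - transfer_op \<rho> u x"
  have "(\<lambda>n. L1_norm (?D n u)) \<longlonglongrightarrow> 0"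
    using u
  proof (rule operator_seq_null[where D = ?D])
    fix n and u :: "real \<Rightarrow> real" assume u: "integrable lam u"
    note i = transfer_op_integral(1)[OF s u, of n] transfer_op_integral(1)[OF rho u]
    show "integrable lam (?D n u)" using i by simp
    show "L1_norm (?D n u) \<le> 2 * L1_norm u"
      using L1_norm_diff_le[OF i] transfer_op_L1[OF s u, of n] transfer_op_L1[OF rho u] by simp
  next
    fix y assume y: "y \<in> Y"
    have bd: "\<bar>transfer_op r (kern y) x\<bar> \<le> 9/4" if "r \<in> Pars" "x \<in> X" for r x
      unfolding transfer_kern[OF that(1) y that(2)]
      using dual_op_bounds[OF that(1) y, of "\<lambda>y. kern y x" 0 "9/4"] kern_bounds[OF _ that(2)] by simp
    have "(\<lambda>n. LINT x|lam. \<bar>?D n (kern y) x\<bar>) \<longlonglongrightarrow> (LINT x|lam. 0)"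
    proof (rule integral_dominated_convergence[where w = "\<lambda>x. 9/2"])
      show "AE x in lam. (\<lambda>n. \<bar>?D n (kern y) x\<bar>) \<longlonglongrightarrow> 0"
      proof (rule AE_I2)
        fix x assume "x \<in> space lam"
        then have x: "x \<in> X" by simp
        note d = transfer_denoms[OF rho x] and ix = inv_in_X[OF rho x]
        have il: "(\<lambda>n. inv_left (s n) x) \<longlonglongrightarrow> inv_left \<rho> x"
          unfolding inv_left_def using d by (intro tendsto_intros lim) auto
        have ir: "(\<lambda>n. inv_right (s n) x) \<longlonglongrightarrow> inv_right \<rho> x"
          unfolding inv_right_def using d by (intro tendsto_intros lim) auto
        have jl: "(\<lambda>n. jac_left (s n) x) \<longlonglongrightarrow> jac_left \<rho> x"
          unfolding jac_left_def using d by (intro tendsto_intros lim) auto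
        have jr: "(\<lambda>n. jac_right (s n) x) \<longlonglongrightarrow> jac_right \<rho> x"
          unfolding jac_right_def using d by (intro tendsto_intros lim) auto
        have "1 - inv_left \<rho> x * y \<noteq> 0" "1 - inv_right \<rho> x * y \<noteq> 0"
          using xy_bound(2)[OF y] ix by fastforce+
        then have "(\<lambda>n. transfer_op (s n) (kern y) x) \<longlonglongrightarrow> transfer_op \<rho> (kern y) x"
          unfolding transfer_op_def kern_def by (intro tendsto_intros il ir jl jr) auto
        then show "(\<lambda>n. \<bar>?D n (kern y) x\<bar>) \<longlonglongrightarrow> 0"
          by (intro tendsto_rabs_zero) (simp add: LIM_zero)
      qed
      show "AE x in lam. norm \<bar>?D n (kern y) x\<bar> \<le> 9/2" for n
      proof (rule AE_I2)
        fix x assume "x \<in> space lam"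
        then have x: "x \<in> X" by simp
        show "norm \<bar>?D n (kern y) x\<bar> \<le> 9/2"
          using order_trans[OF abs_triangle_ineq4 add_mono[OF bd[OF s x, of n] bd[OF rho x]]] by simp
      qed
    qed (use y s rho transfer_op_integral(1) integrable_kern in \<open>auto\<close>)
    then show "(\<lambda>n. L1_norm (?D n (kern y))) \<longlonglongrightarrow> 0" by (simp add: L1_norm_def)
  qed (simp add: transfer_op_lin algebra_simps)
  then show ?thesis by (simp add: L1_dist_def)
qed

section \<open>The explicit invariant densities and convergence to them\<close>

lemma inv_dens_denoms:
  assumes "\<bar>r\<bar> < 2/3" "x \<in> X"
  shows "0 < 1 - r - r * x" "0 < 1 + r - r * x"
proof -
  have b: "\<bar>r * z\<bar> < 1" if "\<bar>z\<bar> \<le> 3/2" for z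
  proof -
    have "\<bar>r * z\<bar> \<le> \<bar>r\<bar> * (3/2)" unfolding abs_mult using that by (intro mult_left_mono) auto
    also have "\<dots> < 1" using assms(1) by simp
    finally show ?thesis .
  qed
  have "\<bar>1 + x\<bar> \<le> 3/2" "\<bar>x - 1\<bar> \<le> 3/2" using assms(2) by (auto simp: X_def)
  then show "0 < 1 - r - r * x" "0 < 1 + r - r * x"
    using b[of "1 + x"] b[of "x - 1"] by (simp_all add: algebra_simps abs_less_iff)
qed

lemma inv_dens_0 [simp]: "inv_dens 0 = kern 0"
  by (simp add: inv_dens_def fun_eq_iff)

lemma inv_dens_log_pos:
  fixes r :: real
  assumes "\<bar>r\<bar> < 2/3" "r \<noteq> 0"
  shows "0 < ln ((4 - r\<^sup>2) / (4 - 9 * r\<^sup>2))"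
proof -
  have "r\<^sup>2 < (2/3)\<^sup>2" using power_strict_mono[OF assms(1), of 2] by simp
  then have "9 * r\<^sup>2 < 4" by (simp add: power2_eq_square)
  moreover have "0 < r\<^sup>2" using assms(2) by simp
  ultimately have "1 < (4 - r\<^sup>2) / (4 - 9 * r\<^sup>2)" by (simp add: less_divide_eq)
  then show ?thesis by simp
qed

lemma continuous_on_inv_dens:
  assumes "\<bar>r\<bar> < 2/3"
  shows "continuous_on X (inv_dens r)"
proof (cases "r = 0")
  case False
  then show ?thesis
    unfolding inv_dens_def using inv_dens_denoms[OF assms] by (auto intro!: continuous_intros; fastforce)
qed (simp add: continuous_on_const)

lemma inv_dens_density:
  assumes r: "\<bar>r\<bar> < 2/3"
  shows "inv_dens r \<in> densities"
proof (cases "r = 0")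
  case True
  then show ?thesis using kern_density[of 0] by simp
next
  case False
  define L where "L = ln ((4 - r\<^sup>2) / (4 - 9 * r\<^sup>2))"
  have L: "0 < L" unfolding L_def by (rule inv_dens_log_pos[OF r False])
  have eq: "inv_dens r x = inverse L * (2 * r\<^sup>2 / ((1 - r - r * x) * (1 + r - r * x)))" for x
    using False by (simp add: inv_dens_def L_def)
  have nn: "0 \<le> inv_dens r x" if "x \<in> X" for x
    unfolding eq using inv_dens_denoms[OF r that] L by simp
  note h = inv_dens_denoms[OF r, of "1/2"] inv_dens_denoms[OF r, of "-1/2"]
  have "(LINT x|lam. inv_dens r x) =
      inverse L * (ln (1 + r - r * (1/2)) - ln (1 - r - r * (1/2))) - inverse L * (ln (1 + r - r * (-1/2)) - ln (1 - r - r * (-1/2)))"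
  proof (rule integral_lam_FTC[where F = "\<lambda>x. inverse L * (ln (1 + r - r * x) - ln (1 - r - r * x))"])
    fix x assume x: "x \<in> X"
    note d = inv_dens_denoms[OF r x]
    have "((\<lambda>x. inverse L * (ln (1 + r - r * x) - ln (1 - r - r * x))) has_real_derivative
        inverse L * ((- r) / (1 + r - r * x) - (- r) / (1 - r - r * x))) (at x)"
      using d by (auto intro!: derivative_eq_intros)
    also have "(- r) / (1 + r - r * x) - (- r) / (1 - r - r * x) = 2 * r\<^sup>2 / ((1 - r - r * x) * (1 + r - r * x))"
      using d by (subst diff_frac_eq) (auto simp: power2_eq_square algebra_simps)
    finally show "((\<lambda>x. inverse L * (ln (1 + r - r * x) - ln (1 - r - r * x))) has_real_derivative inv_dens r x) (at x)"
      unfolding eq .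
    show "isCont (inv_dens r) x"
      unfolding eq[abs_def] using d by (auto intro!: continuous_intros)
  qed
  also have "\<dots> = inverse L * (ln (1 + r / 2) - ln (1 - 3 * r / 2) - (ln (1 + 3 * r / 2) - ln (1 - r / 2)))"
  proof -
    have "1 + r - r * (1/2) = 1 + r / 2" "1 - r - r * (1/2) = 1 - 3 * r / 2"
      "1 + r - r * (-1/2) = 1 + 3 * r / 2" "1 - r - r * (-1/2) = 1 - r / 2"
      by simp_all
    then show ?thesis by (simp only: right_diff_distrib)
  qed
  also have "\<dots> = inverse L * ln (((1 + r / 2) * (1 - r / 2)) / ((1 - 3 * r / 2) * (1 + 3 * r / 2)))"
    using h by (simp add: X_def ln_div ln_mult)
  also have "((1 + r / 2) * (1 - r / 2)) / ((1 - 3 * r / 2) * (1 + 3 * r / 2)) = (4 - r\<^sup>2) / (4 - 9 * r\<^sup>2)"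
  proof -
    have e: "(1 + r / 2) * (1 - r / 2) = (4 - r\<^sup>2) / 4" "(1 - 3 * r / 2) * (1 + 3 * r / 2) = (4 - 9 * r\<^sup>2) / 4"
      by (simp_all add: algebra_simps power2_eq_square)
    have "(a / 4) / (b / 4) = a / b" for a b :: real by simp
    then show ?thesis unfolding e .
  qed
  also have "inverse L * ln ((4 - r\<^sup>2) / (4 - 9 * r\<^sup>2)) = 1"
    using L by (simp add: L_def)
  finally show ?thesis
    using nn continuous_on_inv_dens[OF r] by (auto simp: densities_def integrable_lam_continuous intro!: AE_I2)
qed

lemma transfer_inv_dens:
  assumes r: "r \<in> Pars" and x: "x \<in> X"
  shows "transfer_op r (inv_dens r) x = inv_dens r x"
proof (cases "r = 0")
  case True
  then show ?thesis by (simp add: transfer_op_def jac_left_def jac_right_def)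
next
  case False
  define c where "c = inverse (ln ((4 - r\<^sup>2) / (4 - 9 * r\<^sup>2))) * (2 * r\<^sup>2)"
  have eq: "inv_dens r z = c / ((1 - r - r * z) * (1 + r - r * z))" for z
    using False by (simp add: inv_dens_def c_def)
  have r': "\<bar>r\<bar> < 2/3" "r < 2" "- 2 < r" using r by (auto simp: Pars_def)
  note d = transfer_denoms[OF r x] inv_dens_denoms[OF r'(1) x]
  have rx: "0 < 1 - r * x" using d(3,4) by linarith
  have gen: "2 * (m * p) / D\<^sup>2 * (c / ((2 * m * q / D) * (2 * p * b / D))) = c / (2 * q * b)"
    if "D \<noteq> 0" "m \<noteq> 0" "p \<noteq> 0" for m p D q b :: real
    using that by (cases "q = 0 \<or> b = 0") (auto simp: field_simps power2_eq_square)
  have jac: "8 - 2 * r\<^sup>2 = 2 * ((2 - r) * (2 + r))" by (simp add: algebra_simps power2_eq_square)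
  have "1 - r - r * inv_left r x = 2 * (2 - r) * (1 - r * x) / (r + 4 - 2 * r * x)"
    "1 + r - r * inv_left r x = 2 * (2 + r) * (1 + r - r * x) / (r + 4 - 2 * r * x)"
    using d by (simp_all add: inv_left_def field_simps)
  then have l: "jac_left r x * inv_dens r (inv_left r x) = c / (2 * (1 - r * x) * (1 + r - r * x))"
    unfolding eq jac_left_def jac using d r' by (simp only:) (rule gen; simp)
  have "1 - r - r * inv_right r x = 2 * (2 - r) * (1 - r - r * x) / (4 - r - 2 * r * x)"
    "1 + r - r * inv_right r x = 2 * (2 + r) * (1 - r * x) / (4 - r - 2 * r * x)"
    using d by (simp_all add: inv_right_def field_simps)
  then have rr: "jac_right r x * inv_dens r (inv_right r x) = c / (2 * (1 - r - r * x) * (1 - r * x))"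
    unfolding eq jac_right_def jac using d r' by (simp only:) (rule gen; simp)
  \<comment> \<open>The two branch contributions share the factor \<open>1 - r * x\<close>, which is
    the average of the two denominators of \<open>inv_dens\<close>; their sum therefore
    telescopes.\<close>
  have "c / (2 * q * b) + c / (2 * a * q) = c / (a * b)" if "0 < a" "0 < b" "0 < q" "a + b = 2 * q" for a b q :: real
  proof -
    have "c / (2 * q * b) + c / (2 * a * q) = c * (a + b) / (2 * q * (a * b))"
      using that(1-3) by (simp add: field_simps)
    then show ?thesis using that by simp
  qed
  from this[of "1 - r - r * x" "1 + r - r * x" "1 - r * x"] d rx
  show ?thesis unfolding transfer_op_def unfolding l rr unfolding eq by simp
qed

lemma pf_iter_inv_dens:
  assumes "r \<in> Pars" "x \<in> X"
  shows "pf_iter (\<lambda>_. r) n (inv_dens r) x = inv_dens r x"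
proof (induction n)
  case (Suc n)
  have "pf_iter (\<lambda>_. r) (Suc n) (inv_dens r) x = pf_iter (\<lambda>_. r) n (inv_dens r) x"
    unfolding pf_iter.simps using assms by (intro pf_iter_cong) (auto simp: transfer_inv_dens)
  then show ?case using Suc by simp
qed simp

lemma L1_dist_cong:
  "(\<And>x. x \<in> X \<Longrightarrow> u x = u' x) \<Longrightarrow> (\<And>x. x \<in> X \<Longrightarrow> v x = v' x) \<Longrightarrow> L1_dist u v = L1_dist u' v'"
  unfolding L1_dist_def by (rule L1_norm_cong) simp

lemma Pars_abs: "r \<in> Pars \<Longrightarrow> \<bar>r\<bar> < 2/3"
  by (auto simp: Pars_def)

lemma pf_iter_const_tendsto:
  assumes r: "r \<in> Pars" and u: "u \<in> densities"
  shows "(\<lambda>n. L1_dist (pf_iter (\<lambda>_. r) n u) (inv_dens r)) \<longlonglongrightarrow> 0"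
proof -
  have "L1_dist (pf_iter (\<lambda>_. r) n u) (inv_dens r) = L1_dist (pf_iter (\<lambda>_. r) n u) (pf_iter (\<lambda>_. r) n (inv_dens r))" for n
    using r by (intro L1_dist_cong) (auto simp: pf_iter_inv_dens)
  then show ?thesis
    using memory_loss[OF r u inv_dens_density[OF Pars_abs[OF r]]] by simp
qed

lemma pf_iter_continuous_par:
  assumes s: "\<And>n i. s n i \<in> Pars" and rho: "\<rho> \<in> Pars" and lim: "\<And>i. (\<lambda>n. s n i) \<longlonglongrightarrow> \<rho>" and u: "integrable lam u"
  shows "(\<lambda>n. L1_dist (pf_iter (s n) m u) (pf_iter (\<lambda>_. \<rho>) m u)) \<longlonglongrightarrow> 0"
proof (induction m)
  case (Suc m)
  let ?A = "pf_iter (\<lambda>_. \<rho>) m u"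
  have iA: "integrable lam ?A" using rho u by (simp add: pf_iter_integral)
  have i: "integrable lam (pf_iter (s n) m u)" for n using s u by (simp add: pf_iter_integral)
  have "L1_dist (pf_iter (s n) (Suc m) u) (pf_iter (\<lambda>_. \<rho>) (Suc m) u)
      \<le> L1_dist (pf_iter (s n) m u) ?A + L1_dist (transfer_op (s n m) ?A) (transfer_op \<rho> ?A)" for n
    unfolding pf_iter_Suc_right
    by (rule order_trans[OF L1_dist_triangle[of _ "transfer_op (s n m) ?A"] add_right_mono])
      (use i iA s rho in \<open>auto intro: transfer_op_L1_dist transfer_op_integral\<close>)
  moreover have "(\<lambda>n. L1_dist (pf_iter (s n) m u) ?A + L1_dist (transfer_op (s n m) ?A) (transfer_op \<rho> ?A)) \<longlonglongrightarrow> 0"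
    using Suc transfer_op_continuous_par[OF s rho lim iA, of m] by (auto intro!: tendsto_eq_intros)
  ultimately show ?case
    by (rule null_sandwich) simp
qed (simp add: L1_dist_def L1_norm_def)

text \<open>After \<open>n\<close> steps the image of a kernel is an average of kernels, so
  restarting from any single kernel at that time makes an error that \<open>m\<close> further steps
  contract.\<close>

lemma pf_iter_shift_dist:
  assumes r: "\<And>i. r i \<in> Pars" and y: "y \<in> Y" and z: "z \<in> Y"
  shows "L1_dist (pf_iter r (n + m) (kern y)) (pf_iter (\<lambda>i. r (n + i)) m (kern z)) \<le> (19/20)^m * (20/3)"
  unfolding L1_dist_def
proof (rule L1_norm_le_bound)
  show "integrable lam (\<lambda>x. pf_iter r (n + m) (kern y) x - pf_iter (\<lambda>i. r (n + i)) m (kern z) x)"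
    using r y z by (simp add: pf_iter_integral integrable_kern)
  fix x assume x: "x \<in> X"
  have "\<bar>dual_iter r (n + m) (\<lambda>y. kern y x) y - dual_iter (\<lambda>i. r (n + i)) m (\<lambda>y. kern y x) z\<bar> \<le> (19/20)^m * (20/3)"
    unfolding dual_iter_add
  proof (rule dual_iter_bounds[OF r y])
    fix u assume "u \<in> Y"
    then show "\<bar>dual_iter (\<lambda>i. r (n + i)) m (\<lambda>y. kern y x) u - dual_iter (\<lambda>i. r (n + i)) m (\<lambda>y. kern y x) z\<bar>
        \<le> (19/20)^m * (20/3)"
      using dual_iter_osc[of "\<lambda>i. r (n + i)", OF r kern_lip[OF x] _ z, where n = m] by simp
  qed
  then show "\<bar>pf_iter r (n + m) (kern y) x - pf_iter (\<lambda>i. r (n + i)) m (kern z) x\<bar> \<le> (19/20)^m * (20/3)"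
    using r y z x by (simp add: pf_iter_kern)
qed

text \<open>Only the last \<open>m\<close> steps matter, up to an error geometric in
  \<open>m\<close>; in a window of fixed length \<open>m\<close> the parameters are eventually near
  \<open>\<rho>\<close>, and \<open>m\<close> constant steps lead close to the invariant density.
  Hence \<open>m\<close> is chosen before \<open>n\<close>.\<close>

lemma pf_iter_tendsto:
  assumes r: "\<And>i. r i \<in> Pars" and rho: "\<rho> \<in> Pars" and lim: "r \<longlonglongrightarrow> \<rho>" and u: "u \<in> densities"
  shows "(\<lambda>n. L1_dist (pf_iter r n u) (inv_dens \<rho>)) \<longlonglongrightarrow> 0"
proof -
  let ?k = "kern 0" and ?U = "inv_dens \<rho>"
  have k: "?k \<in> densities" "integrable lam ?k" by (simp_all only: kern_density integrable_kern zero_in_Y)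
  have iU: "integrable lam ?U" using inv_dens_density[OF Pars_abs[OF rho]] densitiesD by blast
  have ik: "integrable lam (pf_iter s n ?k)" if "\<And>i. s i \<in> Pars" for s n
    using that k by (simp only: pf_iter_integral)
  have K: "(\<lambda>n. L1_dist (pf_iter r n ?k) ?U) \<longlonglongrightarrow> 0"
  proof (rule LIMSEQ_I)
    fix \<epsilon> :: real assume e: "0 < \<epsilon>"
    have "eventually (\<lambda>m. (19/20 :: real)^m * (20/3) < \<epsilon>/3) sequentially"
      using e by (intro order_tendstoD(2)[OF kern_contraction_null]) auto
    moreover have "eventually (\<lambda>m. L1_dist (pf_iter (\<lambda>_. \<rho>) m ?k) ?U < \<epsilon>/3) sequentially"
      using e by (intro order_tendstoD(2)[OF pf_iter_const_tendsto[OF rho k(1)]]) auto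
    ultimately obtain m where m: "(19/20 :: real)^m * (20/3) < \<epsilon>/3" "L1_dist (pf_iter (\<lambda>_. \<rho>) m ?k) ?U < \<epsilon>/3"
      by (metis (mono_tags, lifting) eventually_conj eventually_happens' sequentially_bot)
    have "(\<lambda>n. L1_dist (pf_iter (\<lambda>i. r (n + i)) m ?k) (pf_iter (\<lambda>_. \<rho>) m ?k)) \<longlonglongrightarrow> 0"
      by (intro pf_iter_continuous_par r rho k(2) LIMSEQ_ignore_initial_segment[OF lim])
    then have "eventually (\<lambda>n. L1_dist (pf_iter (\<lambda>i. r (n + i)) m ?k) (pf_iter (\<lambda>_. \<rho>) m ?k) < \<epsilon>/3) sequentially"
      using e by (intro order_tendstoD(2)) auto
    then obtain N where N: "\<And>n. n \<ge> N \<Longrightarrow> L1_dist (pf_iter (\<lambda>i. r (n + i)) m ?k) (pf_iter (\<lambda>_. \<rho>) m ?k) < \<epsilon>/3"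
      by (auto simp: eventually_sequentially)
    have "norm (L1_dist (pf_iter r n ?k) ?U - 0) < \<epsilon>" if n: "n \<ge> N + m" for n
    proof -
      define n' where "n' = n - m"
      have n': "n = n' + m" "n' \<ge> N" using n by (auto simp: n'_def)
      let ?a = "pf_iter r n ?k" and ?b = "pf_iter (\<lambda>i. r (n' + i)) m ?k" and ?c = "pf_iter (\<lambda>_. \<rho>) m ?k"
      have i: "integrable lam ?a" "integrable lam ?b" "integrable lam ?c" using r rho by (intro ik; blast)+
      have "L1_dist ?a ?U \<le> L1_dist ?a ?b + (L1_dist ?b ?c + L1_dist ?c ?U)"
        using L1_dist_triangle[OF i(1,2) iU] L1_dist_triangle[OF i(2,3) iU] by linarith
      then show ?thesis
        using N[OF n'(2)] m pf_iter_shift_dist[of r, OF r zero_in_Y zero_in_Y, where n = n' and m = m] unfolding n'(1) by simp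
    qed
    then show "\<exists>N. \<forall>n\<ge>N. norm (L1_dist (pf_iter r n ?k) ?U - 0) < \<epsilon>" by blast
  qed
  have "L1_dist (pf_iter r n u) ?U \<le> L1_dist (pf_iter r n u) (pf_iter r n ?k) + L1_dist (pf_iter r n ?k) ?U" for n
    using u r iU ik[OF r] densitiesD by (intro L1_dist_triangle pf_iter_integral) auto
  moreover have "(\<lambda>n. L1_dist (pf_iter r n u) (pf_iter r n ?k) + L1_dist (pf_iter r n ?k) ?U) \<longlonglongrightarrow> 0"
    using tendsto_add[OF memory_loss[OF r u k(1)] K] by simp
  ultimately show ?thesis
    by (rule null_sandwich) simp
qed

section \<open>Parameter sequences driven by their own field\<close>

lemma kern_mean_in_X: "y \<in> Y \<Longrightarrow> kern_mean y \<in> X"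
  unfolding kern_mean_def by (intro phi_density_in_X kern_density)

lemma dual_iter_kern_mean_const:
  assumes "\<rho> \<in> Pars" "y \<in> Y"
  shows "(\<lambda>n. dual_iter (\<lambda>_. \<rho>) n kern_mean y) \<longlonglongrightarrow> phi (inv_dens \<rho>)"
proof -
  have i: "integrable lam (pf_iter (\<lambda>_. \<rho>) n (kern y))" for n
    using assms by (intro pf_iter_integral integrable_kern)
  have iU: "integrable lam (inv_dens \<rho>)"
    using densitiesD(1)[OF inv_dens_density[OF Pars_abs[OF assms(1)]]] .
  have "(\<lambda>n. \<bar>dual_iter (\<lambda>_. \<rho>) n kern_mean y - phi (inv_dens \<rho>)\<bar>) \<longlonglongrightarrow> 0"
  proof (rule null_sandwich)
    show "\<bar>dual_iter (\<lambda>_. \<rho>) n kern_mean y - phi (inv_dens \<rho>)\<bar> \<le> L1_dist (pf_iter (\<lambda>_. \<rho>) n (kern y)) (inv_dens \<rho>) / 2" for n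
      using phi_diff_le[OF i iU, of n] phi_pf_iter_kern[of "\<lambda>_. \<rho>" y n] assms by simp
    show "(\<lambda>n. L1_dist (pf_iter (\<lambda>_. \<rho>) n (kern y)) (inv_dens \<rho>) / 2) \<longlonglongrightarrow> 0"
      using tendsto_divide[OF pf_iter_const_tendsto[OF assms(1) kern_density[OF assms(2)]] tendsto_const, of 2] by simp
  qed simp
  then show ?thesis by (simp add: LIM_zero_iff tendsto_rabs_zero_iff)
qed

lemma dual_iter_kern_mean_shift:
  assumes r: "\<And>i. r i \<in> Pars" and y: "y \<in> Y" and z: "z \<in> Y"
  shows "\<bar>dual_iter r (n + m) kern_mean y - dual_iter (\<lambda>i. r (n + i)) m kern_mean z\<bar> \<le> (19/20)^m * (10/3)"
  unfolding dual_iter_add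
proof (rule dual_iter_bounds[OF r y])
  fix u assume "u \<in> Y"
  then show "\<bar>dual_iter (\<lambda>i. r (n + i)) m kern_mean u - dual_iter (\<lambda>i. r (n + i)) m kern_mean z\<bar> \<le> (19/20)^m * (10/3)"
    using dual_iter_osc[of "\<lambda>i. r (n + i)", OF r kern_mean_lip _ z, where n = m] by simp
qed

text \<open>Applied to an end of the support, with \<open>d\<close> a branch denominator. The sign
  of \<open>s\<close> is not known, only that it is not far below zero; the term
  \<open>2 * a\<close> absorbs the case in which division by the larger \<open>d\<close> goes the
  wrong way.\<close>

lemma contraction_step:
  fixes s d a :: real
  assumes "- (3 * a) < s" "3 \<le> d" "0 < a"
  shows "2 * s / d \<le> 2/3 * s + 2 * a"
proof (cases "0 \<le> s")
  case True
  then have "2 * s / d \<le> 2 * s / 3" using assms by (intro divide_left_mono) auto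
  then show ?thesis using assms by simp
next
  case False
  then have "2 * s / d \<le> 0" using assms by (simp add: divide_nonpos_pos)
  then show ?thesis using assms by simp
qed

lemma eventually_le_of_contraction:
  fixes l :: "nat \<Rightarrow> real"
  assumes "\<And>n. n \<ge> N \<Longrightarrow> l (Suc n) \<le> 2/3 * l n + 4 * a" "0 < a"
  shows "\<forall>\<^sub>F n in sequentially. l n \<le> 13 * a"
proof -
  \<comment> \<open>The recursion has the fixed point \<open>12 * a\<close>; the extra
    \<open>a\<close> in the conclusion leaves room for the transient.\<close>
  have b: "l (N + k) - 12 * a \<le> (2/3)^k * \<bar>l N - 12 * a\<bar>" for k
  proof (induction k)
    case (Suc k)
    have "l (N + Suc k) - 12 * a \<le> 2/3 * (l (N + k) - 12 * a)"
      using assms(1)[of "N + k"] by simp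
    also have "\<dots> \<le> 2/3 * ((2/3)^k * \<bar>l N - 12 * a\<bar>)" using Suc by (intro mult_left_mono) auto
    finally show ?case by simp
  qed simp
  have "(\<lambda>k. (2/3 :: real)^k * \<bar>l N - 12 * a\<bar>) \<longlonglongrightarrow> 0"
    by (auto intro!: tendsto_eq_intros LIMSEQ_power_zero)
  then have "\<forall>\<^sub>F k in sequentially. (2/3 :: real)^k * \<bar>l N - 12 * a\<bar> < a"
    using assms(2) by (rule order_tendstoD)
  then have "\<forall>\<^sub>F k in sequentially. l (k + N) \<le> 13 * a"
  proof eventually_elim
    case (elim k)
    then show ?case using b[of k] by (simp add: add.commute)
  qed
  then show ?thesis by (rule eventually_sequentially_seg[THEN iffD1])
qed

lemma tendsto_of_bounds:
  assumes "\<And>c. c < l \<Longrightarrow> \<forall>\<^sub>F n in sequentially. c \<le> r n" "\<And>c. l < c \<Longrightarrow> \<forall>\<^sub>F n in sequentially. r n \<le> (c::real)"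
  shows "r \<longlonglongrightarrow> l"
proof (rule order_tendstoI)
  fix a assume "a < l"
  then have "\<forall>\<^sub>F n in sequentially. (a + l) / 2 \<le> r n" by (intro assms) simp
  then show "\<forall>\<^sub>F n in sequentially. a < r n"
  proof eventually_elim
    case (elim n) then show ?case using \<open>a < l\<close> by (simp add: field_simps)
  qed
next
  fix a assume "l < a"
  then have "\<forall>\<^sub>F n in sequentially. r n \<le> (a + l) / 2" by (intro assms) simp
  then show "\<forall>\<^sub>F n in sequentially. r n < a"
  proof eventually_elim
    case (elim n) then show ?case using \<open>l < a\<close> by (simp add: field_simps)
  qed
qed

lemma X_uminus: "x \<in> X \<Longrightarrow> - x \<in> X"
  by (auto simp: X_def)

text \<open>The order-theoretic properties of \<open>G\<close> and \<open>H\<close> on which the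
  asymptotic analysis rests, separated from the derivatives from which they are obtained.\<close>

locale coupling =
  fixes G :: "real \<Rightarrow> real"
  assumes G_range: "x \<in> X \<Longrightarrow> G x \<in> Pars"
    and G_mono: "x \<in> X \<Longrightarrow> y \<in> X \<Longrightarrow> x \<le> y \<Longrightarrow> G x \<le> G y"
    and G_cont: "continuous_on X G"
    and G_odd: "x \<in> X \<Longrightarrow> G (- x) = - G x"
    and H_cont: "continuous_on Pars (H_fun G)"
    and H_odd: "r \<in> Pars \<Longrightarrow> H_fun G (- r) = - H_fun G r"
begin

text \<open>As \<open>kern 0\<close> is the uniform density, the iterates of \<open>kern_mean\<close> at \<open>0\<close> are the means along
  its images under the operators with parameters \<open>r\<close>.\<close>

definition driven :: "(nat \<Rightarrow> real) \<Rightarrow> (nat \<Rightarrow> real) \<Rightarrow> bool" where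
  "driven r x \<longleftrightarrow> (\<forall>n. x n \<in> X \<and> r n = G (x n)) \<and> (\<lambda>n. x n - dual_iter r n kern_mean 0) \<longlonglongrightarrow> 0"

lemma driven_Pars: "driven r x \<Longrightarrow> r n \<in> Pars"
  using G_range by (auto simp: driven_def)

lemma driven_reflect:
  assumes "driven r x"
  shows "driven (\<lambda>n. - r n) (\<lambda>n. - x n)"
proof -
  have "(\<lambda>n. - (x n - dual_iter r n kern_mean 0)) \<longlonglongrightarrow> - 0"
    using assms by (intro tendsto_minus) (simp add: driven_def)
  moreover have "dual_iter (\<lambda>i. - r i) n kern_mean 0 = - dual_iter r n kern_mean 0" for n
    using dual_iter_odd[of r 0 kern_mean n] driven_Pars[OF assms] by (simp add: kern_mean_odd)
  ultimately show ?thesis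
    using assms by (auto simp: driven_def G_odd X_uminus)
qed

text \<open>Restart from the uniform density at a time after which the parameters are at most
  \<open>\<rho>\<close>: by monotonicity the means are then bounded by those for the constant
  parameter \<open>\<rho>\<close>, which converge to the mean of
  \<open>inv_dens \<rho>\<close>.\<close>

lemma driven_upper_step:
  assumes d: "driven r x" and rho: "\<rho> \<in> Pars" and ev: "\<forall>\<^sub>F n in sequentially. r n \<le> \<rho>" and e: "0 < \<epsilon>"
  shows "\<forall>\<^sub>F n in sequentially. r n \<le> H_fun G \<rho> + \<epsilon>"
proof -
  note rP = driven_Pars[OF d]
  obtain N where N: "\<And>n. n \<ge> N \<Longrightarrow> r n \<le> \<rho>" using ev by (auto simp: eventually_sequentially)
  let ?p = "phi (inv_dens \<rho>)"
  have pX: "?p \<in> X" by (intro phi_density_in_X inv_dens_density Pars_abs rho)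
  \<comment> \<open>The summands account for the constant-parameter comparison, the restart at time
    \<open>N\<close>, and the error allowed in \<open>driven\<close>.\<close>
  define b where "b m = dual_iter (\<lambda>_. \<rho>) m kern_mean 0 + (19/20)^m * (10/3)
      + \<bar>x (m + N) - dual_iter r (m + N) kern_mean 0\<bar>" for m
  have "b \<longlonglongrightarrow> ?p + 0 + 0"
    unfolding b_def
    by (intro tendsto_add dual_iter_kern_mean_const rho zero_in_Y kern_contraction_null tendsto_rabs_zero
        LIMSEQ_ignore_initial_segment conjunct2[OF d[unfolded driven_def]])
  then have b: "b \<longlonglongrightarrow> ?p" by simp
  have xb: "x (m + N) \<le> b m" for m
  proof -
    have "dual_iter (\<lambda>i. r (N + i)) m kern_mean 0 \<le> dual_iter (\<lambda>_. \<rho>) m kern_mean 0"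
      using rP rho N kern_mean_mono by (intro dual_iter_mono_par) auto
    then show ?thesis
      using dual_iter_kern_mean_shift[of r, OF rP zero_in_Y zero_in_Y, where n = N and m = m]
      unfolding b_def add.commute[of m N] abs_le_iff by linarith
  qed
  obtain \<delta> where \<delta>: "0 < \<delta>" "\<And>z. z \<in> X \<Longrightarrow> \<bar>z - ?p\<bar> < \<delta> \<Longrightarrow> \<bar>G z - G ?p\<bar> < \<epsilon>"
    using G_cont[unfolded continuous_on_iff] pX e unfolding dist_real_def by meson
  have "\<forall>\<^sub>F m in sequentially. b m < ?p + \<delta>"
    using b \<delta>(1) by (intro order_tendstoD) auto
  then have "\<forall>\<^sub>F m in sequentially. r (m + N) \<le> H_fun G \<rho> + \<epsilon>"
  proof eventually_elim
    case (elim m)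
    have xX: "x (m + N) \<in> X" and rG: "r (m + N) = G (x (m + N))" using d by (auto simp: driven_def)
    show ?case
    proof (cases "x (m + N) \<le> ?p")
      case True
      then show ?thesis using G_mono[OF xX pX] e rG by (simp add: H_fun_def)
    next
      case False
      then have "\<bar>x (m + N) - ?p\<bar> < \<delta>" using elim xb[of m] by simp
      then show ?thesis using \<delta>(2)[OF xX] rG by (simp add: H_fun_def)
    qed
  qed
  then show ?thesis by (rule eventually_sequentially_seg[THEN iffD1])
qed

text \<open>Here \<open>\<rho>\<close> is the limit superior, obtained as the infimum of the
  eventual upper bounds. The upper step gives \<open>\<rho> <= H s\<close> for each such bound
  \<open>s\<close>, and continuity of \<open>H\<close> lets \<open>s\<close> tend to
  \<open>\<rho>\<close>.\<close>

lemma driven_limsup: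
  assumes d: "driven r x"
  shows "\<exists>\<rho>\<in>Pars. \<rho> \<le> H_fun G \<rho> \<and> (\<forall>c>\<rho>. \<forall>\<^sub>F n in sequentially. r n \<le> c)
    \<and> (\<forall>c. (\<forall>\<^sub>F n in sequentially. r n \<le> c) \<longrightarrow> \<rho> \<le> c)"
proof -
  define S where "S = {\<rho>\<in>Pars. \<forall>\<^sub>F n in sequentially. r n \<le> \<rho>}"
  have rb: "-2/5 \<le> r n" "r n \<le> 2/5" for n using driven_Pars[OF d, of n] by (auto simp: Pars_def)
  have top: "2/5 \<in> S" using rb by (auto simp: S_def Pars_def)
  have SP: "S \<subseteq> Pars" by (auto simp: S_def)
  have bdd: "bdd_below S" by (rule bdd_belowI[of _ "-2/5"]) (auto simp: S_def Pars_def)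
  define \<rho> where "\<rho> = Inf S"
  have low: "\<rho> \<le> s" if "s \<in> S" for s unfolding \<rho>_def using that bdd by (rule cInf_lower)
  have "-2/5 \<le> \<rho>"
    unfolding \<rho>_def by (rule cInf_greatest) (use top SP in \<open>auto simp: Pars_def\<close>)
  then have rP: "\<rho> \<in> Pars"
    using low[OF top] by (simp add: Pars_def)
  have ev: "\<forall>\<^sub>F n in sequentially. r n \<le> c" if "\<rho> < c" for c
  proof -
    have "\<exists>s\<in>S. s < c" by (rule cInf_lessD) (use top that in \<open>auto simp: \<rho>_def\<close>)
    then obtain s where "s \<in> S" "s < c" by blast
    then have "\<forall>\<^sub>F n in sequentially. r n \<le> s" by (simp add: S_def)
    then show ?thesis by eventually_elim (use \<open>s < c\<close> in simp)
  qed
  have le: "\<rho> \<le> c" if c: "\<forall>\<^sub>F n in sequentially. r n \<le> c" for c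
  proof (cases "c \<le> 2/5")
    case True
    obtain n where "r n \<le> c" using eventually_happens'[OF sequentially_bot c] by auto
    then have "c \<in> S" using c True rb(1)[of n] by (auto simp: S_def Pars_def)
    then show ?thesis by (rule low)
  next
    case False
    then show ?thesis using low[OF top] by simp
  qed
  have H: "\<rho> \<le> H_fun G s" if "s \<in> S" for s
    by (rule field_le_epsilon, rule le, rule driven_upper_step[OF d]) (use that in \<open>auto simp: S_def\<close>)
  have cl: "\<rho> \<in> closure S"
    unfolding \<rho>_def using top bdd by (intro closure_contains_Inf) auto
  have "\<rho> \<le> H_fun G \<rho>"
  proof (rule field_le_epsilon)
    fix e :: real assume e: "0 < e"
    obtain \<delta> where \<delta>: "0 < \<delta>" "\<And>z. z \<in> Pars \<Longrightarrow> dist z \<rho> < \<delta> \<Longrightarrow> dist (H_fun G z) (H_fun G \<rho>) < e"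
      using H_cont[unfolded continuous_on_iff] rP e by meson
    obtain s where s: "s \<in> S" "dist s \<rho> < \<delta>" using cl \<delta>(1) unfolding closure_approachable by auto
    have "\<bar>H_fun G s - H_fun G \<rho>\<bar> < e" using \<delta>(2)[of s] s SP by (auto simp: dist_real_def)
    then show "\<rho> \<le> H_fun G \<rho> + e" using H[OF s(1)] by simp
  qed
  with rP ev le show ?thesis by blast
qed

lemma driven_liminf:
  assumes d: "driven r x"
  shows "\<exists>\<rho>\<in>Pars. H_fun G \<rho> \<le> \<rho> \<and> (\<forall>c<\<rho>. \<forall>\<^sub>F n in sequentially. c \<le> r n)
    \<and> (\<forall>c. (\<forall>\<^sub>F n in sequentially. c \<le> r n) \<longrightarrow> c \<le> \<rho>)"
proof -
  obtain \<rho> where \<rho>: "\<rho> \<in> Pars" "\<rho> \<le> H_fun G \<rho>" "\<And>c. \<rho> < c \<Longrightarrow> \<forall>\<^sub>F n in sequentially. - r n \<le> c"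
    "\<And>c. \<forall>\<^sub>F n in sequentially. - r n \<le> c \<Longrightarrow> \<rho> \<le> c"
    using driven_limsup[OF driven_reflect[OF d]] by blast
  show ?thesis
  proof (intro bexI[of _ "- \<rho>"] conjI allI impI)
    show "\<forall>\<^sub>F n in sequentially. c \<le> r n" if "c < - \<rho>" for c
      using \<rho>(3)[of "- c"] that by simp
    show "c \<le> - \<rho>" if "\<forall>\<^sub>F n in sequentially. c \<le> r n" for c
      using \<rho>(4)[of "- c"] that by simp
  qed (use \<rho>(1,2) H_odd[OF \<rho>(1)] in auto)
qed

text \<open>The limit superior satisfies \<open>\<rho> <= H \<rho>\<close> and so cannot be
  positive; by oddness the limit inferior cannot be negative.\<close>

lemma driven_stable:
  assumes d: "driven r x" and H: "\<And>s. s \<in> Pars \<Longrightarrow> 0 < s \<Longrightarrow> H_fun G s < s"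
  shows "r \<longlonglongrightarrow> 0"
proof (rule tendsto_of_bounds)
  obtain \<rho> where \<rho>: "\<rho> \<in> Pars" "\<rho> \<le> H_fun G \<rho>" "\<And>c. \<rho> < c \<Longrightarrow> \<forall>\<^sub>F n in sequentially. r n \<le> c"
    "\<And>c. \<forall>\<^sub>F n in sequentially. r n \<le> c \<Longrightarrow> \<rho> \<le> c"
    using driven_limsup[OF d] by blast
  have "\<rho> \<le> 0" using H[OF \<rho>(1)] \<rho>(2) by linarith
  then show "\<forall>\<^sub>F n in sequentially. r n \<le> c" if "0 < c" for c
    using that by (intro \<rho>(3)) linarith
  obtain \<sigma> where \<sigma>: "\<sigma> \<in> Pars" "H_fun G \<sigma> \<le> \<sigma>" "\<And>c. c < \<sigma> \<Longrightarrow> \<forall>\<^sub>F n in sequentially. c \<le> r n"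
    "\<And>c. \<forall>\<^sub>F n in sequentially. c \<le> r n \<Longrightarrow> c \<le> \<sigma>"
    using driven_liminf[OF d] by blast
  have "0 \<le> \<sigma>" using H[of "- \<sigma>"] H_odd[OF \<sigma>(1)] \<sigma>(1,2) by (cases "\<sigma> < 0") auto
  then show "\<forall>\<^sub>F n in sequentially. c \<le> r n" if "c < 0" for c
    using that by (intro \<sigma>(3)) linarith
qed

end

text \<open>The last assumption makes trapping self-sustaining: a measure to the right of
  \<open>a\<close> has mean at least \<open>kern_mean a\<close>, and the parameter produced by this
  mean exceeds the value \<open>a / (1 - a)\<close> that keeps the measure to the right of
  \<open>a\<close>.\<close>

locale bistable_coupling = coupling +
  fixes rs a0 :: real
  assumes rs: "0 < rs" "rs \<in> Pars"
    and H_above: "r \<in> Pars \<Longrightarrow> 0 < r \<Longrightarrow> r < rs \<Longrightarrow> r < H_fun G r"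
    and H_below: "r \<in> Pars \<Longrightarrow> rs < r \<Longrightarrow> H_fun G r < r"
    and a0: "0 < a0" "a0 \<le> 1/2"
    and G_kern_mean: "0 < a \<Longrightarrow> a < a0 \<Longrightarrow> a / (1 - a) < G (kern_mean a)"
begin

text \<open>The bound \<open>c\<close> makes the limit inferior positive, and on the positive side
  the two inequalities for \<open>H\<close> leave only \<open>rs\<close> for both limits.\<close>

lemma driven_positive:
  assumes d: "driven r x" and c: "0 < c" "\<forall>\<^sub>F n in sequentially. c \<le> r n"
  shows "r \<longlonglongrightarrow> rs"
proof (rule tendsto_of_bounds)
  obtain \<rho> where \<rho>: "\<rho> \<in> Pars" "\<rho> \<le> H_fun G \<rho>" "\<And>c. \<rho> < c \<Longrightarrow> \<forall>\<^sub>F n in sequentially. r n \<le> c"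
    "\<And>c. \<forall>\<^sub>F n in sequentially. r n \<le> c \<Longrightarrow> \<rho> \<le> c"
    using driven_limsup[OF d] by blast
  have "\<rho> \<le> rs" using H_below[OF \<rho>(1)] \<rho>(2) by linarith
  then show "\<forall>\<^sub>F n in sequentially. r n \<le> c" if "rs < c" for c
    using that by (intro \<rho>(3)) linarith
  obtain \<sigma> where \<sigma>: "\<sigma> \<in> Pars" "H_fun G \<sigma> \<le> \<sigma>" "\<And>c. c < \<sigma> \<Longrightarrow> \<forall>\<^sub>F n in sequentially. c \<le> r n"
    "\<And>c. \<forall>\<^sub>F n in sequentially. c \<le> r n \<Longrightarrow> c \<le> \<sigma>"
    using driven_liminf[OF d] by blast
  have "0 < \<sigma>" using \<sigma>(4)[OF c(2)] c(1) by simp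
  then have "rs \<le> \<sigma>" using H_above[OF \<sigma>(1)] \<sigma>(2) by linarith
  then show "\<forall>\<^sub>F n in sequentially. c \<le> r n" if "c < rs" for c
    using that by (intro \<sigma>(3)) linarith
qed

lemma trap_point_facts:
  assumes "0 < a" "a < a0"
  shows "a \<in> Y" "0 < a / (1 - a)" "a < 1"
  using assms a0 by (auto simp: Y_def)

text \<open>The strict inequality in \<open>G_kern_mean\<close> leaves a margin for errors in the
  mean, needed for the vanishing error of driven sequences and for perturbed initial
  densities.\<close>

lemma trap_margin:
  assumes a: "0 < a" "a < a0"
  shows "\<exists>\<epsilon>>0. \<forall>z\<in>X. kern_mean a - \<epsilon> \<le> z \<longrightarrow> a / (1 - a) \<le> G z"
proof -
  let ?k = "kern_mean a"
  have kX: "?k \<in> X" by (intro kern_mean_in_X trap_point_facts a)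
  have gap: "0 < G ?k - a / (1 - a)" using G_kern_mean[OF a] by simp
  obtain \<delta> where \<delta>: "0 < \<delta>" "\<And>z. z \<in> X \<Longrightarrow> dist z ?k < \<delta> \<Longrightarrow> dist (G z) (G ?k) < G ?k - a / (1 - a)"
    using G_cont[unfolded continuous_on_iff] kX gap by meson
  show ?thesis
  proof (intro exI[of _ "\<delta> / 2"] conjI ballI impI)
    fix z assume z: "z \<in> X" "?k - \<delta> / 2 \<le> z"
    show "a / (1 - a) \<le> G z"
    proof (cases "?k \<le> z")
      case True
      then show ?thesis using G_mono[OF kX z(1)] gap by simp
    next
      case False
      then have "dist z ?k < \<delta>" using z \<delta>(1) by (simp add: dist_real_def)
      then have "\<bar>G z - G ?k\<bar> < G ?k - a / (1 - a)" using \<delta>(2)[OF z(1)] by (simp add: dist_real_def)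
      then show ?thesis by simp
    qed
  qed (use \<delta> in simp)
qed

text \<open>Once the error in the mean is below the margin, a left end beyond \<open>a\<close> would
  stay beyond \<open>a\<close> for ever; the parameters would then be bounded away from zero and
  tend to \<open>rs\<close>.\<close>

lemma low_orbit_small:
  assumes d: "driven r x" and nlim: "\<not> r \<longlonglongrightarrow> rs" and a: "0 < a" "a < a0"
  shows "\<forall>\<^sub>F n in sequentially. low_orbit r n < a"
proof -
  note rP = driven_Pars[OF d] and af = trap_point_facts[OF a]
  obtain \<epsilon> where e: "0 < \<epsilon>" "\<And>z. z \<in> X \<Longrightarrow> kern_mean a - \<epsilon> \<le> z \<Longrightarrow> a / (1 - a) \<le> G z"
    using trap_margin[OF a] by blast
  have "(\<lambda>n. x n - dual_iter r n kern_mean 0) \<longlonglongrightarrow> 0" using d unfolding driven_def by (rule conjunct2)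
  then obtain N where N: "\<And>n. n \<ge> N \<Longrightarrow> \<bar>x n - dual_iter r n kern_mean 0\<bar> < \<epsilon>"
    using LIMSEQ_D[OF _ e(1)] by fastforce
  have par: "a / (1 - a) \<le> r n" if "n \<ge> N" "a \<le> low_orbit r n" for n
  proof -
    have "kern_mean a \<le> kern_mean (low_orbit r n)"
      by (rule mono_YD[OF kern_mean_mono af(1) low_orbit_in_Y[OF rP] that(2)])
    also have "\<dots> \<le> dual_iter r n kern_mean 0"
      by (rule dual_iter_ge_low_orbit[OF rP kern_mean_mono])
    finally have "kern_mean a - \<epsilon> \<le> x n" using N[OF that(1)] by linarith
    then show ?thesis using e(2)[of "x n"] d by (simp add: driven_def)
  qed
  have False if n: "n \<ge> N" "a \<le> low_orbit r n" for n
  proof -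
    have "a \<le> low_orbit r m" if "m \<ge> n" for m
      using that
    proof (induction m rule: dec_induct)
      case (step m)
      have "a / (1 - a) \<le> r m" by (rule par) (use step n in auto)
      then show ?case
        unfolding low_orbit.simps using step a
        by (intro left_branch_ge rP low_orbit_in_Y[OF rP]) auto
    qed (use n in simp)
    then have "a / (1 - a) \<le> r m" if "m \<ge> n" for m
      using par[of m] n that by simp
    then have "\<forall>\<^sub>F m in sequentially. a / (1 - a) \<le> r m" by (auto simp: eventually_sequentially)
    then show False using driven_positive[OF d af(2)] nlim by simp
  qed
  then show ?thesis by (auto simp: eventually_sequentially not_le[symmetric])
qed

text \<open>If neither \<open>rs\<close> nor \<open>- rs\<close> is the limit, the left end of the
  support is eventually below every small \<open>a\<close> and the right end above
  \<open>- a\<close>. The length of the support then contracts up to terms of order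
  \<open>a\<close>, which forces the parameters to be of order \<open>a\<close> too.\<close>

lemma driven_trichotomy:
  assumes d: "driven r x"
  shows "r \<longlonglongrightarrow> 0 \<or> r \<longlonglongrightarrow> rs \<or> r \<longlonglongrightarrow> - rs"
proof (rule ccontr)
  assume contr: "\<not> ?thesis"
  let ?r = "\<lambda>n. - r n"
  note d' = driven_reflect[OF d] and rP = driven_Pars[OF d] and rP' = driven_Pars[OF driven_reflect[OF d]]
  have n1: "\<not> r \<longlonglongrightarrow> rs" and n2: "\<not> ?r \<longlonglongrightarrow> rs"
    using contr tendsto_minus[of ?r rs] by auto
  have small: "\<forall>\<^sub>F n in sequentially. \<bar>r n\<bar> \<le> 17 * a" if a: "0 < a" "a < a0" for a
  proof -
    \<comment> \<open>The support of the measure at time \<open>n\<close> extends from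
      \<open>A n\<close> to \<open>- B n\<close>, so \<open>- A n - B n\<close> is its
      length.\<close>
    define A where "A n = low_orbit r n" for n
    define B where "B n = low_orbit ?r n" for n
    have "\<forall>\<^sub>F n in sequentially. A n < a \<and> B n < a"
      using low_orbit_small[OF d n1 a] low_orbit_small[OF d' n2 a] unfolding A_def B_def
      by (rule eventually_conj)
    then obtain N where N: "\<And>n. n \<ge> N \<Longrightarrow> A n < a" "\<And>n. n \<ge> N \<Longrightarrow> B n < a"
      by (auto simp: eventually_sequentially)
    \<comment> \<open>The branch value is \<open>2 * (s + z)\<close> over a denominator between 16/5
      and 6; the upper bound gives the first part and the lower bound the second.\<close>
    have key: "s + z < 3 * a \<and> - left_branch s z \<le> 2/3 * (- (s + z)) + 2 * a"
      if s: "s \<in> Pars" "z \<in> Y" "left_branch s z < a" for s z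
    proof -
      let ?d = "4 + s * z + (s + z)"
      note b = denom_bounds[OF s(1,2)]
      have "2 * (s + z) < a * ?d"
        using s(3) b by (simp add: left_branch_def pos_divide_less_eq)
      also have "\<dots> \<le> a * 6" using a b by (intro mult_left_mono) auto
      finally have lt: "s + z < 3 * a" by simp
      have "2 * (- (s + z)) / ?d \<le> 2/3 * (- (s + z)) + 2 * a"
        by (rule contraction_step) (use lt b a in auto)
      moreover have "- left_branch s z = 2 * (- (s + z)) / ?d"
        unfolding left_branch_def by (simp only: mult_minus_right minus_divide_left)
      ultimately show ?thesis using lt by simp
    qed
    have kA: "r n + A n < 3 * a \<and> - A (Suc n) \<le> 2/3 * (- (r n + A n)) + 2 * a" if "n \<ge> N" for n
      using key[OF rP[of n] low_orbit_in_Y[of r n, OF rP]] N(1)[of "Suc n"] that by (simp add: A_def)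
    have kB: "- r n + B n < 3 * a \<and> - B (Suc n) \<le> 2/3 * (- (- r n + B n)) + 2 * a" if "n \<ge> N" for n
      using key[OF rP'[of n] low_orbit_in_Y[of ?r n, OF rP']] N(2)[of "Suc n"] that by (simp add: B_def)
    \<comment> \<open>Adding the estimates for the two ends cancels the parameter
      \<open>r n\<close>.\<close>
    have "- A (Suc n) - B (Suc n) \<le> 2/3 * (- A n - B n) + 4 * a" if "n \<ge> N" for n
    proof -
      have "- A (Suc n) + - B (Suc n) \<le> 2/3 * (- (r n + A n)) + 2 * a + (2/3 * (- (- r n + B n)) + 2 * a)"
        using kA[OF that] kB[OF that] by (intro add_mono) auto
      also have "\<dots> = 2/3 * (- A n - B n) + 4 * a"
        by argo
      finally show ?thesis by simp
    qed
    then have "\<forall>\<^sub>F n in sequentially. - A n - B n \<le> 13 * a"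
      using eventually_le_of_contraction[of N "\<lambda>n. - A n - B n" a] a by simp
    then have "\<forall>\<^sub>F n in sequentially. n \<ge> N \<and> - A n - B n \<le> 13 * a"
      using eventually_ge_at_top[of N] by eventually_elim simp
    then show ?thesis
    proof eventually_elim
      case (elim n)
      \<comment> \<open>From \<open>B n < a\<close> follows \<open>- A n < 14 * a\<close>, and
        \<open>r n + A n < 3 * a\<close> then gives the bound \<open>17 * a\<close>; the other sign
        is symmetric.\<close>
      then show ?case using kA[of n] kB[of n] N(1)[of n] N(2)[of n] unfolding abs_le_iff by linarith
    qed
  qed
  have "r \<longlonglongrightarrow> 0"
  proof (rule LIMSEQ_I)
    fix e :: real assume e: "0 < e"
    define a where "a = min (a0 / 2) (e / 18)"
    have a: "0 < a" "a < a0" "17 * a < e" using e a0 by (auto simp: a_def)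
    from small[OF a(1,2)] obtain N where "\<And>n. n \<ge> N \<Longrightarrow> \<bar>r n\<bar> \<le> 17 * a"
      by (auto simp: eventually_sequentially)
    then show "\<exists>N. \<forall>n\<ge>N. norm (r n - 0) < e" using a(3) by (intro exI[of _ N]) fastforce
  qed
  with contr show False by simp
qed

end

section \<open>Orbits, fixed points and basins\<close>

lemma density_cong_AE:
  assumes "u \<in> densities" "integrable lam v" "ae_eq u v"
  shows "v \<in> densities"
proof -
  have "AE x in lam. 0 \<le> v x"
    using assms(1,3) unfolding densities_def ae_eq_def by (auto elim: eventually_elim2)
  moreover have "(LINT x|lam. v x) = (LINT x|lam. u x)"
    using integral_diff_le_L1[OF assms(2) densitiesD(1)[OF assms(1)]]
      L1_dist_eq_0_iff[OF assms(2) densitiesD(1)[OF assms(1)]] ae_eq_sym[OF assms(3)] by simp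
  ultimately show ?thesis using assms densitiesD(2)[OF assms(1)] by (simp add: densities_def)
qed

lemma L1_dist_tendsto_unique:
  assumes "\<And>n. integrable lam (u n)" "integrable lam v" "integrable lam w"
    and "(\<lambda>n. L1_dist (u n) v) \<longlonglongrightarrow> 0" "(\<lambda>n. L1_dist (u n) w) \<longlonglongrightarrow> 0"
  shows "ae_eq v w"
proof -
  have "(\<lambda>n. L1_dist (u n) v + L1_dist (u n) w) \<longlonglongrightarrow> 0 + 0"
    by (intro tendsto_add assms)
  moreover have "L1_dist v w \<le> L1_dist (u n) v + L1_dist (u n) w" for n
    using L1_dist_triangle[OF assms(2,1,3), of n] by (simp add: L1_dist_commute)
  ultimately have "L1_dist v w \<le> 0"
    by (intro LIMSEQ_le_const[of _ 0]) auto
  then have "L1_dist v w = 0" by (simp add: order_antisym)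
  then show ?thesis using L1_dist_eq_0_iff[OF assms(2,3)] by simp
qed

section \<open>Convexity and analyticity of the kernels\<close>

lemma deriv_recip_power_affine:
  fixes x y c :: real
  assumes "1 - x * y \<noteq> 0"
  shows "((\<lambda>x. c / (1 - x * y) ^ Suc m) has_real_derivative c * real (Suc m) * y / (1 - x * y) ^ Suc (Suc m)) (at x)"
proof -
  have g: "((\<lambda>u. c / u ^ Suc m) has_real_derivative - (c * real (Suc m)) / u ^ Suc (Suc m)) (at u)"
    if "u \<noteq> 0" for u :: real
  proof -
    have "((\<lambda>u. u ^ Suc m) has_real_derivative real (Suc m) * u ^ m) (at u)"
      using DERIV_pow[of "Suc m" u UNIV] by simp
    from DERIV_divide[OF DERIV_const this, of c] that show ?thesis
      by (simp del: of_nat_Suc add: field_simps)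
  qed
  have h: "((\<lambda>x. 1 - x * y) has_real_derivative - y) (at x)"
    by (auto intro!: derivative_eq_intros)
  show ?thesis using DERIV_chain2[OF g[OF assms] h] by simp
qed

lemma convex_on_kern:
  assumes y: "y \<in> Y"
  shows "convex_on X (kern y)"
proof (rule f''_ge0_imp_convex)
  show "convex X" by (simp add: X_def)
  let ?c = "1 - y\<^sup>2 / 4"
  have eq: "kern y = (\<lambda>x. ?c / (1 - x * y) ^ Suc 1)"
    by (simp add: kern_def fun_eq_iff power2_eq_square)
  fix x assume x: "x \<in> X"
  have n: "1 - x * y \<noteq> 0" using xy_bound(2)[OF y x] by auto
  show "(kern y has_real_derivative (?c * real (Suc 1) * y) / (1 - x * y) ^ Suc (Suc 1)) (at x)"
    unfolding eq by (rule deriv_recip_power_affine[OF n])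
  show "((\<lambda>x. (?c * real (Suc 1) * y) / (1 - x * y) ^ Suc (Suc 1)) has_real_derivative
      (?c * real (Suc 1) * y) * real (Suc (Suc 1)) * y / (1 - x * y) ^ Suc (Suc (Suc 1))) (at x)"
    by (rule deriv_recip_power_affine[OF n])
  have "0 \<le> ?c * (6 * y\<^sup>2 / ((1 - x * y)\<^sup>2)\<^sup>2)" using Y_sq[OF y] by simp
  then show "0 \<le> (?c * real (Suc 1) * y) * real (Suc (Suc 1)) * y / (1 - x * y) ^ Suc (Suc (Suc 1))"
    by (simp add: power2_eq_square mult_ac)
qed

lemma real_analytic_on_kern:
  assumes y: "y \<in> Y"
  shows "real_analytic_on (kern y) X"
  unfolding real_analytic_on_def
proof
  fix x assume x: "x \<in> X"
  \<comment> \<open>Re-centring at \<open>x\<close>: \<open>1 - z * y\<close> equals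
    \<open>(1 - x * y) * (1 - q * (z - x))\<close>, and \<open>q\<close> is at most 1 in absolute
    value because \<open>|y| <= 2/3 <= 1 - x * y\<close>. A uniform radius 1/2 is therefore
    safe.\<close>
  define q where "q = y / (1 - x * y)"
  define c where "c = (1 - y\<^sup>2 / 4) / (1 - x * y)\<^sup>2"
  note d = xy_bound[OF y x]
  have "\<bar>y\<bar> \<le> 2/3" using y by (auto simp: Y_def)
  then have q: "\<bar>q\<bar> \<le> 1" using d by (auto simp: q_def abs_divide divide_le_eq)
  show "\<exists>\<epsilon>>0. \<exists>a. \<forall>z\<in>X. \<bar>z - x\<bar> < \<epsilon> \<longrightarrow> (\<lambda>n. a n * (z - x) ^ n) sums kern y z"
  proof (intro exI[of _ "1/2"] conjI exI[of _ "\<lambda>n. c * (real (Suc n) * q ^ n)"] ballI impI)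
    fix z assume z: "z \<in> X" "\<bar>z - x\<bar> < 1/2"
    define t where "t = q * (z - x)"
    have "\<bar>t\<bar> \<le> 1 * \<bar>z - x\<bar>" unfolding t_def abs_mult using q by (intro mult_right_mono) auto
    then have t: "norm t < 1" using z(2) by simp
    have eq: "(1 - x * y) * (1 - t) = 1 - z * y" using d by (simp add: t_def q_def field_simps)
    have "(\<lambda>n. of_nat (Suc n) * t ^ n) sums (1 / (1 - t)\<^sup>2)" by (rule geometric_deriv_sums[OF t])
    then have "(\<lambda>n. c * (of_nat (Suc n) * t ^ n)) sums (c * (1 / (1 - t)\<^sup>2))" by (rule sums_mult)
    moreover have "c * (1 / (1 - t)\<^sup>2) = kern y z"
      unfolding c_def kern_def eq[symmetric] by (simp add: power_mult_distrib)
    moreover have "(\<lambda>n. c * (of_nat (Suc n) * t ^ n)) = (\<lambda>n. c * (real (Suc n) * q ^ n) * (z - x) ^ n)"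
      unfolding t_def power_mult_distrib by (simp only: mult_ac)
    ultimately show "(\<lambda>n. c * (real (Suc n) * q ^ n) * (z - x) ^ n) sums kern y z" by (simp only:)
  qed simp
qed

lemma pf_iter_cong_par: "(\<And>i. i < n \<Longrightarrow> r i = s i) \<Longrightarrow> pf_iter r n u = pf_iter s n u"
proof (induction n arbitrary: r s u)
  case (Suc n)
  have "pf_iter (\<lambda>i. r (Suc i)) n v = pf_iter (\<lambda>i. s (Suc i)) n v" for v
    by (rule Suc.IH) (rule Suc.prems, simp)
  then show ?case using Suc.prems[of 0] by simp
qed simp

section \<open>Self-consistent orbits as driven parameter sequences\<close>

context coupling
begin

definition orbit :: "(real \<Rightarrow> real) \<Rightarrow> nat \<Rightarrow> real \<Rightarrow> real" where
  "orbit u n = (PF_sc G ^^ n) u"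

definition param :: "(real \<Rightarrow> real) \<Rightarrow> nat \<Rightarrow> real" where
  "param u n = G (phi (orbit u n))"

lemma orbit_0 [simp]: "orbit u 0 = u"
  and orbit_Suc: "orbit u (Suc n) = PF_sc G (orbit u n)"
  and orbit_add: "orbit u (n + m) = orbit (orbit u m) n"
  by (simp_all add: orbit_def funpow_add)

lemma phi_Pars: "u \<in> densities \<Longrightarrow> G (phi u) \<in> Pars"
  by (intro G_range phi_density_in_X)

lemma PF_sc_ae:
  assumes "u \<in> densities"
  shows "PF_sc G u \<in> densities" "ae_eq (PF_sc G u) (transfer_op (G (phi u)) u)"
proof -
  note P = PF_ae_transfer[OF phi_Pars[OF assms] densitiesD(1)[OF assms]]
  show "ae_eq (PF_sc G u) (transfer_op (G (phi u)) u)" unfolding PF_sc_def by (rule P(2))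
  show "PF_sc G u \<in> densities"
    unfolding PF_sc_def
    by (rule density_cong_AE[OF transfer_op_density[OF phi_Pars[OF assms] assms] P(1) ae_eq_sym[OF P(2)]])
qed

lemma orbit_density: "u \<in> densities \<Longrightarrow> orbit u n \<in> densities"
  by (induction n) (simp_all add: orbit_Suc PF_sc_ae)

lemma param_Pars: "u \<in> densities \<Longrightarrow> param u n \<in> Pars"
  unfolding param_def by (intro phi_Pars orbit_density)

lemma orbit_ae:
  assumes u: "u \<in> densities"
  shows "ae_eq (orbit u n) (pf_iter (param u) n u)"
proof (induction n)
  case (Suc n)
  have "ae_eq (orbit u (Suc n)) (transfer_op (param u n) (orbit u n))"
    unfolding orbit_Suc param_def by (rule PF_sc_ae(2)[OF orbit_density[OF u]])
  moreover have "ae_eq (transfer_op (param u n) (orbit u n)) (pf_iter (param u) (Suc n) u)"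
    unfolding pf_iter_Suc_right using u
    by (intro transfer_op_cong_AE param_Pars Suc densitiesD(1) orbit_density pf_iter_density)
  ultimately show ?case by (rule ae_eq_trans)
qed simp

lemma orbit_phi:
  assumes u: "u \<in> densities"
  shows "phi (orbit u n) = phi (pf_iter (param u) n u)"
  using u by (intro phi_cong_AE orbit_ae densitiesD(1) orbit_density pf_iter_density param_Pars)

text \<open>Loss of memory along the orbit's own parameters replaces the initial density by the
  uniform one, with a vanishing error in the mean.\<close>

lemma orbit_driven:
  assumes u: "u \<in> densities"
  shows "driven (param u) (\<lambda>n. phi (orbit u n))"
  unfolding driven_def
proof (intro conjI allI)
  fix n show "phi (orbit u n) \<in> X" by (intro phi_density_in_X orbit_density u)
  show "param u n = G (phi (orbit u n))" by (simp add: param_def)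
next
  have p: "param u n \<in> Pars" for n by (rule param_Pars[OF u])
  have k: "kern 0 \<in> densities" by (rule kern_density) simp
  have e: "dual_iter (param u) n kern_mean 0 = phi (pf_iter (param u) n (kern 0))" for n
    by (rule phi_pf_iter_kern[symmetric, OF p zero_in_Y])
  have "(\<lambda>n. \<bar>phi (orbit u n) - dual_iter (param u) n kern_mean 0\<bar>) \<longlonglongrightarrow> 0"
  proof (rule null_sandwich)
    show "\<bar>phi (orbit u n) - dual_iter (param u) n kern_mean 0\<bar>
        \<le> L1_dist (pf_iter (param u) n u) (pf_iter (param u) n (kern 0)) / 2" for n
      unfolding e orbit_phi[OF u] by (intro phi_diff_le densitiesD(1) pf_iter_density p u k)
    show "(\<lambda>n. L1_dist (pf_iter (param u) n u) (pf_iter (param u) n (kern 0)) / 2) \<longlonglongrightarrow> 0"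
      using tendsto_divide[OF memory_loss[of "param u", OF p u k] tendsto_const, of 2] by simp
  qed simp
  then show "(\<lambda>n. phi (orbit u n) - dual_iter (param u) n kern_mean 0) \<longlonglongrightarrow> 0"
    by (simp add: tendsto_rabs_zero_iff)
qed

lemma inv_dens_Pars: "r \<in> Pars \<Longrightarrow> inv_dens r \<in> densities"
  by (intro inv_dens_density Pars_abs)

text \<open>Reduces convergence of densities in L1 to convergence of the scalar parameters.\<close>

lemma basinI:
  assumes u: "u \<in> densities" and rho: "\<rho> \<in> Pars" and lim: "param u \<longlonglongrightarrow> \<rho>"
  shows "u \<in> basin G (inv_dens \<rho>)"
proof -
  have "L1_dist (orbit u n) (inv_dens \<rho>) = L1_dist (pf_iter (param u) n u) (inv_dens \<rho>)" for n
    using u rho by (intro L1_dist_cong_AE orbit_ae ae_eq_refl densitiesD(1) orbit_density pf_iter_density param_Pars inv_dens_Pars)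
  then show ?thesis
    using pf_iter_tendsto[of "param u", OF param_Pars[OF u] rho lim u] u by (simp add: basin_def orbit_def)
qed

lemma PF_sc_cong_AE:
  assumes "u \<in> densities" "w \<in> densities" "ae_eq u w"
  shows "ae_eq (PF_sc G u) (PF_sc G w)"
proof -
  have "phi u = phi w" using assms by (intro phi_cong_AE densitiesD(1))
  moreover have "ae_eq (transfer_op (G (phi w)) u) (transfer_op (G (phi w)) w)"
    using assms by (intro transfer_op_cong_AE phi_Pars densitiesD(1))
  ultimately show ?thesis
    using PF_sc_ae(2)[OF assms(1)] ae_eq_sym[OF PF_sc_ae(2)[OF assms(2)]] by (metis ae_eq_trans)
qed

lemma fixed_density_orbit:
  assumes "fixed_density G v"
  shows "ae_eq (orbit v n) v"
proof (induction n)
  case (Suc n)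
  have v: "v \<in> densities" "ae_eq (PF_sc G v) v" using assms by (auto simp: fixed_density_def)
  then show ?case
    unfolding orbit_Suc using PF_sc_cong_AE[OF orbit_density[OF v(1)] v(1) Suc] by (metis ae_eq_trans)
qed simp

lemma fixed_density_in_basin:
  assumes "fixed_density G v"
  shows "v \<in> basin G v"
proof -
  have v: "v \<in> densities" using assms by (simp add: fixed_density_def)
  have "L1_dist (orbit v n) v = 0" for n
    using fixed_density_orbit[OF assms] L1_dist_eq_0_iff[OF densitiesD(1)[OF orbit_density[OF v]] densitiesD(1)[OF v]] by blast
  then show ?thesis using v by (simp add: basin_def orbit_def)
qed

lemma fixed_density_inv_dens:
  assumes "\<rho> \<in> Pars" "H_fun G \<rho> = \<rho>"
  shows "fixed_density G (inv_dens \<rho>)"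
proof -
  have g: "G (phi (inv_dens \<rho>)) = \<rho>" using assms by (simp add: H_fun_def)
  have "ae_eq (transfer_op \<rho> (inv_dens \<rho>)) (inv_dens \<rho>)"
    unfolding ae_eq_def using transfer_inv_dens[OF assms(1)] by (intro AE_I2) simp
  then show ?thesis
    unfolding fixed_density_def using PF_sc_ae(2)[OF inv_dens_Pars[OF assms(1)], unfolded g]
    by (auto intro: ae_eq_trans inv_dens_Pars assms)
qed

text \<open>The orbit of a fixed density has a constant parameter \<open>\<rho>\<close> and so tends
  to \<open>inv_dens \<rho>\<close>; since it also stays at \<open>v\<close>, the two
  coincide.\<close>

lemma fixed_density_cases:
  assumes v: "fixed_density G v"
  obtains \<rho> where "\<rho> \<in> Pars" "H_fun G \<rho> = \<rho>" "ae_eq v (inv_dens \<rho>)"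
proof -
  have vd: "v \<in> densities" using v by (simp add: fixed_density_def)
  define \<rho> where "\<rho> = G (phi v)"
  have rho: "\<rho> \<in> Pars" unfolding \<rho>_def by (rule phi_Pars[OF vd])
  have "phi (orbit v n) = phi v" for n
    by (rule phi_cong_AE[OF _ _ fixed_density_orbit[OF v]]) (simp_all add: densitiesD orbit_density vd)
  then have "param v = (\<lambda>_. \<rho>)" by (simp add: param_def \<rho>_def fun_eq_iff)
  then have "v \<in> basin G (inv_dens \<rho>)" using basinI[OF vd rho] by simp
  then have "ae_eq v (inv_dens \<rho>)"
    using fixed_density_in_basin[OF v] unfolding basin_def orbit_def[symmetric]
    by (intro L1_dist_tendsto_unique[of "orbit v"]) (auto simp: densitiesD orbit_density vd inv_dens_Pars rho)
  moreover from this have "H_fun G \<rho> = \<rho>"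
    using phi_cong_AE[OF densitiesD(1)[OF vd] densitiesD(1)[OF inv_dens_Pars[OF rho]]]
    by (simp add: H_fun_def \<rho>_def)
  ultimately show thesis using rho that by blast
qed

text \<open>The nonlinear step is continuous in L1 since the parameter depends continuously on the
  density and the operators are strongly continuous in the parameter. Operator-norm continuity is
  not invoked, hence the formulation by sequences.\<close>

lemma orbit_seq_continuous:
  assumes u: "u \<in> densities" and w: "\<And>m. w m \<in> densities" and lim: "(\<lambda>m. L1_dist u (w m)) \<longlonglongrightarrow> 0"
  shows "(\<lambda>m. L1_dist (orbit u n) (orbit (w m) n)) \<longlonglongrightarrow> 0"
proof (induction n)
  case 0
  then show ?case using lim by simp
next
  case (Suc n)
  let ?u = "orbit u n" and ?w = "\<lambda>m. orbit (w m) n"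
  let ?s = "\<lambda>m. G (phi (?w m))"
  have ud: "?u \<in> densities" and wd: "?w m \<in> densities" for m by (simp_all add: orbit_density u w)
  note ui = densitiesD(1)[OF ud] and wi = densitiesD(1)[OF wd]
  have "(\<lambda>m. \<bar>phi (?w m) - phi ?u\<bar>) \<longlonglongrightarrow> 0"
  proof (rule null_sandwich)
    show "\<bar>phi (?w m) - phi ?u\<bar> \<le> L1_dist ?u (?w m) / 2" for m
      using phi_diff_le[OF wi ui, of m] by (simp add: L1_dist_commute)
    show "(\<lambda>m. L1_dist ?u (?w m) / 2) \<longlonglongrightarrow> 0"
      using tendsto_divide[OF Suc tendsto_const, of 2] by simp
  qed simp
  then have "(\<lambda>m. phi (?w m)) \<longlonglongrightarrow> phi ?u" by (simp add: tendsto_rabs_zero_iff LIM_zero_iff)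
  then have "?s \<longlonglongrightarrow> G (phi ?u)"
    using G_cont phi_density_in_X[OF ud] phi_density_in_X[OF wd]
    by (auto simp: continuous_on_sequentially o_def)
  then have c: "(\<lambda>m. L1_dist (transfer_op (?s m) ?u) (transfer_op (G (phi ?u)) ?u)) \<longlonglongrightarrow> 0"
    by (intro transfer_op_continuous_par phi_Pars ud wd ui)
  show ?case
  proof (rule null_sandwich)
    fix m
    note si = transfer_op_integral(1)[OF phi_Pars[OF wd]]
    have "L1_dist (orbit u (Suc n)) (orbit (w m) (Suc n))
        = L1_dist (transfer_op (G (phi ?u)) ?u) (transfer_op (?s m) (?w m))"
      unfolding orbit_Suc
      by (intro L1_dist_cong_AE PF_sc_ae(2) densitiesD(1) PF_sc_ae(1) transfer_op_density phi_Pars ud wd)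
    also have "\<dots> \<le> L1_dist (transfer_op (G (phi ?u)) ?u) (transfer_op (?s m) ?u)
        + L1_dist (transfer_op (?s m) ?u) (transfer_op (?s m) (?w m))"
      by (intro L1_dist_triangle transfer_op_integral phi_Pars ud wd ui wi)
    also have "\<dots> \<le> L1_dist (transfer_op (?s m) ?u) (transfer_op (G (phi ?u)) ?u) + L1_dist ?u (?w m)"
      using transfer_op_L1_dist[OF phi_Pars[OF wd] ui wi, of m m]
      by (simp add: L1_dist_commute[of "transfer_op (G (phi ?u)) ?u"])
    finally show "L1_dist (orbit u (Suc n)) (orbit (w m) (Suc n)) \<le>
      L1_dist (transfer_op (?s m) ?u) (transfer_op (G (phi ?u)) ?u) + L1_dist ?u (?w m)" .
    show "(\<lambda>m. L1_dist (transfer_op (?s m) ?u) (transfer_op (G (phi ?u)) ?u) + L1_dist ?u (?w m)) \<longlonglongrightarrow> 0"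
      using tendsto_add[OF c Suc] by simp
  qed simp
qed

lemma basin_shift:
  assumes "w \<in> densities" "orbit w n \<in> basin G v"
  shows "w \<in> basin G v"
proof -
  have "(\<lambda>k. L1_dist (orbit w (k + n)) v) \<longlonglongrightarrow> 0"
    using assms(2) by (simp add: basin_def orbit_add flip: orbit_def)
  then have "(\<lambda>k. L1_dist (orbit w k) v) \<longlonglongrightarrow> 0" by (rule LIMSEQ_offset)
  then show ?thesis using assms(1) by (simp add: basin_def orbit_def)
qed

text \<open>The sign \<open>c\<close> selects the side of zero, so that one argument serves both
  nontrivial fixed points.\<close>

lemma signed_trap:
  assumes c: "c = 1 \<or> c = (-1 :: real)" and s: "\<And>i. s i \<in> Pars" and a: "a \<in> Y" "0 \<le> a"
    and trap: "\<And>i. i < n \<Longrightarrow> a / (1 - a) \<le> c * s i"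
  shows "kern_mean a \<le> c * dual_iter s n kern_mean (c * a)"
  using c
proof
  assume "c = 1"
  then show ?thesis using dual_iter_ge_trap[of s a a kern_mean n] s a trap kern_mean_mono by simp
next
  assume c: "c = -1"
  have "kern_mean a \<le> dual_iter (\<lambda>i. - s i) n kern_mean a"
    using dual_iter_ge_trap[of "\<lambda>i. - s i" a a kern_mean n] s a trap kern_mean_mono c by simp
  also have "\<dots> = - dual_iter s n kern_mean (- a)"
    using dual_iter_odd[of s "- a" kern_mean n] s a by (simp add: kern_mean_odd)
  finally show ?thesis using c by simp
qed

end

section \<open>Basins in the bistable regime\<close>

context bistable_coupling
begin

text \<open>The orbit of \<open>z\<close> is compared with a density whose representing measure lies
  beyond \<open>a\<close> on the side chosen by \<open>c\<close>, moved by the parameters of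
  \<open>z\<close> itself. While these parameters keep the measure trapped, its mean is at least
  \<open>kern_mean a\<close> in the signed sense; the distance to the orbit of \<open>z\<close> does
  not grow, so the next parameter of \<open>z\<close> traps as well.\<close>

lemma trap_basin:
  assumes c: "c = 1 \<or> c = (-1 :: real)" and a: "0 < a" "a < a0" "a / (1 - a) \<le> rs"
    and e: "0 < \<epsilon>" "\<And>z. z \<in> X \<Longrightarrow> kern_mean a - \<epsilon> \<le> z \<Longrightarrow> a / (1 - a) \<le> G z"
    and z: "z \<in> densities" and near: "L1_dist z (pf_iter (\<lambda>_. c * rs) M (kern (c * a))) \<le> 2 * \<epsilon>"
  shows "z \<in> basin G (inv_dens (c * rs))"
proof -
  note af = trap_point_facts[OF a(1,2)]
  have cP: "c * rs \<in> Pars" and caY: "c * a \<in> Y" using c rs af by auto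
  have c2: "c * (c * t) = t" for t using c by auto
  let ?r = "param z"
  let ?v = "pf_iter (\<lambda>_. c * rs) M (kern (c * a))"
  \<comment> \<open>Prefixing \<open>M\<close> constant steps presents the comparison density as an
    image of one kernel, so that \<open>signed_trap\<close> applies to the concatenated
    sequence.\<close>
  define s where "s i = (if i < M then c * rs else ?r (i - M))" for i
  have sP: "s i \<in> Pars" for i using cP param_Pars[OF z] by (simp add: s_def)
  have vd: "?v \<in> densities" by (intro pf_iter_density cP kern_density caY)
  have "a / (1 - a) \<le> c * ?r k" for k
  proof (induction k rule: less_induct)
    case (less k)
    have "kern_mean a \<le> c * dual_iter s (M + k) kern_mean (c * a)"
    proof (rule signed_trap[OF c sP af(1)])
      fix i assume "i < M + k"
      then show "a / (1 - a) \<le> c * s i"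
        using less[of "i - M"] a(3) c by (cases "i < M") (auto simp: s_def)
    qed (use a in simp)
    also have "dual_iter s (M + k) kern_mean (c * a) = phi (pf_iter s (M + k) (kern (c * a)))"
      by (rule phi_pf_iter_kern[symmetric, OF sP caY])
    also have "pf_iter s (M + k) (kern (c * a)) = pf_iter ?r k ?v"
      unfolding pf_iter_add
      by (subst pf_iter_cong_par[of M s "\<lambda>_. c * rs"]) (auto simp: s_def intro!: pf_iter_cong_par)
    finally have ge: "kern_mean a \<le> c * phi (pf_iter ?r k ?v)" .
    \<comment> \<open>Means differ by at most half the L1 distance, which is why
      \<open>2 * \<epsilon>\<close> is admissible in \<open>near\<close>.\<close>
    have "\<bar>phi (orbit z k) - phi (pf_iter ?r k ?v)\<bar> \<le> L1_dist (pf_iter ?r k z) (pf_iter ?r k ?v) / 2"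
      unfolding orbit_phi[OF z] by (intro phi_diff_le densitiesD(1) pf_iter_density param_Pars z vd)
    also have "\<dots> \<le> L1_dist z ?v / 2"
      by (intro divide_right_mono pf_iter_L1_dist param_Pars z densitiesD(1) vd) simp
    also have "\<dots> \<le> \<epsilon>" using near by simp
    finally have "kern_mean a - \<epsilon> \<le> c * phi (orbit z k)" using ge c by auto
    moreover have pX: "phi (orbit z k) \<in> X" by (intro phi_density_in_X orbit_density z)
    moreover have "c * phi (orbit z k) \<in> X" "G (c * phi (orbit z k)) = c * ?r k"
      using pX c X_uminus G_odd[OF pX] by (auto simp: param_def)
    ultimately show ?case using e(2)[of "c * phi (orbit z k)"] by simp
  qed
  then have ev: "\<forall>\<^sub>F k in sequentially. a / (1 - a) \<le> c * ?r k" by simp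
  have "driven (\<lambda>n. c * ?r n) (\<lambda>n. c * phi (orbit z n))"
    using c orbit_driven[OF z] driven_reflect[OF orbit_driven[OF z]] by auto
  from driven_positive[OF this af(2) ev] have "(\<lambda>n. c * (c * ?r n)) \<longlonglongrightarrow> c * rs"
    by (intro tendsto_mult tendsto_const)
  then have "?r \<longlonglongrightarrow> c * rs" by (simp add: c2)
  then show ?thesis by (intro basinI z cP)
qed

lemma small_trap:
  "\<exists>a1>0. \<forall>a. 0 < a \<longrightarrow> a < a1 \<longrightarrow> a < a0 \<and> a / (1 - a) \<le> rs"
proof (intro exI[of _ "min a0 (rs / 2)"] conjI[of "0 < min a0 (rs / 2)"] allI impI)
  fix a assume a: "0 < a" "a < min a0 (rs / 2)"
  then have "a \<le> rs * (1 / 2)" by simp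
  also have "\<dots> \<le> rs * (1 - a)" using a a0 rs by (intro mult_left_mono) auto
  finally show "a < a0 \<and> a / (1 - a) \<le> rs" using a a0 by (simp add: divide_le_eq)
qed (use a0 rs in simp)

lemma kern_in_basin:
  assumes c: "c = 1 \<or> c = (-1 :: real)" and a: "0 < a" "a < a0" "a / (1 - a) \<le> rs"
  shows "kern (c * a) \<in> basin G (inv_dens (c * rs))"
proof -
  obtain \<epsilon> where e: "0 < \<epsilon>" "\<forall>z\<in>X. kern_mean a - \<epsilon> \<le> z \<longrightarrow> a / (1 - a) \<le> G z"
    using trap_margin[OF a(1,2)] by blast
  have "L1_dist (kern (c * a)) (pf_iter (\<lambda>_. c * rs) 0 (kern (c * a))) \<le> 2 * \<epsilon>"
    using e(1) by (simp add: L1_dist_def L1_norm_def)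
  then show ?thesis
    using trap_point_facts[OF a(1,2)] c e by (intro trap_basin[where a = a and \<epsilon> = \<epsilon> and M = 0] c a kern_density) auto
qed

text \<open>A ball around the fixed density lies in the basin by trapping; a density attracted by it
  enters the ball after finitely many steps, and by continuity of the orbit so do its
  neighbours.\<close>

lemma basin_open:
  assumes c: "c = 1 \<or> c = (-1 :: real)"
  shows "L1_open_in_densities (basin G (inv_dens (c * rs)))"
proof -
  let ?U = "inv_dens (c * rs)"
  obtain a1 where a1: "0 < a1" "\<And>a. 0 < a \<Longrightarrow> a < a1 \<Longrightarrow> a < a0 \<and> a / (1 - a) \<le> rs"
    using small_trap by blast
  define a where "a = a1 / 2"
  have a: "0 < a" "a < a0" "a / (1 - a) \<le> rs" using a1(1) a1(2)[of a] by (auto simp: a_def)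
  have cP: "c * rs \<in> Pars" and caY: "c * a \<in> Y" using c rs trap_point_facts[OF a(1,2)] by auto
  obtain \<epsilon> where e: "0 < \<epsilon>" "\<forall>z\<in>X. kern_mean a - \<epsilon> \<le> z \<longrightarrow> a / (1 - a) \<le> G z"
    using trap_margin[OF a(1,2)] by blast
  \<comment> \<open>Iterating a trapped kernel under the constant parameter gives densities that
    approach the fixed density while their representing measures remain trapped.\<close>
  have "\<forall>\<^sub>F M in sequentially. L1_dist (pf_iter (\<lambda>_. c * rs) M (kern (c * a))) ?U < \<epsilon>"
    using e(1) by (intro order_tendstoD(2)[OF pf_iter_const_tendsto] cP kern_density caY)
  then obtain M where M: "L1_dist (pf_iter (\<lambda>_. c * rs) M (kern (c * a))) ?U < \<epsilon>"
    by (auto simp: eventually_sequentially)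
  have ball: "z \<in> basin G ?U" if z: "z \<in> densities" "L1_dist z ?U < \<epsilon>" for z
  proof (rule trap_basin[OF c a e(1) _ z(1)])
    let ?v = "pf_iter (\<lambda>_. c * rs) M (kern (c * a))"
    have "L1_dist z ?v \<le> L1_dist z ?U + L1_dist ?U ?v"
      by (intro L1_dist_triangle densitiesD(1) z inv_dens_Pars cP pf_iter_density kern_density caY)
    then show "L1_dist z ?v \<le> 2 * \<epsilon>" using z(2) M by (simp add: L1_dist_commute)
  qed (use e in auto)
  show ?thesis
    unfolding L1_open_in_densities_def
  proof (intro conjI ballI)
    show "basin G ?U \<subseteq> densities" by (auto simp: basin_def)
    fix u assume u: "u \<in> basin G ?U"
    then have ud: "u \<in> densities" and ul: "(\<lambda>n. L1_dist (orbit u n) ?U) \<longlonglongrightarrow> 0"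
      by (auto simp: basin_def orbit_def)
    have "\<forall>\<^sub>F n in sequentially. L1_dist (orbit u n) ?U < \<epsilon> / 2"
      using e(1) by (intro order_tendstoD(2)[OF ul]) simp
    then obtain n where n: "L1_dist (orbit u n) ?U < \<epsilon> / 2" by (auto simp: eventually_sequentially)
    show "\<exists>\<epsilon>>0. \<forall>w\<in>densities. L1_dist u w < \<epsilon> \<longrightarrow> w \<in> basin G ?U"
    proof (rule ccontr)
      assume "\<not> ?thesis"
      then have "\<exists>w. w \<in> densities \<and> L1_dist u w < inverse (real (Suc m)) \<and> w \<notin> basin G ?U" for m
        by (metis inverse_positive_iff_positive of_nat_0_less_iff zero_less_Suc)
      then obtain w where w: "\<And>m. w m \<in> densities" "\<And>m. L1_dist u (w m) < inverse (real (Suc m))"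
        "\<And>m. w m \<notin> basin G ?U" by metis
      have "(\<lambda>m. L1_dist u (w m)) \<longlonglongrightarrow> 0"
        by (rule null_sandwich[OF less_imp_le[OF w(2)] LIMSEQ_inverse_real_of_nat]) simp
      from orbit_seq_continuous[of u w n, OF ud w(1) this]
      have "\<forall>\<^sub>F m in sequentially. L1_dist (orbit u n) (orbit (w m) n) < \<epsilon> / 2"
        using e(1) by (intro order_tendstoD(2)) auto
      then obtain m where m: "L1_dist (orbit u n) (orbit (w m) n) < \<epsilon> / 2" by (auto simp: eventually_sequentially)
      have "L1_dist (orbit (w m) n) ?U \<le> L1_dist (orbit (w m) n) (orbit u n) + L1_dist (orbit u n) ?U"
        by (intro L1_dist_triangle densitiesD(1) orbit_density w ud inv_dens_Pars cP)
      then have "L1_dist (orbit (w m) n) ?U < \<epsilon>"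
        using n m by (simp add: L1_dist_commute)
      then have "orbit (w m) n \<in> basin G ?U" by (intro ball orbit_density w(1))
      then show False using basin_shift[OF w(1)] w(3) by blast
    qed
  qed
qed

lemma basin_cases:
  assumes u: "u \<in> densities"
  shows "u \<in> basin G (inv_dens 0) \<or> u \<in> basin G (inv_dens rs) \<or> u \<in> basin G (inv_dens (- rs))"
  using driven_trichotomy[OF orbit_driven[OF u]] basinI[OF u] rs(2) by (auto simp del: inv_dens_0)

lemma approx_by_kern:
  assumes c: "c = 1 \<or> c = (-1 :: real)" and e: "0 < \<epsilon>"
  shows "\<exists>u\<in>basin G (inv_dens (c * rs)). convex_on X u \<and> real_analytic_on u X \<and> L1_dist u (inv_dens 0) < \<epsilon>"
proof -
  obtain a1 where a1: "0 < a1" "\<And>a. 0 < a \<Longrightarrow> a < a1 \<Longrightarrow> a < a0 \<and> a / (1 - a) \<le> rs"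
    using small_trap by blast
  define a where "a = min (a1 / 2) (\<epsilon> / 10)"
  have a: "0 < a" "a < a0" "a / (1 - a) \<le> rs" "5 * a < \<epsilon>" using a1(1) a1(2)[of a] e by (auto simp: a_def)
  have caY: "c * a \<in> Y" using c trap_point_facts[OF a(1,2)] by auto
  have "L1_dist (kern (c * a)) (kern 0) \<le> 5 * \<bar>c * a - 0\<bar>" by (rule kern_L1_dist[OF caY zero_in_Y])
  also have "\<dots> < \<epsilon>" using c a by auto
  finally show ?thesis
    using kern_in_basin[OF c a(1-3)] convex_on_kern[OF caY] real_analytic_on_kern[OF caY]
    by (intro bexI[of _ "kern (c * a)"]) simp_all
qed

text \<open>Were it open, it would meet the basin of \<open>inv_dens rs\<close> in a kernel near the
  uniform density. Uniqueness of limits would identify two densities at which \<open>H\<close> takes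
  the different values 0 and \<open>rs\<close>.\<close>

lemma basin_0_not_open:
  assumes H0: "H_fun G 0 = 0" and Hrs: "H_fun G rs = rs"
  shows "\<not> L1_open_in_densities (basin G (inv_dens 0))"
proof
  assume "L1_open_in_densities (basin G (inv_dens 0))"
  moreover have "inv_dens 0 \<in> basin G (inv_dens 0)"
    by (rule fixed_density_in_basin[OF fixed_density_inv_dens[OF zero_in_Pars H0]])
  ultimately obtain \<epsilon> where e: "0 < \<epsilon>" "\<And>w. w \<in> densities \<Longrightarrow> L1_dist (inv_dens 0) w < \<epsilon> \<Longrightarrow> w \<in> basin G (inv_dens 0)"
    unfolding L1_open_in_densities_def by blast
  obtain u where u: "u \<in> basin G (inv_dens (1 * rs))" "L1_dist u (inv_dens 0) < \<epsilon>"
    using approx_by_kern[of 1, OF _ e(1)] by blast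
  then have ud: "u \<in> densities" by (simp add: basin_def)
  then have "u \<in> basin G (inv_dens 0)" using e(2) u(2) by (simp add: L1_dist_commute del: inv_dens_0)
  then have "ae_eq (inv_dens 0) (inv_dens rs)"
    using u(1) unfolding basin_def orbit_def[symmetric]
    by (intro L1_dist_tendsto_unique[of "orbit u"]) (auto simp: densitiesD orbit_density ud inv_dens_Pars rs simp del: inv_dens_0)
  then have "phi (inv_dens 0) = phi (inv_dens rs)"
    by (intro phi_cong_AE densitiesD(1) inv_dens_Pars zero_in_Pars rs)
  then have "H_fun G 0 = H_fun G rs" by (simp add: H_fun_def del: inv_dens_0)
  then show False using H0 Hrs rs by simp
qed

end

section \<open>Transfer operators on functions of bounded variation\<close>

definition list_var :: "(real \<Rightarrow> real) \<Rightarrow> real list \<Rightarrow> real" where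
  "list_var w t = (\<Sum>i<length t - 1. \<bar>w (t ! Suc i) - w (t ! i)\<bar>)"

text \<open>Keeps variation estimates in the reals; \<open>pointwise_var_le_iff\<close> is the
  bridge to the extended nonnegative values.\<close>

definition var_le :: "(real \<Rightarrow> real) \<Rightarrow> real \<Rightarrow> bool" where
  "var_le w v \<longleftrightarrow> (\<forall>t. sorted t \<longrightarrow> set t \<subseteq> X \<longrightarrow> list_var w t \<le> v)"

lemma list_var_simps [simp]:
  "list_var w [] = 0" "list_var w [x] = 0"
  "list_var w (x # y # t) = \<bar>w y - w x\<bar> + list_var w (y # t)"
proof -
  show "list_var w (x # y # t) = \<bar>w y - w x\<bar> + list_var w (y # t)"
    unfolding list_var_def by (simp add: sum.lessThan_Suc_shift del: sum.lessThan_Suc)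
qed (simp_all add: list_var_def)

lemma list_var_nonneg [simp]: "0 \<le> list_var w t"
  unfolding list_var_def by (intro sum_nonneg) simp

lemma list_var_append: "list_var w s + list_var w t \<le> list_var w (s @ t)"
proof (induction s)
  case (Cons x s)
  show ?case
  proof (cases s)
    case Nil
    then show ?thesis by (cases t) simp_all
  next
    case (Cons y s')
    then show ?thesis using Cons.IH by simp
  qed
qed simp

lemma list_var_snoc: "t \<noteq> [] \<Longrightarrow> list_var w (t @ [b]) = list_var w t + \<bar>w b - w (last t)\<bar>"
proof (induction t)
  case (Cons x s)
  then show ?case by (cases s) simp_all
qed simp

lemma list_var_map: "list_var w (map f t) = list_var (\<lambda>x. w (f x)) t"
  unfolding list_var_def by (intro sum.cong) auto

lemma list_var_lin: "list_var (\<lambda>x. a * u x + b * v x) t \<le> \<bar>a\<bar> * list_var u t + \<bar>b\<bar> * list_var v t"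
proof -
  have "\<bar>(a * u y + b * v y) - (a * u x + b * v x)\<bar> \<le> \<bar>a\<bar> * \<bar>u y - u x\<bar> + \<bar>b\<bar> * \<bar>v y - v x\<bar>" for x y
  proof -
    have "(a * u y + b * v y) - (a * u x + b * v x) = a * (u y - u x) + b * (v y - v x)"
      by (simp add: algebra_simps)
    then show ?thesis using abs_triangle_ineq[of "a * (u y - u x)" "b * (v y - v x)"] by (simp add: abs_mult)
  qed
  then show ?thesis
    unfolding list_var_def sum_distrib_left sum.distrib[symmetric] by (intro sum_mono)
qed

lemma pointwise_var_le_iff:
  assumes "0 \<le> v"
  shows "pointwise_var w \<le> ennreal v \<longleftrightarrow> var_le w v"
proof -
  have "(\<Sum>i<length t - 1. ennreal \<bar>w (t ! Suc i) - w (t ! i)\<bar>) = ennreal (list_var w t)" for t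
    unfolding list_var_def by (rule sum_ennreal) simp
  then show ?thesis
    unfolding pointwise_var_def var_le_def SUP_le_iff using assms by (auto simp: ennreal_le_iff)
qed

lemma var_le_lin: "var_le u a' \<Longrightarrow> var_le v b' \<Longrightarrow> var_le (\<lambda>x. a * u x + b * v x) (\<bar>a\<bar> * a' + \<bar>b\<bar> * b')"
  unfolding var_le_def
  by (intro allI impI order_trans[OF list_var_lin] add_mono mult_left_mono) auto

lemma var_le_ident: "var_le (\<lambda>x. x) 1"
proof -
  have "sorted t \<Longrightarrow> t \<noteq> [] \<Longrightarrow> list_var (\<lambda>x. x) t = last t - hd t" for t
  proof (induction t)
    case (Cons x s)
    then show ?case by (cases s) auto
  qed simp
  moreover have "last t - hd t \<le> 1" if "t \<noteq> []" "set t \<subseteq> X" for t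
  proof -
    have "last t \<in> X" "hd t \<in> X" using that last_in_set[OF that(1)] hd_in_set[OF that(1)] by blast+
    then show ?thesis by (simp add: X_def)
  qed
  ultimately show ?thesis
    unfolding var_le_def by (metis list_var_simps(1) zero_le_one)
qed

lemma var_le_diff:
  assumes "var_le w v" "x \<in> X" "y \<in> X"
  shows "\<bar>w x - w y\<bar> \<le> v"
proof -
  have *: "\<bar>w y - w x\<bar> \<le> v" if "x \<in> X" "y \<in> X" "x \<le> y" for x y
  proof -
    have "list_var w [x, y] \<le> v"
      using assms(1) that unfolding var_le_def by (elim allE[of _ "[x, y]"]) simp
    then show ?thesis by simp
  qed
  show ?thesis using *[of x y] *[of y x] assms by (cases "x \<le> y") (auto simp: abs_minus_commute)
qed

text \<open>The witness is the variation of \<open>w\<close> on the part of \<open>X\<close> up to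
  \<open>x\<close>. It dominates the increments of \<open>w\<close> by increments of a monotone
  bounded function.\<close>

lemma variation_function:
  assumes "var_le w v"
  shows "\<exists>V. (\<forall>x. 0 \<le> V x \<and> V x \<le> v)
    \<and> (\<forall>a\<in>X. \<forall>b\<in>X. a \<le> b \<longrightarrow> \<bar>w b - w a\<bar> \<le> V b - V a)"
proof -
  define S where "S x = list_var w ` {t. sorted t \<and> set t \<subseteq> X \<inter> {..x}}" for x
  have le: "s \<le> v" if "s \<in> S x" for s x using assms that by (auto simp: S_def var_le_def)
  have S0: "0 \<in> S x" for x unfolding S_def by (rule image_eqI[of _ _ "[]"]) auto
  have bdd: "bdd_above (S x)" for x using le by (rule bdd_aboveI)
  define V where "V x = Sup (S x)" for x
  show ?thesis
  proof (intro exI[of _ V] conjI allI ballI impI)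
    show "0 \<le> V x" for x unfolding V_def by (rule cSup_upper[OF S0 bdd])
    show "V x \<le> v" for x
      unfolding V_def
    proof (rule cSup_least)
      show "S x \<noteq> {}" using S0 by auto
    qed (rule le)
    fix a b assume ab: "a \<in> X" "b \<in> X" "a \<le> b"
    have "V a \<le> V b - \<bar>w b - w a\<bar>"
      unfolding V_def[of a]
    proof (rule cSup_least)
      show "S a \<noteq> {}" using S0 by auto
      fix s assume "s \<in> S a"
      then obtain t where t: "sorted t" "set t \<subseteq> X \<inter> {..a}" "s = list_var w t" by (auto simp: S_def)
      \<comment> \<open>Inserting \<open>a\<close> before \<open>b\<close> makes the increment from
        \<open>a\<close> to \<open>b\<close> a separate last summand.\<close>
      have "list_var w ((t @ [a]) @ [b]) \<in> S b"
        unfolding S_def using t ab by (intro imageI) (auto simp: sorted_append)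
      then have "list_var w ((t @ [a]) @ [b]) \<le> V b" unfolding V_def using bdd by (rule cSup_upper)
      moreover have "list_var w t \<le> list_var w (t @ [a])" using list_var_append[of w t "[a]"] by simp
      ultimately have "s + \<bar>w b - w a\<bar> \<le> V b"
        unfolding t(3) by (subst (asm) list_var_snoc) auto
      then show "s \<le> V b - \<bar>w b - w a\<bar>" by simp
    qed
    then show "\<bar>w b - w a\<bar> \<le> V b - V a" by simp
  qed
qed

lemma measurable_lam_mono:
  fixes f :: "real \<Rightarrow> real"
  assumes "mono_on X f"
  shows "f \<in> borel_measurable lam"
  unfolding measurable_lam_cong by (rule borel_measurable_mono_on_fnc[OF assms])

text \<open>Jordan decomposition: \<open>w\<close> is a difference of two monotone functions, hence
  measurable, and its values differ from \<open>w 0\<close> by at most \<open>v\<close>.\<close>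

lemma integrable_var_le:
  assumes "var_le w v"
  shows "integrable lam w"
proof -
  obtain V where V: "\<And>a b. a \<in> X \<Longrightarrow> b \<in> X \<Longrightarrow> a \<le> b \<Longrightarrow> \<bar>w b - w a\<bar> \<le> V b - V a"
    using variation_function[OF assms] by blast
  have "mono_on X V" "mono_on X (\<lambda>x. V x - w x)"
    using V by (force intro: mono_onI)+
  then have "V \<in> borel_measurable lam" "(\<lambda>x. V x - w x) \<in> borel_measurable lam"
    by (simp_all add: measurable_lam_mono)
  then have "(\<lambda>x. V x - (V x - w x)) \<in> borel_measurable lam" by (rule borel_measurable_diff)
  then have m: "w \<in> borel_measurable lam" by simp
  have 0: "0 \<in> X" by (simp add: X_def)
  have "\<bar>w x\<bar> \<le> \<bar>w 0\<bar> + v" if "x \<in> X" for x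
    using var_le_diff[OF assms that 0] by linarith
  then show ?thesis using m by (intro integrable_lam_bounded)
qed

lemma mean_zero_var_bound:
  assumes v: "var_le w v" and z: "(LINT x|lam. w x) = 0" and x: "x \<in> X"
  shows "\<bar>w x\<bar> \<le> v"
proof -
  have i: "integrable lam w" by (rule integrable_var_le[OF v])
  have "w x = (LINT y|lam. w x - w y)" using i z by simp
  also have "\<bar>\<dots>\<bar> \<le> (LINT y|lam. \<bar>w x - w y\<bar>)" by (rule integral_abs_bound)
  also have "\<dots> \<le> (LINT y|lam. v)"
    using i var_le_diff[OF v x] by (intro integral_mono) auto
  finally show ?thesis by simp
qed

section \<open>Variation of L1 classes\<close>

definition variation :: "(real \<Rightarrow> real) \<Rightarrow> real" where
  "variation u = enn2real (ess_var u)"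

lemma variation_nonneg [simp]: "0 \<le> variation u"
  by (simp add: variation_def)

lemma BV_norm_eq: "BV_norm u = L1_norm u + variation u"
  by (simp add: BV_norm_def variation_def)

text \<open>The infimum over representatives is only approximated here; the slack \<open>e\<close>
  is carried along and removed at the end of each estimate.\<close>

lemma BV_rep:
  assumes "u \<in> BV" "0 < e"
  shows "\<exists>w. ae_eq w u \<and> var_le w (variation u + e)"
proof -
  have fin: "ess_var u < top" using assms by (simp add: BV_def)
  then have "ess_var u < ennreal (variation u + e)"
    unfolding variation_def using assms(2)
    by (cases "ess_var u") (auto simp: ennreal_less_iff)
  then obtain w where w: "ae_eq w u" "pointwise_var w < ennreal (variation u + e)"
    unfolding ess_var_def by (auto simp: INF_less_iff)
  then have "var_le w (variation u + e)"
    using assms(2) pointwise_var_le_iff[of "variation u + e" w] by (simp add: less_imp_le del: ennreal_plus)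
  with w(1) show ?thesis by blast
qed

lemma BV_variation_le:
  assumes "integrable lam u" "ae_eq w u" "var_le w v" "0 \<le> v"
  shows "u \<in> BV" "variation u \<le> v"
proof -
  have "ess_var u \<le> pointwise_var w" unfolding ess_var_def using assms(2) by (intro INF_lower) simp
  also have "\<dots> \<le> ennreal v" using assms(3,4) by (simp add: pointwise_var_le_iff)
  finally have le: "ess_var u \<le> ennreal v" .
  then show "u \<in> BV" using assms(1) by (auto simp: BV_def intro: le_less_trans)
  show "variation u \<le> v" unfolding variation_def using le assms(4) by (metis enn2real_leI)
qed

lemma BV_lin:
  assumes "u \<in> BV" "v \<in> BV"
  shows "(\<lambda>x. a * u x + b * v x) \<in> BV"
    "variation (\<lambda>x. a * u x + b * v x) \<le> \<bar>a\<bar> * variation u + \<bar>b\<bar> * variation v"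
proof -
  have i: "integrable lam (\<lambda>x. a * u x + b * v x)" using assms by (simp add: BV_def)
  have *: "(\<lambda>x. a * u x + b * v x) \<in> BV \<and>
      variation (\<lambda>x. a * u x + b * v x) \<le> \<bar>a\<bar> * (variation u + e) + \<bar>b\<bar> * (variation v + e)" if e: "0 < e" for e
  proof -
    obtain w where w: "ae_eq w u" "var_le w (variation u + e)" using BV_rep[OF assms(1) e] by blast
    obtain z where z: "ae_eq z v" "var_le z (variation v + e)" using BV_rep[OF assms(2) e] by blast
    have "ae_eq (\<lambda>x. a * w x + b * z x) (\<lambda>x. a * u x + b * v x)"
      using w(1) z(1) unfolding ae_eq_def by eventually_elim simp
    then show ?thesis
      using BV_variation_le[OF i _ var_le_lin[OF w(2) z(2), of a b]] e by simp
  qed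
  show "(\<lambda>x. a * u x + b * v x) \<in> BV" using *[of 1] by simp
  show "variation (\<lambda>x. a * u x + b * v x) \<le> \<bar>a\<bar> * variation u + \<bar>b\<bar> * variation v"
  proof (rule field_le_epsilon)
    fix e :: real assume e: "0 < e"
    define d where "d = e / (\<bar>a\<bar> + \<bar>b\<bar> + 1)"
    have d: "0 < d" using e by (simp add: d_def)
    have "\<bar>a\<bar> * d + \<bar>b\<bar> * d \<le> (\<bar>a\<bar> + \<bar>b\<bar> + 1) * d" using d by (simp add: algebra_simps)
    also have "\<dots> = e" by (simp add: d_def)
    finally show "variation (\<lambda>x. a * u x + b * v x) \<le> \<bar>a\<bar> * variation u + \<bar>b\<bar> * variation v + e"
      using *[OF d] by (simp add: algebra_simps)
  qed
qed

lemma BV_norm_lin: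
  assumes "u \<in> BV" "v \<in> BV"
  shows "BV_norm (\<lambda>x. a * u x + b * v x) \<le> \<bar>a\<bar> * BV_norm u + \<bar>b\<bar> * BV_norm v"
proof -
  have "L1_norm (\<lambda>x. a * u x + b * v x) \<le> \<bar>a\<bar> * L1_norm u + \<bar>b\<bar> * L1_norm v"
    using L1_norm_triangle[of "\<lambda>x. a * u x" "\<lambda>x. b * v x"] assms by (simp add: BV_def L1_norm_cmult)
  then show ?thesis using BV_lin(2)[OF assms, of a b] by (simp add: BV_norm_eq algebra_simps)
qed

lemma L1_le_BV_norm: "L1_norm u \<le> BV_norm u"
  by (simp add: BV_norm_eq)

lemma BV0_lin:
  assumes "u \<in> BV0" "v \<in> BV0"
  shows "(\<lambda>x. a * u x + b * v x) \<in> BV0"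
  using assms BV_lin(1)[of u v a b] by (auto simp: BV0_def BV_def)

lemma BV0_integrable: "u \<in> BV0 \<Longrightarrow> integrable lam u"
  by (simp add: BV0_def BV_def)

lemma ident_BV: "(\<lambda>x. x) \<in> BV0" "BV_norm (\<lambda>x. x) \<le> 2"
proof -
  have i: "integrable lam (\<lambda>x. x)" by (intro integrable_lam_continuous continuous_intros)
  note b = BV_variation_le[OF i ae_eq_refl var_le_ident]
  show "(\<lambda>x. x) \<in> BV0" using b by (simp add: BV0_def integral_lam_ident)
  have "L1_norm (\<lambda>x. x) \<le> 1" using i by (intro L1_norm_le_bound) (auto simp: X_def)
  then show "BV_norm (\<lambda>x. x) \<le> 2" using b(2) by (simp add: BV_norm_eq)
qed

section \<open>The transfer operator of the doubling map \<open>T_map 0\<close>\<close>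

lemma inv_0: "inv_left 0 x = (2 * x - 1) / 4" "inv_right 0 x = (2 * x + 1) / 4"
  by (simp_all add: inv_left_def inv_right_def)

lemma transfer_op_0: "transfer_op 0 u x = 1/2 * u (inv_left 0 x) + 1/2 * u (inv_right 0 x)"
  by (simp add: transfer_op_def jac_left_def jac_right_def)

lemma transfer_op_0_ident: "transfer_op 0 (\<lambda>x. x) x = x / 2"
  by (simp add: transfer_op_0 inv_0 field_simps)

text \<open>The two inverse branches send a sorted list to sorted lists in adjacent halves of
  \<open>X\<close>. Concatenated they form one admissible list for \<open>w\<close>, so both halves
  together use its variation only once, and the weights 1/2 halve it.\<close>

lemma var_le_transfer_op_0:
  assumes "var_le w v"
  shows "var_le (transfer_op 0 w) (1/2 * v)"
  unfolding var_le_def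
proof (intro allI impI)
  fix t assume t: "sorted t" "set t \<subseteq> X"
  let ?l = "map (inv_left 0) t" and ?r = "map (inv_right 0) t"
  have "sorted ?l" "sorted ?r"
    using t(1) by (auto simp: sorted_map inv_0 elim!: sorted_wrt_mono_rel[rotated])
  moreover have "x \<le> y" if "x \<in> set ?l" "y \<in> set ?r" for x y
    using that t(2) inv_range[OF zero_in_Pars] by fastforce
  ultimately have "sorted (?l @ ?r)" by (auto simp: sorted_append)
  moreover have "set (?l @ ?r) \<subseteq> X" using t(2) inv_in_X[OF zero_in_Pars] by auto
  ultimately have le: "list_var w (?l @ ?r) \<le> v" using assms unfolding var_le_def by blast
  have "list_var (transfer_op 0 w) t \<le> 1/2 * list_var w ?l + 1/2 * list_var w ?r"
    using list_var_lin[of "1/2" "\<lambda>x. w (inv_left 0 x)" "1/2" "\<lambda>x. w (inv_right 0 x)" t]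
    by (simp add: transfer_op_0[abs_def] list_var_map)
  also have "\<dots> \<le> 1/2 * v" using list_var_append[of w ?l ?r] le by simp
  finally show "list_var (transfer_op 0 w) t \<le> 1/2 * v" .
qed

abbreviation P0_iter :: "nat \<Rightarrow> (real \<Rightarrow> real) \<Rightarrow> real \<Rightarrow> real" where
  "P0_iter n \<equiv> transfer_op 0 ^^ n"

lemma P0_iter_integral:
  assumes "integrable lam u"
  shows "integrable lam (P0_iter n u)" "(LINT x|lam. P0_iter n u x) = (LINT x|lam. u x)"
    "L1_norm (P0_iter n u) \<le> L1_norm u"
proof -
  have "integrable lam (P0_iter n u) \<and> (LINT x|lam. P0_iter n u x) = (LINT x|lam. u x) \<and> L1_norm (P0_iter n u) \<le> L1_norm u"
  proof (induction n)
    case (Suc n)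
    then show ?case
      using transfer_op_integral[OF zero_in_Pars, of "P0_iter n u"] transfer_op_L1[OF zero_in_Pars, of "P0_iter n u"] by auto
  qed (use assms in simp)
  then show "integrable lam (P0_iter n u)" "(LINT x|lam. P0_iter n u x) = (LINT x|lam. u x)"
    "L1_norm (P0_iter n u) \<le> L1_norm u" by auto
qed

lemma P0_iter_cong_AE:
  assumes "integrable lam u" "integrable lam v" "ae_eq u v"
  shows "ae_eq (P0_iter n u) (P0_iter n v)"
  using assms by (induction n) (auto intro: transfer_op_cong_AE P0_iter_integral)

lemma P0_iter_var_le: "var_le w v \<Longrightarrow> var_le (P0_iter n w) ((1/2)^n * v)"
proof (induction n)
  case (Suc n)
  then show ?case using var_le_transfer_op_0[of "P0_iter n w" "(1/2)^n * v"] by simp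
qed simp

lemma P0_iter_lin: "P0_iter n (\<lambda>x. a * u x + b * v x) = (\<lambda>x. a * P0_iter n u x + b * P0_iter n v x)"
  by (induction n) (simp_all add: transfer_op_lin[abs_def])

text \<open>The variation halves at each step, and the mean stays zero, so the L1 norm is bounded by
  the variation; this accounts for the factor 2.\<close>

lemma P0_iter_BV0:
  assumes g: "g \<in> BV0"
  shows "P0_iter n g \<in> BV0" "BV_norm (P0_iter n g) \<le> 2 * (1/2)^n * BV_norm g"
proof -
  have gB: "g \<in> BV" and gi: "integrable lam g" and g0: "(LINT x|lam. g x) = 0"
    using g by (auto simp: BV0_def BV_def)
  note Pi = P0_iter_integral[OF gi, of n]
  have *: "P0_iter n g \<in> BV \<and> BV_norm (P0_iter n g) \<le> 2 * (1/2)^n * (variation g + e)" if e: "0 < e" for e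
  proof -
    obtain w where w: "ae_eq w g" "var_le w (variation g + e)" using BV_rep[OF gB e] by blast
    have wi: "integrable lam w" by (rule integrable_var_le[OF w(2)])
    have ae: "ae_eq (P0_iter n w) (P0_iter n g)" by (rule P0_iter_cong_AE[OF wi gi w(1)])
    note v = P0_iter_var_le[OF w(2), of n]
    have p: "0 \<le> (1/2)^n * (variation g + e)" using e by simp
    note b = BV_variation_le[OF Pi(1) ae v p]
    have w0: "(LINT x|lam. w x) = 0"
      using integral_diff_le_L1[OF wi gi] L1_dist_eq_0_iff[OF wi gi] w(1) g0 by simp
    have "L1_norm (P0_iter n g) = L1_norm (P0_iter n w)"
      by (rule L1_norm_cong_AE[OF Pi(1) P0_iter_integral(1)[OF wi] ae_eq_sym[OF ae]])
    also have "\<dots> \<le> (1/2)^n * (variation g + e)"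
      using mean_zero_var_bound[OF v] P0_iter_integral[OF wi, of n] w0 by (intro L1_norm_le_bound) auto
    finally show ?thesis using b by (simp add: BV_norm_eq)
  qed
  show "P0_iter n g \<in> BV0" using *[of 1] Pi(2) g0 by (simp add: BV0_def)
  have "BV_norm (P0_iter n g) \<le> 2 * (1/2)^n * variation g"
  proof (rule field_le_epsilon)
    fix e :: real assume e: "0 < e"
    have "(1/2 :: real)^n \<le> 1" by (simp add: power_le_one)
    then have "2 * (1/2)^n * (e / 2) \<le> e" using e mult_right_mono[of "(1/2)^n" 1 e] by simp
    moreover have "BV_norm (P0_iter n g) \<le> 2 * (1/2)^n * (variation g + e / 2)" using *[of "e / 2"] e by simp
    ultimately show "BV_norm (P0_iter n g) \<le> 2 * (1/2)^n * variation g + e"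
      by (simp only: distrib_left)
  qed
  also have "\<dots> \<le> 2 * (1/2)^n * BV_norm g"
    by (intro mult_left_mono) (simp_all add: BV_norm_eq)
  finally show "BV_norm (P0_iter n g) \<le> 2 * (1/2)^n * BV_norm g" .
qed

section \<open>First-order dependence of the transfer operator on its parameter\<close>

lemma jac_close:
  assumes r: "r \<in> Pars" and x: "x \<in> X"
  shows "\<bar>jac_left r x - 1/2\<bar> \<le> 2 * \<bar>r\<bar>" "\<bar>jac_right r x - 1/2\<bar> \<le> 2 * \<bar>r\<bar>"
proof -
  have r1: "\<bar>r\<bar> \<le> 2/5" using r by (auto simp: Pars_def)
  have gen: "\<bar>(8 - 2 * r\<^sup>2) / (4 + p)\<^sup>2 - 1/2\<bar> \<le> 2 * \<bar>r\<bar>" if p: "\<bar>p\<bar> \<le> 2 * \<bar>r\<bar>" "3 \<le> 4 + p" for p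
  proof -
    have "(3::real)\<^sup>2 \<le> (4 + p)\<^sup>2" using p(2) by (intro power_mono) auto
    then have D: "9 \<le> (4 + p)\<^sup>2" by simp
    have "c / d - 1/2 = (2 * c - d) / (2 * d)" if "9 \<le> d" for c d :: real
      using that by (simp add: field_simps)
    from this[OF D] have "(8 - 2 * r\<^sup>2) / (4 + p)\<^sup>2 - 1/2 = (2 * (8 - 2 * r\<^sup>2) - (4 + p)\<^sup>2) / (2 * (4 + p)\<^sup>2)" .
    also have "2 * (8 - 2 * r\<^sup>2) - (4 + p)\<^sup>2 = - 8 * p - p\<^sup>2 - 4 * r\<^sup>2"
      by (simp add: algebra_simps power2_eq_square)
    finally have eq: "(8 - 2 * r\<^sup>2) / (4 + p)\<^sup>2 - 1/2 = (- 8 * p - p\<^sup>2 - 4 * r\<^sup>2) / (2 * (4 + p)\<^sup>2)" .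
    have "\<bar>(8 - 2 * r\<^sup>2) / (4 + p)\<^sup>2 - 1/2\<bar> \<le> (16 * \<bar>r\<bar> + 4 * r\<^sup>2 + 4 * r\<^sup>2) / (2 * 9)"
      unfolding eq abs_divide
    proof (rule frac_le)
      have "p\<^sup>2 \<le> (2 * \<bar>r\<bar>)\<^sup>2" using power_mono[OF p(1), of 2] by simp
      then have "p\<^sup>2 \<le> 4 * r\<^sup>2" by (simp add: power_mult_distrib)
      then show "\<bar>- 8 * p - p\<^sup>2 - 4 * r\<^sup>2\<bar> \<le> 16 * \<bar>r\<bar> + 4 * r\<^sup>2 + 4 * r\<^sup>2"
        using p(1) zero_le_power2[of p] zero_le_power2[of r] by linarith
    qed (use D in auto)
    also have "\<dots> \<le> 2 * \<bar>r\<bar>"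
    proof -
      have "r\<^sup>2 \<le> 2/5 * \<bar>r\<bar>" using mult_right_mono[OF r1, of "\<bar>r\<bar>"] by (simp add: power2_eq_square)
      then show ?thesis by simp
    qed
    finally show ?thesis .
  qed
  note d = transfer_denoms[OF r x]
  have "\<bar>1 - 2 * x\<bar> \<le> 2" "\<bar>1 + 2 * x\<bar> \<le> 2" using x by (auto simp: X_def)
  then have "\<bar>r * (1 - 2 * x)\<bar> \<le> 2 * \<bar>r\<bar>" "\<bar>- (r * (1 + 2 * x))\<bar> \<le> 2 * \<bar>r\<bar>"
    using mult_left_mono[of "\<bar>1 - 2 * x\<bar>" 2 "\<bar>r\<bar>"] mult_left_mono[of "\<bar>1 + 2 * x\<bar>" 2 "\<bar>r\<bar>"] by (simp_all add: abs_mult mult.commute)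
  moreover have e: "r + 4 - 2 * r * x = 4 + r * (1 - 2 * x)" "4 - r - 2 * r * x = 4 + - (r * (1 + 2 * x))"
    by (simp_all add: algebra_simps)
  ultimately show "\<bar>jac_left r x - 1/2\<bar> \<le> 2 * \<bar>r\<bar>" "\<bar>jac_right r x - 1/2\<bar> \<le> 2 * \<bar>r\<bar>"
    unfolding jac_left_def jac_right_def using gen d unfolding e by blast+
qed

lemma inv_par_order:
  assumes r: "r \<in> Pars" and x: "x \<in> X"
  shows "0 \<le> r \<Longrightarrow> inv_left r x \<le> inv_left 0 x" "0 \<le> r \<Longrightarrow> inv_right r x \<le> inv_right 0 x"
    "r \<le> 0 \<Longrightarrow> inv_left 0 x \<le> inv_left r x" "r \<le> 0 \<Longrightarrow> inv_right 0 x \<le> inv_right r x"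
proof -
  note d = transfer_denoms[OF r x]
  have l: "inv_left r x - inv_left 0 x = - (r * ((3 - 2 * x) * (2 * x + 1))) / (4 * (r + 4 - 2 * r * x))"
    using d by (simp add: inv_left_def field_simps)
  have rr: "inv_right r x - inv_right 0 x = - (r * ((3 + 2 * x) * (1 - 2 * x))) / (4 * (4 - r - 2 * r * x))"
    using d by (simp add: inv_right_def field_simps)
  have p: "0 \<le> (3 - 2 * x) * (2 * x + 1)" "0 \<le> (3 + 2 * x) * (1 - 2 * x)"
    using x by (auto simp: X_def intro!: mult_nonneg_nonneg)
  have neg: "- (r * k) / (4 * D) \<le> 0" if "0 \<le> r" "0 \<le> k" "3 \<le> D" for k D :: real
    using that by (intro divide_nonpos_pos) auto
  have pos: "0 \<le> - (r * k) / (4 * D)" if "r \<le> 0" "0 \<le> k" "3 \<le> D" for k D :: real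
    using that by (intro divide_nonneg_pos) (auto simp: mult_nonpos_nonneg)
  show "0 \<le> r \<Longrightarrow> inv_left r x \<le> inv_left 0 x" using neg[OF _ p(1) d(1)] l by linarith
  show "0 \<le> r \<Longrightarrow> inv_right r x \<le> inv_right 0 x" using neg[OF _ p(2) d(2)] rr by linarith
  show "r \<le> 0 \<Longrightarrow> inv_left 0 x \<le> inv_left r x" using pos[OF _ p(1) d(1)] l by linarith
  show "r \<le> 0 \<Longrightarrow> inv_right 0 x \<le> inv_right r x" using pos[OF _ p(2) d(2)] rr by linarith
qed

text \<open>Both inverse branches move in the same direction as \<open>r\<close> varies, so that the increments of a
  variation function \<open>V\<close> along them have constant sign and integrate to the difference of
  the integrals of \<open>transfer_op 0 V\<close> and \<open>transfer_op r V\<close>, up to the change of the Jacobians.\<close>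

lemma transfer_op_par_var:
  assumes r: "r \<in> Pars" and v: "var_le w v" and z: "(LINT x|lam. w x) = 0"
  shows "L1_dist (transfer_op r w) (transfer_op 0 w) \<le> 8 * \<bar>r\<bar> * v"
proof -
  obtain V where V: "\<And>x. 0 \<le> V x" "\<And>x. V x \<le> v"
    "\<And>a b. a \<in> X \<Longrightarrow> b \<in> X \<Longrightarrow> a \<le> b \<Longrightarrow> \<bar>w b - w a\<bar> \<le> V b - V a"
    using variation_function[OF v] by blast
  have "mono_on X V" using V(3) by (force intro: mono_onI)
  then have Vi: "integrable lam V"
    using V(1,2) by (intro integrable_lam_bounded[of _ v] measurable_lam_mono) auto
  have wi: "integrable lam w" by (rule integrable_var_le[OF v])
  define s where "s = (if 0 \<le> r then 1 else -1 :: real)"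
  \<comment> \<open>The sign \<open>s\<close> makes the increments of \<open>V\<close> nonnegative.
    The 8 counts four Jacobian corrections of size \<open>2 * |r| * v\<close>: two from
    \<open>w\<close> and two from rewriting the increments as transfers of \<open>V\<close>. The
    second summand integrates to zero.\<close>
  let ?B = "\<lambda>x. 8 * \<bar>r\<bar> * v + s * (transfer_op 0 V x - transfer_op r V x)"
  have pw: "\<bar>transfer_op r w x - transfer_op 0 w x\<bar> \<le> ?B x" if x: "x \<in> X" for x
  proof -
    let ?l = "inv_left r x" and ?m = "inv_left 0 x" and ?p = "inv_right r x" and ?q = "inv_right 0 x"
    let ?j = "jac_left r x - 1/2" and ?k = "jac_right r x - 1/2"
    note iX = inv_in_X[OF r x] inv_in_X[OF zero_in_Pars x]
    have inc: "\<bar>w ?l - w ?m\<bar> \<le> s * (V ?m - V ?l)" "\<bar>w ?p - w ?q\<bar> \<le> s * (V ?q - V ?p)"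
      using inv_par_order[OF r x] V(3)[of ?l ?m] V(3)[of ?m ?l] V(3)[of ?p ?q] V(3)[of ?q ?p] iX
      by (auto simp: s_def abs_minus_commute)
    have jb: "\<bar>?j * t\<bar> \<le> 2 * \<bar>r\<bar> * v" "\<bar>?k * t\<bar> \<le> 2 * \<bar>r\<bar> * v" if "\<bar>t\<bar> \<le> v" for t
      unfolding abs_mult using jac_close[OF r x] that by (intro mult_mono; simp)+
    have wb: "\<bar>w ?l\<bar> \<le> v" "\<bar>w ?p\<bar> \<le> v" using mean_zero_var_bound[OF v z] iX by auto
    have Vb: "\<bar>V ?l\<bar> \<le> v" "\<bar>V ?p\<bar> \<le> v" using V(1,2) by (simp_all add: abs_le_iff order_trans[of _ 0])
    have sb: "s * t \<le> \<bar>t\<bar>" for t by (auto simp: s_def)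
    have tri: "\<bar>a + b + 1/2 * c + 1/2 * d\<bar> \<le> \<bar>a\<bar> + \<bar>b\<bar> + 1/2 * \<bar>c\<bar> + 1/2 * \<bar>d\<bar>" for a b c d :: real
      by linarith
    have d1: "transfer_op r w x - transfer_op 0 w x =
        ?j * w ?l + ?k * w ?p + 1/2 * (w ?l - w ?m) + 1/2 * (w ?p - w ?q)"
      unfolding transfer_op_0 by (simp add: transfer_op_def algebra_simps)
    have d2: "s * (transfer_op 0 V x - transfer_op r V x) =
        1/2 * (s * (V ?m - V ?l)) + 1/2 * (s * (V ?q - V ?p)) - s * (?j * V ?l) - s * (?k * V ?p)"
      unfolding transfer_op_0 by (simp add: transfer_op_def algebra_simps)
    have "\<bar>transfer_op r w x - transfer_op 0 w x\<bar> \<le>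
        \<bar>?j * w ?l\<bar> + \<bar>?k * w ?p\<bar> + 1/2 * \<bar>w ?l - w ?m\<bar> + 1/2 * \<bar>w ?p - w ?q\<bar>"
      unfolding d1 by (rule tri)
    also have "\<dots> \<le> 4 * \<bar>r\<bar> * v + 1/2 * (s * (V ?m - V ?l)) + 1/2 * (s * (V ?q - V ?p))"
      using jb(1)[OF wb(1)] jb(2)[OF wb(2)] inc by linarith
    also have "\<dots> \<le> ?B x"
      unfolding d2 using jb(1)[OF Vb(1)] jb(2)[OF Vb(2)] sb[of "?j * V ?l"] sb[of "?k * V ?p"] by linarith
    finally show ?thesis .
  qed
  note ti = transfer_op_integral[OF r Vi] transfer_op_integral[OF zero_in_Pars Vi]
    transfer_op_integral[OF r wi] transfer_op_integral[OF zero_in_Pars wi]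
  have "L1_dist (transfer_op r w) (transfer_op 0 w) \<le> (LINT x|lam. ?B x)"
    unfolding L1_dist_def L1_norm_def using ti pw by (intro integral_mono) auto
  also have "\<dots> = 8 * \<bar>r\<bar> * v" using ti by simp
  finally show ?thesis .
qed

text \<open>With \<open>|r|\<close> of the order of \<open>BV_norm g\<close> this bound is quadratic
  in \<open>g\<close>, as the remainder of a derivative demands; this is the point at which bounded
  variation of the direction is used.\<close>

lemma transfer_op_par_BV0:
  assumes r: "r \<in> Pars" and g: "g \<in> BV0"
  shows "L1_dist (transfer_op r g) (transfer_op 0 g) \<le> 8 * \<bar>r\<bar> * BV_norm g"
proof -
  have gB: "g \<in> BV" and gi: "integrable lam g" and g0: "(LINT x|lam. g x) = 0"
    using g by (auto simp: BV0_def BV_def)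
  have *: "L1_dist (transfer_op r g) (transfer_op 0 g) \<le> 8 * \<bar>r\<bar> * (variation g + e)" if e: "0 < e" for e
  proof -
    obtain w where w: "ae_eq w g" "var_le w (variation g + e)" using BV_rep[OF gB e] by blast
    have wi: "integrable lam w" by (rule integrable_var_le[OF w(2)])
    have w0: "(LINT x|lam. w x) = 0"
      using integral_diff_le_L1[OF wi gi] L1_dist_eq_0_iff[OF wi gi] w(1) g0 by simp
    have "L1_dist (transfer_op r g) (transfer_op 0 g) = L1_dist (transfer_op r w) (transfer_op 0 w)"
      by (intro L1_dist_cong_AE transfer_op_integral transfer_op_cong_AE r zero_in_Pars gi wi ae_eq_sym[OF w(1)])
    also have "\<dots> \<le> 8 * \<bar>r\<bar> * (variation g + e)" by (rule transfer_op_par_var[OF r w(2) w0])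
    finally show ?thesis .
  qed
  have "L1_dist (transfer_op r g) (transfer_op 0 g) \<le> 8 * \<bar>r\<bar> * variation g"
  proof (rule field_le_epsilon)
    fix e :: real assume e: "0 < e"
    have "\<bar>r\<bar> * e \<le> 1/2 * e" using r e by (intro mult_right_mono) (auto simp: Pars_def)
    then have "8 * \<bar>r\<bar> * (e / 4) \<le> e" by (simp add: mult.commute)
    moreover have "L1_dist (transfer_op r g) (transfer_op 0 g) \<le> 8 * \<bar>r\<bar> * (variation g + e / 4)" using *[of "e / 4"] e by simp
    ultimately show "L1_dist (transfer_op r g) (transfer_op 0 g) \<le> 8 * \<bar>r\<bar> * variation g + e"
      by (simp only: distrib_left)
  qed
  also have "\<dots> \<le> 8 * \<bar>r\<bar> * BV_norm g" by (intro mult_left_mono) (simp_all add: BV_norm_eq)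
  finally show ?thesis .
qed

text \<open>Each Jacobian has the form \<open>(8 - 2 * r^2) / (4 + p)^2\<close> with
  \<open>p\<close> linear in \<open>r\<close>, and equals \<open>1/2 - p/4\<close> up to second
  order. The linear parts add up to \<open>1 + r * x\<close>: hence the function \<open>x\<close> in
  the rank-one term of the derivative.\<close>

lemma transfer_op_one_expansion:
  assumes r: "r \<in> Pars" and x: "x \<in> X"
  shows "\<bar>transfer_op r (\<lambda>x. 1) x - 1 - r * x\<bar> \<le> 3 * r\<^sup>2"
proof -
  have r1: "\<bar>r\<bar> \<le> 2/5" using r by (auto simp: Pars_def)
  have gen: "\<bar>(8 - 2 * r\<^sup>2) / (4 + p)\<^sup>2 - (1/2 - p/4)\<bar> \<le> 3/2 * r\<^sup>2" if p: "\<bar>p\<bar> \<le> 2 * \<bar>r\<bar>" "3 \<le> 4 + p" for p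
  proof -
    have "(3::real)\<^sup>2 \<le> (4 + p)\<^sup>2" using p(2) by (intro power_mono) auto
    then have D: "9 \<le> (4 + p)\<^sup>2" by simp
    have "c / d - b = (4 * c - 4 * b * d) / (4 * d)" if "9 \<le> d" for b c d :: real
      using that by (simp add: field_simps)
    from this[OF D] have "(8 - 2 * r\<^sup>2) / (4 + p)\<^sup>2 - (1/2 - p/4) =
        (4 * (8 - 2 * r\<^sup>2) - 4 * (1/2 - p/4) * (4 + p)\<^sup>2) / (4 * (4 + p)\<^sup>2)" .
    also have "4 * (8 - 2 * r\<^sup>2) - 4 * (1/2 - p/4) * (4 + p)\<^sup>2 = p\<^sup>2 * (6 + p) - 8 * r\<^sup>2"
      by (simp add: algebra_simps power2_eq_square)
    finally have eq: "(8 - 2 * r\<^sup>2) / (4 + p)\<^sup>2 - (1/2 - p/4) = (p\<^sup>2 * (6 + p) - 8 * r\<^sup>2) / (4 * (4 + p)\<^sup>2)" .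
    have "\<bar>(8 - 2 * r\<^sup>2) / (4 + p)\<^sup>2 - (1/2 - p/4)\<bar> \<le> (36 * r\<^sup>2) / (4 * 9)"
      unfolding eq abs_divide
    proof (rule frac_le)
      have "p\<^sup>2 \<le> (2 * \<bar>r\<bar>)\<^sup>2" using power_mono[OF p(1), of 2] by simp
      then have "p\<^sup>2 \<le> 4 * r\<^sup>2" by (simp add: power_mult_distrib)
      then have "\<bar>p\<^sup>2 * (6 + p)\<bar> \<le> (4 * r\<^sup>2) * 7"
        unfolding abs_mult using p r1 by (intro mult_mono) auto
      then show "\<bar>p\<^sup>2 * (6 + p) - 8 * r\<^sup>2\<bar> \<le> 36 * r\<^sup>2"
        by (intro order_trans[OF abs_triangle_ineq4]) simp
    qed (use D in auto)
    also have "\<dots> \<le> 3/2 * r\<^sup>2" by simp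
    finally show ?thesis .
  qed
  note d = transfer_denoms[OF r x]
  have "\<bar>1 - 2 * x\<bar> \<le> 2" "\<bar>1 + 2 * x\<bar> \<le> 2" using x by (auto simp: X_def)
  then have b: "\<bar>r * (1 - 2 * x)\<bar> \<le> 2 * \<bar>r\<bar>" "\<bar>- (r * (1 + 2 * x))\<bar> \<le> 2 * \<bar>r\<bar>"
    using mult_left_mono[of "\<bar>1 - 2 * x\<bar>" 2 "\<bar>r\<bar>"] mult_left_mono[of "\<bar>1 + 2 * x\<bar>" 2 "\<bar>r\<bar>"] by (simp_all add: abs_mult mult.commute)
  have e: "r + 4 - 2 * r * x = 4 + r * (1 - 2 * x)" "4 - r - 2 * r * x = 4 + - (r * (1 + 2 * x))"
    by (simp_all add: algebra_simps)
  have "\<bar>jac_left r x - (1/2 - r * (1 - 2 * x) / 4)\<bar> \<le> 3/2 * r\<^sup>2"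
    "\<bar>jac_right r x - (1/2 - - (r * (1 + 2 * x)) / 4)\<bar> \<le> 3/2 * r\<^sup>2"
    unfolding jac_left_def jac_right_def e by (intro gen b d[unfolded e])+
  moreover have "transfer_op r (\<lambda>x. 1) x - 1 - r * x =
      (jac_left r x - (1/2 - r * (1 - 2 * x) / 4)) + (jac_right r x - (1/2 - - (r * (1 + 2 * x)) / 4))"
    by (simp add: transfer_op_def field_simps)
  ultimately show ?thesis by linarith
qed

section \<open>Hyperbolicity at the uniform density\<close>

definition linearization :: "real \<Rightarrow> (real \<Rightarrow> real) \<Rightarrow> real \<Rightarrow> real" where
  "linearization c g x = transfer_op 0 g x + c * phi g * x"

text \<open>The left eigenfunctional of \<open>linearization c\<close> with eigenvalue \<open>1/2 + c/12\<close>.\<close>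

definition unstable_coeff :: "real \<Rightarrow> (real \<Rightarrow> real) \<Rightarrow> real" where
  "unstable_coeff c g = c * (\<Sum>n. (1 / (1/2 + c/12)) ^ Suc n * phi (P0_iter n g))"

lemma linearization_lin:
  assumes "integrable lam g" "integrable lam h"
  shows "linearization c (\<lambda>x. a * g x + b * h x) x = a * linearization c g x + b * linearization c h x"
  unfolding linearization_def transfer_op_lin phi_lin[OF assms] by (simp add: algebra_simps)

lemma phi_ident: "phi (\<lambda>x. x) = 1/12"
  using integral_lam_ident_sq by (simp add: phi_def power2_eq_square)

lemma ident_integrable: "integrable lam (\<lambda>x. x)"
  by (intro integrable_lam_continuous continuous_intros)

lemma linearization_integrable:
  assumes "integrable lam g"
  shows "integrable lam (linearization c g)"
  unfolding linearization_def[abs_def] using transfer_op_integral(1)[OF zero_in_Pars assms] ident_integrable by simp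

lemma linearization_L1:
  assumes "integrable lam g" "0 \<le> c"
  shows "L1_norm (linearization c g) \<le> (1 + c) * L1_norm g"
proof -
  have i: "L1_norm (\<lambda>x. x) \<le> 1" using ident_integrable by (intro L1_norm_le_bound) (auto simp: X_def)
  have "L1_norm (linearization c g) \<le> L1_norm (transfer_op 0 g) + L1_norm (\<lambda>x. (c * phi g) * x)"
    unfolding linearization_def[abs_def]
    using transfer_op_integral(1)[OF zero_in_Pars assms(1)] ident_integrable by (intro L1_norm_triangle) auto
  also have "\<dots> \<le> L1_norm g + \<bar>c * phi g\<bar> * 1"
    unfolding L1_norm_cmult using transfer_op_L1[OF zero_in_Pars assms(1)] i
    by (intro add_mono mult_left_mono) auto
  also have "\<bar>c * phi g\<bar> * 1 \<le> c * L1_norm g"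
    using phi_abs_le[OF assms(1)] assms(2) L1_norm_nonneg[of g]
    by (simp add: abs_mult) (intro mult_left_mono; linarith)
  finally show ?thesis by (simp add: algebra_simps)
qed

lemma linearization_BV0:
  assumes g: "g \<in> BV0"
  shows "linearization c g \<in> BV0"
proof -
  have "(\<lambda>x. 1 * P0_iter 1 g x + (c * phi g) * x) \<in> BV0"
    by (rule BV0_lin[OF P0_iter_BV0(1)[OF g] ident_BV(1)])
  then show ?thesis by (simp add: linearization_def[abs_def])
qed

lemma linearization_ident: "linearization c (\<lambda>x. x) x = (1/2 + c/12) * x"
  by (simp add: linearization_def transfer_op_0_ident phi_ident algebra_simps)

context
  fixes c \<mu> :: real
  assumes c: "6 < c" and mu: "\<mu> = 1/2 + c/12"
begin

lemma mu_gt_1: "1 < \<mu>" using c mu by simp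

lemma coeff_term_bound:
  assumes "integrable lam g"
  shows "norm ((1 / \<mu>) ^ Suc n * phi (P0_iter n g)) \<le> (1 / \<mu>) ^ n * L1_norm g"
proof -
  have "\<bar>phi (P0_iter n g)\<bar> \<le> L1_norm g"
    using phi_abs_le[OF P0_iter_integral(1)[OF assms], of n] P0_iter_integral(3)[OF assms, of n] L1_norm_nonneg[of "P0_iter n g"]
    by linarith
  moreover have "(1 / \<mu>) ^ Suc n \<le> (1 / \<mu>) ^ n" using mu_gt_1 by (intro power_decreasing) auto
  ultimately show ?thesis
    using mu_gt_1 unfolding real_norm_def abs_mult by (intro mult_mono) auto
qed

lemma geometric_summable: "summable (\<lambda>n. (1 / \<mu>) ^ n * K)"
  using mu_gt_1 by (intro summable_mult2 summable_geometric) simp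

lemma coeff_summable:
  assumes "integrable lam g"
  shows "summable (\<lambda>n. (1 / \<mu>) ^ Suc n * phi (P0_iter n g))"
  by (rule summable_comparison_test'[OF geometric_summable coeff_term_bound[OF assms]])

lemma coeff_eq: "unstable_coeff c g = c * (\<Sum>n. (1 / \<mu>) ^ Suc n * phi (P0_iter n g))"
  by (simp add: unstable_coeff_def mu)

lemma coeff_lin:
  assumes g: "integrable lam g" and h: "integrable lam h"
  shows "unstable_coeff c (\<lambda>x. a * g x + b * h x) = a * unstable_coeff c g + b * unstable_coeff c h"
proof -
  have "(\<lambda>n. (1 / \<mu>) ^ Suc n * phi (P0_iter n (\<lambda>x. a * g x + b * h x)))
      = (\<lambda>n. a * ((1 / \<mu>) ^ Suc n * phi (P0_iter n g)) + b * ((1 / \<mu>) ^ Suc n * phi (P0_iter n h)))"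
    by (rule ext, subst P0_iter_lin, subst phi_lin) (use g h in \<open>simp_all add: P0_iter_integral algebra_simps\<close>)
  moreover have "(\<Sum>n. a * ((1 / \<mu>) ^ Suc n * phi (P0_iter n g)) + b * ((1 / \<mu>) ^ Suc n * phi (P0_iter n h)))
      = a * (\<Sum>n. (1 / \<mu>) ^ Suc n * phi (P0_iter n g)) + b * (\<Sum>n. (1 / \<mu>) ^ Suc n * phi (P0_iter n h))"
    by (subst suminf_add[symmetric]) (intro summable_mult coeff_summable g h |
      simp only: suminf_mult[OF coeff_summable[OF g]] suminf_mult[OF coeff_summable[OF h]])+
  ultimately show ?thesis
    unfolding coeff_eq by (simp only: distrib_left mult.left_commute[of c])
qed

lemma coeff_bound:
  assumes "integrable lam g"
  shows "\<bar>unstable_coeff c g\<bar> \<le> c * (\<Sum>n. (1 / \<mu>) ^ n) * L1_norm g"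
proof -
  have "norm (\<Sum>n. (1 / \<mu>) ^ Suc n * phi (P0_iter n g)) \<le> (\<Sum>n. (1 / \<mu>) ^ n * L1_norm g)"
    by (rule norm_suminf_le[OF coeff_term_bound[OF assms] geometric_summable])
  also have "\<dots> = (\<Sum>n. (1 / \<mu>) ^ n) * L1_norm g"
    using mu_gt_1 by (intro suminf_mult2[symmetric] summable_geometric) simp
  finally show ?thesis using c unfolding coeff_eq abs_mult by (simp add: mult.assoc)
qed

text \<open>Shifting the series multiplies it by \<open>\<mu>\<close> and loses its first term,
  which is exactly what the rank-one part of the linearization gives back.\<close>

lemma coeff_transfer:
  assumes "integrable lam g"
  shows "unstable_coeff c (transfer_op 0 g) = \<mu> * unstable_coeff c g - c * phi g"
proof -
  let ?f = "\<lambda>n. (1 / \<mu>) ^ Suc n * phi (P0_iter n g)"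
  have "unstable_coeff c (transfer_op 0 g) = c * (\<Sum>n. \<mu> * ?f (Suc n))"
    unfolding coeff_eq using mu_gt_1 by (simp add: funpow_swap1 flip: funpow_Suc_right)
  also have "\<dots> = c * \<mu> * (\<Sum>n. ?f (Suc n))"
    using suminf_mult[OF summable_Suc_iff[THEN iffD2, OF coeff_summable[OF assms]], of \<mu>] by (simp only: mult.assoc)
  also have "(\<Sum>n. ?f (Suc n)) = (\<Sum>n. ?f n) - ?f 0"
    by (rule suminf_split_head[OF coeff_summable[OF assms]])
  also have "c * \<mu> * ((\<Sum>n. ?f n) - ?f 0) = \<mu> * unstable_coeff c g - c * phi g"
    unfolding coeff_eq using mu_gt_1 by (simp add: algebra_simps)
  finally show ?thesis .
qed

text \<open>As \<open>x\<close> is an eigenvector of \<open>transfer_op 0\<close> for 1/2,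
  \<open>coeff_transfer\<close> becomes the scalar equation
  \<open>(\<mu> - 1/2) * k = c / 12\<close> for its coefficient \<open>k\<close>, and
  \<open>\<mu> - 1/2 = c / 12\<close>.\<close>

lemma coeff_ident: "unstable_coeff c (\<lambda>x. x) = 1"
proof -
  have "unstable_coeff c (transfer_op 0 (\<lambda>x. x)) = 1/2 * unstable_coeff c (\<lambda>x. x)"
    using coeff_lin[OF ident_integrable ident_integrable, of "1/2" 0] by (simp add: transfer_op_0_ident[abs_def])
  then have "(\<mu> - 1/2) * unstable_coeff c (\<lambda>x. x) = c / 12"
    using coeff_transfer[OF ident_integrable] by (simp add: phi_ident algebra_simps)
  then show ?thesis using c mu by simp
qed

lemma coeff_linearization:
  assumes "integrable lam g"
  shows "unstable_coeff c (linearization c g) = \<mu> * unstable_coeff c g"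
  using coeff_lin[OF transfer_op_integral(1)[OF zero_in_Pars assms] ident_integrable, of 1 "c * phi g"]
  by (simp add: linearization_def[abs_def] coeff_transfer[OF assms] coeff_ident)

text \<open>The linearization differs from \<open>transfer_op 0\<close> by multiples of
  \<open>x\<close> and preserves the kernel of the eigenfunctional; vanishing of that functional
  determines the multiple.\<close>

lemma linearization_funpow:
  assumes g: "integrable lam g" and z: "unstable_coeff c g = 0"
  shows "(linearization c ^^ n) g = (\<lambda>x. 1 * P0_iter n g x + (- unstable_coeff c (P0_iter n g)) * x)"
proof (induction n)
  case 0
  then show ?case using z by simp
next
  case (Suc n)
  let ?h = "P0_iter n g"
  have h: "integrable lam ?h" by (rule P0_iter_integral(1)[OF g])
  have "(linearization c ^^ Suc n) g = (\<lambda>x. 1 * linearization c ?h x + (- unstable_coeff c ?h) * linearization c (\<lambda>x. x) x)"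
    unfolding funpow.simps o_def Suc by (rule ext) (rule linearization_lin[OF h ident_integrable])
  also have "\<dots> = (\<lambda>x. 1 * P0_iter (Suc n) g x + (- unstable_coeff c (P0_iter (Suc n) g)) * x)"
    by (simp add: coeff_transfer[OF h] linearization_ident mu[symmetric] linearization_def algebra_simps)
  finally show ?case .
qed

lemma linearization_hyperbolic: "hyperbolic_one_dim_unstable (linearization c)"
  unfolding hyperbolic_one_dim_unstable_def
proof (intro exI conjI)
  let ?e = "\<lambda>x::real. x" and ?Es = "{g \<in> BV0. unstable_coeff c g = 0}"
  \<comment> \<open>A bound for the eigenfunctional on L1. Since \<open>x\<close> has
    \<open>BV_norm\<close> at most 2, removing the component along it costs the factor
    \<open>1 + 2 * ?K\<close>; the other factor 2 is that of \<open>P0_iter_BV0\<close>.\<close>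
  let ?K = "c * (\<Sum>n. (1 / \<mu>) ^ n)"
  let ?C = "2 * (1 + 2 * ?K)"
  have K: "0 \<le> ?K" using c mu_gt_1 by (intro mult_nonneg_nonneg suminf_nonneg summable_geometric) auto
  show "?e \<in> BV0" by (rule ident_BV)
  show "1 < \<bar>\<mu>\<bar>" using mu_gt_1 by simp
  show "ae_eq (linearization c ?e) (\<lambda>x. \<mu> * ?e x)" by (simp add: linearization_ident[abs_def] mu)
  show "?Es \<subseteq> BV0" by auto
  have z: "unstable_coeff c (\<lambda>x. 0) = 0" "(\<lambda>x. 0) \<in> BV0"
    using coeff_lin[OF ident_integrable ident_integrable, of 0 0] BV0_lin[OF ident_BV(1) ident_BV(1), of 0 0] by simp_all
  then show "(\<lambda>x. 0) \<in> ?Es" by simp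
  show "\<forall>g\<in>?Es. \<forall>h\<in>?Es. \<forall>a b. (\<lambda>x. a * g x + b * h x) \<in> ?Es"
    by (auto simp: BV0_lin coeff_lin BV0_integrable)
  show "\<forall>g\<in>BV0. (\<forall>\<epsilon>>0. \<exists>h\<in>?Es. BV_norm (\<lambda>x. g x - h x) < \<epsilon>) \<longrightarrow> g \<in> ?Es"
  proof (intro ballI impI)
    fix g assume g: "g \<in> BV0" and ap: "\<forall>\<epsilon>>0. \<exists>h\<in>?Es. BV_norm (\<lambda>x. g x - h x) < \<epsilon>"
    have "\<bar>unstable_coeff c g\<bar> \<le> 0 + e" if e: "0 < e" for e
    proof -
      obtain h where h: "h \<in> BV0" "unstable_coeff c h = 0" "BV_norm (\<lambda>x. g x - h x) < e / (?K + 1)"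
        using ap e K by (auto dest!: spec[of _ "e / (?K + 1)"])
      have i: "integrable lam g" "integrable lam h" using g h BV0_integrable by auto
      have "unstable_coeff c g = unstable_coeff c (\<lambda>x. g x - h x)"
        using coeff_lin[OF i, of 1 "-1"] h(2) by simp
      then have "\<bar>unstable_coeff c g\<bar> \<le> ?K * L1_norm (\<lambda>x. g x - h x)"
        using coeff_bound[of "\<lambda>x. g x - h x"] i by simp
      also have "\<dots> \<le> ?K * (e / (?K + 1))"
        using h(3) K by (intro mult_left_mono order_trans[OF L1_le_BV_norm]) auto
      also have "\<dots> \<le> e" using K e by (simp add: field_simps)
      finally show ?thesis by simp
    qed
    then have "\<bar>unstable_coeff c g\<bar> \<le> 0" by (rule field_le_epsilon)
    then show "g \<in> ?Es" using g by simp
  qed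
  show "\<forall>g\<in>BV0. \<exists>!k. (\<lambda>x. g x - k * ?e x) \<in> ?Es"
  proof
    fix g assume g: "g \<in> BV0"
    have "(\<lambda>x. g x - k * x) \<in> BV0" "unstable_coeff c (\<lambda>x. g x - k * x) = unstable_coeff c g - k" for k
      using BV0_lin[OF g ident_BV(1), of 1 "- k"] coeff_lin[OF BV0_integrable[OF g] ident_integrable, of 1 "- k"]
      by (simp_all add: coeff_ident)
    then show "\<exists>!k. (\<lambda>x. g x - k * ?e x) \<in> ?Es"
      by (intro ex1I[of _ "unstable_coeff c g"]) auto
  qed
  show "\<forall>g\<in>?Es. linearization c g \<in> ?Es"
    by (auto simp: linearization_BV0 coeff_linearization BV0_integrable)
  show "(0::real) \<le> 1/2" "(1/2::real) < 1" by simp_all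
  show "\<forall>g\<in>?Es. \<forall>n. BV_norm ((linearization c ^^ n) g) \<le> ?C * (1/2) ^ n * BV_norm g"
  proof (intro ballI allI)
    fix g n assume "g \<in> ?Es"
    then have g: "g \<in> BV0" "unstable_coeff c g = 0" by auto
    let ?h = "P0_iter n g"
    note h = P0_iter_BV0[OF g(1), of n]
    have hB: "?h \<in> BV" "(\<lambda>x. x) \<in> BV" using h(1) ident_BV(1) by (auto simp: BV0_def)
    have "BV_norm ((linearization c ^^ n) g) \<le> \<bar>1\<bar> * BV_norm ?h + \<bar>- unstable_coeff c ?h\<bar> * BV_norm (\<lambda>x. x)"
      unfolding linearization_funpow[OF BV0_integrable[OF g(1)] g(2)] by (rule BV_norm_lin[OF hB])
    also have "\<dots> \<le> BV_norm ?h + (?K * BV_norm ?h) * 2"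
    proof (intro add_mono mult_mono)
      have "\<bar>unstable_coeff c ?h\<bar> \<le> ?K * L1_norm ?h" by (rule coeff_bound[OF BV0_integrable[OF h(1)]])
      also have "\<dots> \<le> ?K * BV_norm ?h" using K by (intro mult_left_mono L1_le_BV_norm)
      finally show "\<bar>- unstable_coeff c ?h\<bar> \<le> ?K * BV_norm ?h" by simp
      show "0 \<le> BV_norm (\<lambda>x::real. x)" by (simp add: BV_norm_eq)
      show "0 \<le> ?K * BV_norm ?h" by (rule mult_nonneg_nonneg[OF K]) (simp add: BV_norm_eq)
    qed (use ident_BV in auto)
    also have "\<dots> = (1 + 2 * ?K) * BV_norm ?h" by (simp add: algebra_simps)
    also have "\<dots> \<le> (1 + 2 * ?K) * (2 * (1/2)^n * BV_norm g)" using K h(2) by (intro mult_left_mono) auto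
    finally show "BV_norm ((linearization c ^^ n) g) \<le> ?C * (1/2) ^ n * BV_norm g" by (simp only: mult_ac)
  qed
qed

end

context coupling
begin

text \<open>With \<open>t = phi g\<close> and \<open>r = G t\<close> the remainder splits into three
  parts. The second-order error of \<open>transfer_op r\<close> on the constant 1 and the change of
  \<open>transfer_op\<close> on \<open>g\<close> are quadratic in \<open>BV_norm g\<close>; the term
  \<open>(r - c * t) * x\<close> is small by differentiability of \<open>G\<close> at 0.\<close>

lemma has_derivative_at_one:
  assumes G': "(G has_real_derivative c) (at 0)" and c: "0 \<le> c"
  shows "has_BV_L1_derivative (PF_sc G) (linearization c) (inv_dens 0)"
  unfolding has_BV_L1_derivative_def
proof (intro conjI ballI allI impI)
  show "integrable lam (linearization c g)" if "g \<in> BV0" for g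
    by (rule linearization_integrable[OF BV0_integrable[OF that]])
  show "ae_eq (linearization c g) (linearization c h)" if gh: "g \<in> BV0" "h \<in> BV0" "ae_eq g h" for g h
  proof -
    have "phi g = phi h" using gh by (intro phi_cong_AE BV0_integrable)
    moreover have "ae_eq (transfer_op 0 g) (transfer_op 0 h)"
      using gh by (intro transfer_op_cong_AE zero_in_Pars BV0_integrable)
    ultimately show ?thesis by (auto simp: ae_eq_def linearization_def elim: eventually_mono)
  qed
  show "ae_eq (linearization c (\<lambda>x. a * g x + b * h x)) (\<lambda>x. a * linearization c g x + b * linearization c h x)"
    if "g \<in> BV0" "h \<in> BV0" for g h a b
    using linearization_lin[OF BV0_integrable[OF that(1)] BV0_integrable[OF that(2)], of c a b] by (simp add: ae_eq_def)
  show "\<exists>K. \<forall>g\<in>BV0. L1_norm (linearization c g) \<le> K * BV_norm g"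
  proof (intro exI[of _ "1 + c"] ballI)
    fix g assume "g \<in> BV0"
    then have "L1_norm (linearization c g) \<le> (1 + c) * L1_norm g" using c by (intro linearization_L1 BV0_integrable)
    also have "\<dots> \<le> (1 + c) * BV_norm g" using c by (intro mult_left_mono L1_le_BV_norm) auto
    finally show "L1_norm (linearization c g) \<le> (1 + c) * BV_norm g" .
  qed
next
  fix \<epsilon> :: real assume e: "0 < \<epsilon>"
  have G0: "G 0 = 0" using G_odd[of 0] by (simp add: X_def)
  have "((\<lambda>h. G h / h) \<longlongrightarrow> c) (at 0)"
    using G' unfolding DERIV_def by (simp add: G0)
  \<comment> \<open>The cap at 1 yields \<open>|r| <= (c + 1) * |t|\<close>; the other bound
    reserves half of \<open>\<epsilon>\<close> for the error of \<open>G\<close>.\<close>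
  define \<eta> where "\<eta> = min 1 (\<epsilon> / 2)"
  have eta: "0 < \<eta>" "\<eta> \<le> 1" "\<eta> \<le> \<epsilon> / 2" using e by (auto simp: \<eta>_def)
  obtain d where d: "0 < d" "\<And>t. t \<noteq> 0 \<Longrightarrow> \<bar>t\<bar> < d \<Longrightarrow> \<bar>G t / t - c\<bar> < \<eta>"
    using LIM_D[OF \<open>((\<lambda>h. G h / h) \<longlongrightarrow> c) (at 0)\<close> eta(1)] by auto
  have Gd: "\<bar>G t - c * t\<bar> \<le> \<eta> * \<bar>t\<bar>" if "\<bar>t\<bar> < d" for t
  proof (cases "t = 0")
    case False
    have "G t - c * t = (G t / t - c) * t" using False by (simp add: field_simps)
    then have "\<bar>G t - c * t\<bar> = \<bar>G t / t - c\<bar> * \<bar>t\<bar>" by (simp add: abs_mult)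
    also have "\<dots> \<le> \<eta> * \<bar>t\<bar>" using d(2)[OF False that] by (intro mult_right_mono) auto
    finally show ?thesis .
  qed (simp add: G0)
  \<comment> \<open>The coefficient of the quadratic terms \<open>3 * r^2\<close> and
    \<open>8 * |r| * BV_norm g\<close> once \<open>r\<close> is bounded by
    \<open>(c + 1) * BV_norm g\<close>.\<close>
  define M where "M = 3 * (c + 1)\<^sup>2 + 8 * (c + 1)"
  have M: "0 < M" using c by (simp add: M_def add_nonneg_pos)
  define \<delta> where "\<delta> = min d (\<epsilon> / (2 * M))"
  have dl: "0 < \<delta>" "\<delta> \<le> d" "M * \<delta> \<le> \<epsilon> / 2" using d(1) e M by (auto simp: \<delta>_def min_def field_simps)
  show "\<exists>\<delta>>0. \<forall>g\<in>BV0. (\<lambda>x. inv_dens 0 x + g x) \<in> densities \<longrightarrow> BV_norm g < \<delta> \<longrightarrow>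
        L1_norm (\<lambda>x. PF_sc G (\<lambda>y. inv_dens 0 y + g y) x - PF_sc G (inv_dens 0) x - linearization c g x) \<le> \<epsilon> * BV_norm g"
  proof (intro exI[of _ \<delta>] conjI ballI impI)
    fix g assume g: "g \<in> BV0" and dens: "(\<lambda>x. inv_dens 0 x + g x) \<in> densities" and small: "BV_norm g < \<delta>"
    have dens1: "(\<lambda>x. 1 + g x) \<in> densities" using dens by simp
    have one: "(\<lambda>x. 1) \<in> densities" using kern_density[OF zero_in_Y] by simp
    have gi: "integrable lam g" by (rule BV0_integrable[OF g])
    let ?N = "BV_norm g"
    define t where "t = phi g"
    have phi1: "phi (\<lambda>x. 1) = 0" by (simp add: phi_def integral_lam_ident)
    have "phi (\<lambda>x. 1 + g x) = t"
      using phi_lin[OF densitiesD(1)[OF one] gi, of 1 1] phi1 by (simp add: t_def)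
    then have PF1: "ae_eq (PF_sc G (\<lambda>x. 1 + g x)) (transfer_op (G t) (\<lambda>x. 1 + g x))" and rP: "G t \<in> Pars"
      using PF_sc_ae(2)[OF dens1] phi_Pars[OF dens1] by simp_all
    have PF0: "ae_eq (PF_sc G (\<lambda>x. 1)) (transfer_op 0 (\<lambda>x. 1))"
      using PF_sc_ae(2)[OF one] phi1 G0 by simp
    define r where "r = G t"
    have N0: "0 \<le> ?N" by (simp add: BV_norm_eq)
    have tN: "\<bar>t\<bar> \<le> ?N" using phi_abs_le[OF gi] L1_le_BV_norm[of g] N0 by (simp add: t_def)
    then have Gt: "\<bar>r - c * t\<bar> \<le> \<eta> * \<bar>t\<bar>" unfolding r_def using small dl(2) by (intro Gd) linarith
    have "\<eta> * \<bar>t\<bar> \<le> 1 * \<bar>t\<bar>" using eta by (intro mult_right_mono) auto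
    moreover have "\<bar>r\<bar> \<le> \<bar>r - c * t\<bar> + \<bar>c * t\<bar>" by linarith
    ultimately have "\<bar>r\<bar> \<le> (c + 1) * \<bar>t\<bar>" using Gt c by (simp add: abs_mult algebra_simps)
    also have "\<dots> \<le> (c + 1) * ?N" using tN c by (intro mult_left_mono) auto
    finally have rN: "\<bar>r\<bar> \<le> (c + 1) * ?N" .
    let ?A = "\<lambda>x. (transfer_op r (\<lambda>x. 1) x - 1 - r * x) + (r - c * t) * x"
    let ?B = "\<lambda>x. transfer_op r g x - transfer_op 0 g x"
    have rP': "r \<in> Pars" using rP by (simp add: r_def)
    note ti = transfer_op_integral(1)[OF rP' densitiesD(1)[OF one]] transfer_op_integral(1)[OF rP' gi]
      transfer_op_integral(1)[OF zero_in_Pars gi] ident_integrable densitiesD(1)[OF one]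
    have iA: "integrable lam ?A" and iB: "integrable lam ?B" using ti by auto
    have ae: "ae_eq (\<lambda>x. PF_sc G (\<lambda>x. 1 + g x) x - PF_sc G (\<lambda>x. 1) x - linearization c g x) (\<lambda>x. ?A x + ?B x)"
      using PF1 PF0 unfolding ae_eq_def
    proof eventually_elim
      case (elim x)
      have "transfer_op r (\<lambda>x. 1 + g x) x = transfer_op r (\<lambda>x. 1) x + transfer_op r g x"
        using transfer_op_lin[of r 1 "\<lambda>x. 1" 1 g x] by simp
      moreover have "transfer_op 0 (\<lambda>x. 1) x = 1" by (simp add: transfer_op_0)
      ultimately show ?case
        using elim by (simp add: linearization_def r_def[symmetric] t_def[symmetric] algebra_simps)
    qed
    have "L1_norm (\<lambda>x. PF_sc G (\<lambda>x. 1 + g x) x - PF_sc G (\<lambda>x. 1) x - linearization c g x) = L1_norm (\<lambda>x. ?A x + ?B x)"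
    proof (rule L1_norm_cong_AE[OF _ _ ae])
      show "integrable lam (\<lambda>x. PF_sc G (\<lambda>x. 1 + g x) x - PF_sc G (\<lambda>x. 1) x - linearization c g x)"
        using densitiesD(1)[OF PF_sc_ae(1)[OF dens1]] densitiesD(1)[OF PF_sc_ae(1)[OF one]] linearization_integrable[OF gi]
        by (intro Bochner_Integration.integrable_diff)
      show "integrable lam (\<lambda>x. ?A x + ?B x)" using iA iB by (rule Bochner_Integration.integrable_add)
    qed
    also have "\<dots> \<le> L1_norm ?A + L1_norm ?B" by (rule L1_norm_triangle[OF iA iB])
    also have "\<dots> \<le> (3 * r\<^sup>2 + \<eta> * \<bar>t\<bar>) + 8 * \<bar>r\<bar> * ?N"
    proof (rule add_mono)
      show "L1_norm ?B \<le> 8 * \<bar>r\<bar> * ?N" using transfer_op_par_BV0[OF rP' g] by (simp add: L1_dist_def)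
      show "L1_norm ?A \<le> 3 * r\<^sup>2 + \<eta> * \<bar>t\<bar>"
      proof (rule L1_norm_le_bound[OF iA])
        fix x assume x: "x \<in> X"
        then have "\<bar>x\<bar> \<le> 1" by (auto simp: X_def)
        then have "\<bar>(r - c * t) * x\<bar> \<le> \<eta> * \<bar>t\<bar>"
          unfolding abs_mult using Gt mult_mono[of "\<bar>r - c * t\<bar>" "\<eta> * \<bar>t\<bar>" "\<bar>x\<bar>" 1] eta(1) by simp
        then show "\<bar>?A x\<bar> \<le> 3 * r\<^sup>2 + \<eta> * \<bar>t\<bar>"
          using transfer_op_one_expansion[OF rP' x] by linarith
      qed
    qed
    also have "\<dots> \<le> (3 * ((c + 1) * ?N)\<^sup>2 + \<epsilon> / 2 * ?N) + 8 * ((c + 1) * ?N) * ?N"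
    proof (intro add_mono mult_right_mono mult_left_mono)
      show "r\<^sup>2 \<le> ((c + 1) * ?N)\<^sup>2" using rN by (metis abs_ge_zero power2_abs power_mono)
      show "\<eta> * \<bar>t\<bar> \<le> \<epsilon> / 2 * ?N" using eta tN e by (intro mult_mono) auto
    qed (use rN N0 in auto)
    also have "\<dots> = (M * ?N) * ?N + \<epsilon> / 2 * ?N"
      by (simp add: M_def algebra_simps power2_eq_square)
    also have "\<dots> \<le> \<epsilon> / 2 * ?N + \<epsilon> / 2 * ?N"
    proof (intro add_mono mult_right_mono)
      have "M * ?N \<le> M * \<delta>" using M small by (intro mult_left_mono) auto
      then show "M * ?N \<le> \<epsilon> / 2" using dl(3) by simp
    qed (use N0 in auto)
    finally show "L1_norm (\<lambda>x. PF_sc G (\<lambda>y. inv_dens 0 y + g y) x - PF_sc G (inv_dens 0) x - linearization c g x) \<le> \<epsilon> * ?N"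
      by simp
  qed (rule dl(1))
qed

end

section \<open>Consequences of the S-shape\<close>

lemma deriv_in_works:
  assumes "F differentiable_on S" "x \<in> S"
  shows "(F has_real_derivative deriv_in S F x) (at x within S)"
proof -
  have "F differentiable (at x within S)" using assms by (simp add: differentiable_on_def)
  then show ?thesis
    unfolding deriv_in_def has_real_derivative_iff_has_vector_derivative by (simp add: vector_derivative_works)
qed

lemma below_diagonal:
  fixes H :: "real \<Rightarrow> real"
  assumes "continuous_on {r..b} H" "r \<le> b" "H b < b" "\<And>s. s \<in> {r..b} \<Longrightarrow> H s \<noteq> s"
  shows "H r < r"
proof (rule ccontr)
  assume "\<not> ?thesis"
  then have "\<exists>s\<ge>r. s \<le> b \<and> s - H s = 0"
    using assms(1-3) by (intro IVT'[of "\<lambda>s. s - H s"] continuous_intros) auto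
  then show False using assms(4) by force
qed

text \<open>Chord slopes of a strictly concave function decrease. The chord from 0 to
  \<open>b\<close> has slope 1, so the slope at 0 is larger, and the chord from 0 to an inner point
  \<open>r\<close> is steeper than 1.\<close>

lemma concave_above_diagonal:
  fixes H D :: "real \<Rightarrow> real"
  assumes der: "\<And>r. 0 \<le> r \<Longrightarrow> r \<le> b \<Longrightarrow> DERIV H r :> D r"
    and dec: "\<And>r s. 0 \<le> r \<Longrightarrow> r < s \<Longrightarrow> s \<le> b \<Longrightarrow> D s < D r"
    and b: "0 < b" "H 0 = 0" "H b = b"
  shows "1 < D 0" "\<And>r. 0 < r \<Longrightarrow> r < b \<Longrightarrow> r < H r"
proof -
  obtain z where z: "0 < z" "z < b" "H b - H 0 = (b - 0) * D z" using MVT2[of 0 b H D] der b by auto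
  then have "D z = 1" using b by simp
  then show "1 < D 0" using dec[of 0 z] z by simp
  fix r assume r: "0 < r" "r < b"
  obtain u where u: "0 < u" "u < r" "H r - H 0 = (r - 0) * D u" using MVT2[of 0 r H D] der r by auto
  obtain v where v: "r < v" "v < b" "H b - H r = (b - r) * D v" using MVT2[of r b H D] der r by auto
  have "D v < D u" using dec[of u v] u v by simp
  then have "(b - r) * D v < (b - r) * D u" using r by simp
  then have "b - H r < (b - r) * D u" using v b by simp
  moreover have "H r = r * D u" using u b by simp
  ultimately have "b * 1 < b * D u" by (simp add: algebra_simps)
  then have "1 < D u" using b by simp
  then show "r < H r" using \<open>H r = r * D u\<close> r by simp
qed

lemma kern_mean_deriv: "(kern_mean has_real_derivative 1/6) (at 0)"
  unfolding DERIV_def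
proof (rule LIM_I)
  fix e :: real assume e: "0 < e"
  show "\<exists>s>0. \<forall>h. h \<noteq> 0 \<and> norm (h - 0) < s \<longrightarrow> norm ((kern_mean (0 + h) - kern_mean 0) / h - 1/6) < e"
  proof (intro exI[of _ "min (1/2) (e / 2)"] conjI allI impI)
    fix h :: real assume h: "h \<noteq> 0 \<and> norm (h - 0) < min (1/2) (e / 2)"
    then have hY: "h \<in> Y" by (auto simp: Y_def)
    have "(kern_mean (0 + h) - kern_mean 0) / h - 1/6 = (kern_mean h - h/6) / h"
      using h by (simp add: diff_divide_distrib)
    also have "norm \<dots> \<le> (3/2 * h\<^sup>2) / \<bar>h\<bar>"
      unfolding real_norm_def abs_divide by (intro divide_right_mono kern_mean_taylor hY abs_ge_zero)
    also have "\<dots> = 3/2 * \<bar>h\<bar>" using h by (simp add: power2_eq_square abs_if)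
    also have "\<dots> < e" using h by auto
    finally show "norm ((kern_mean (0 + h) - kern_mean 0) / h - 1/6) < e" .
  qed (use e in simp)
qed

text \<open>The point \<open>r / (1 - r)\<close> is fixed by \<open>right_branch r\<close>. A point
  mass there never spreads to its right, and its evolution converges to the representation of
  \<open>inv_dens r\<close>; the slope of the mean of \<open>inv_dens r\<close> at 0 thus need not
  be computed.\<close>

lemma phi_inv_dens_le:
  assumes r: "r \<in> Pars" "0 \<le> r"
  shows "phi (inv_dens r) \<le> kern_mean (r / (1 - r))"
proof -
  let ?b = "r / (1 - r)"
  have r1: "r \<le> 2/5" using r by (simp add: Pars_def)
  have b: "0 \<le> ?b" "?b \<le> 2/3" using r r1 by (auto simp: divide_le_eq)
  have bY: "?b \<in> Y" using b by (simp add: Y_def)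
  have "r \<le> ?b / (1 + ?b)" using r1 by (simp add: field_simps)
  then have "dual_iter (\<lambda>_. r) n kern_mean ?b \<le> kern_mean ?b" for n
    using r bY b kern_mean_mono by (intro dual_iter_le_trap) auto
  then show ?thesis
    by (intro LIMSEQ_le_const2[OF dual_iter_kern_mean_const[OF r(1) bY]]) auto
qed

lemma deriv_le_of_le_right:
  fixes f g :: "real \<Rightarrow> real"
  assumes "DERIV f 0 :> a" "DERIV g 0 :> b" "f 0 = g 0" "0 < d" "\<And>h. 0 < h \<Longrightarrow> h < d \<Longrightarrow> f h \<le> g h"
  shows "a \<le> b"
proof (rule ccontr)
  assume "\<not> ?thesis"
  then have pos: "0 < a - b" by simp
  have "\<exists>e>0. \<forall>h>0. h < e \<longrightarrow> f 0 - g 0 < f (0 + h) - g (0 + h)"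
    by (rule DERIV_pos_inc_right[OF DERIV_diff[OF assms(1,2)] pos])
  then obtain e where e: "0 < e" "\<And>h. 0 < h \<Longrightarrow> h < e \<Longrightarrow> f 0 - g 0 < f h - g h" by auto
  define h where "h = min e d / 2"
  have "0 < h" "h < e" "h < d" using e(1) assms(4) by (auto simp: h_def)
  then show False using e(2)[of h] assms(5)[of h] assms(3) by simp
qed

theorem theorem2:
  fixes G :: "real \<Rightarrow> real"
  assumes range: "G ` X \<subseteq> {-4/10..4/10}"
    and analytic: "real_analytic_on G X"
    and S_shaped: "S_shaped_on G X"
    and I: "\<And>x. x \<in> X \<Longrightarrow> deriv_in X G x \<le> 25 - 50 * \<bar>G x\<bar>"
    and II: "S_shaped_on (H_fun G) {-2/3<..<2/3}"
  shows
    "(stable_regime G \<longrightarrow>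
        fixed_density G (inv_dens 0) \<and>
        (\<forall>v. fixed_density G v \<longrightarrow> ae_eq v (inv_dens 0)) \<and>
        (\<forall>u\<in>densities. u \<in> basin G (inv_dens 0)))
     \<and>
     (\<forall>rs. bistable_regime G rs \<longrightarrow>
        (\<forall>r\<in>{- rs, 0, rs}. fixed_density G (inv_dens r)) \<and>
        (\<forall>v. fixed_density G v \<longrightarrow> (\<exists>r\<in>{- rs, 0, rs}. ae_eq v (inv_dens r))) \<and>
        (\<forall>r\<in>{- rs, rs}. L1_open_in_densities (basin G (inv_dens r))) \<and>
        (\<forall>u\<in>densities. u \<notin> basin G (inv_dens (- rs)) \<and> u \<notin> basin G (inv_dens rs) \<longrightarrow>
            u \<in> basin G (inv_dens 0)) \<and>
        \<not> L1_open_in_densities (basin G (inv_dens 0)) \<and>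
        (\<forall>r\<in>{- rs, rs}. \<forall>\<epsilon>>0. \<exists>u\<in>basin G (inv_dens r).
            convex_on X u \<and> real_analytic_on u X \<and> L1_dist u (inv_dens 0) < \<epsilon>) \<and>
        (\<exists>Q. has_BV_L1_derivative (PF_sc G) Q (inv_dens 0) \<and> hyperbolic_one_dim_unstable Q))"
proof -
  let ?H = "H_fun G" and ?S = "{-2/3<..<2/3::real}"
  have GP: "G x \<in> Pars" if "x \<in> X" for x using range that by (auto simp: Pars_def)
  have Gdiff: "G differentiable_on X" and Gpos: "\<And>x. x \<in> X \<Longrightarrow> 0 < deriv_in X G x"
    and Godd: "\<And>x. x \<in> X \<Longrightarrow> G (- x) = - G x"
    using S_shaped by (auto simp: S_shaped_on_def)
  have Gcont: "continuous_on X G" using Gdiff by (rule differentiable_imp_continuous_on)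
  have Gder: "DERIV G x :> deriv_in X G x" if "-1/2 < x" "x < 1/2" for x
    using deriv_in_works[OF Gdiff, of x] that at_within_Icc_at[of "-1/2" x "1/2"] by (simp add: X_def)
  have Gmono: "G x \<le> G y" if xy: "x \<in> X" "y \<in> X" "x \<le> y" for x y
  proof (cases "x = y")
    case False
    have "G x < G y"
    proof (rule DERIV_pos_imp_increasing_open[where f = G])
      show "x < y" using xy False by simp
      show "\<exists>d. DERIV G z :> d \<and> 0 < d" if "x < z" "z < y" for z
        using Gder[of z] Gpos[of z] xy that by (auto simp: X_def)
      show "continuous_on {x..y} G" using Gcont xy by (auto intro: continuous_on_subset simp: X_def)
    qed
    then show ?thesis by simp
  qed simp
  have Hdiff: "?H differentiable_on ?S" "deriv_in ?S ?H differentiable_on ?S"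
    and Hodd: "\<And>r. r \<in> ?S \<Longrightarrow> ?H (- r) = - ?H r"
    and Hconc: "\<And>r. r \<in> ?S \<Longrightarrow> 0 < r \<Longrightarrow> deriv_in ?S (deriv_in ?S ?H) r < 0"
    using II by (auto simp: S_shaped_on_def)
  have Hcont: "continuous_on ?S ?H" using Hdiff(1) by (rule differentiable_imp_continuous_on)
  have at_S: "at r within ?S = at r" if "r \<in> ?S" for r using that by (intro at_within_open) auto
  have Hder: "DERIV ?H r :> deriv_in ?S ?H r" if "r \<in> ?S" for r
    using deriv_in_works[OF Hdiff(1) that] at_S[OF that] by simp
  have H2der: "DERIV (deriv_in ?S ?H) r :> deriv_in ?S (deriv_in ?S ?H) r" if "r \<in> ?S" for r
    using deriv_in_works[OF Hdiff(2) that] at_S[OF that] by simp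
  have Hdec: "deriv_in ?S ?H s < deriv_in ?S ?H r" if rs: "0 \<le> r" "r < s" "s < 2/3" for r s
  proof (rule DERIV_neg_imp_decreasing_open[where f = "deriv_in ?S ?H", OF rs(2)])
    show "\<exists>d. DERIV (deriv_in ?S ?H) z :> d \<and> d < 0" if "r < z" "z < s" for z
      using H2der[of z] Hconc[of z] rs that by auto
    show "continuous_on {r..s} (deriv_in ?S ?H)"
      using rs by (intro continuous_on_subset[OF differentiable_imp_continuous_on[OF Hdiff(2)]]) auto
  qed
  have PS: "Pars \<subseteq> ?S" by (auto simp: Pars_def)
  have HP: "?H r \<in> Pars" if "r \<in> ?S" for r
    unfolding H_fun_def using that by (intro GP phi_density_in_X inv_dens_density) auto
  interpret coupling G
    by unfold_locales (use GP Gmono Gcont Godd Hodd PS continuous_on_subset[OF Hcont PS] in auto)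
  \<comment> \<open>All values of \<open>H\<close> lie in \<open>Pars\<close>, so its fixed points
    do as well.\<close>
  have fp: "r \<in> H_fixed_points G \<longleftrightarrow> r \<in> Pars \<and> ?H r = r" for r
    using HP[of r] PS by (auto simp: H_fixed_points_def)
  \<comment> \<open>The values of \<open>H\<close> are at most 2/5, so \<open>H\<close> is below the
    diagonal at 1/2; with no fixed point from \<open>r\<close> up to there, the intermediate value
    theorem keeps it below.\<close>
  have below: "?H r < r" if r: "r \<in> Pars" "0 < r" and nf: "\<And>s. r \<le> s \<Longrightarrow> s \<notin> H_fixed_points G" for r
  proof (rule below_diagonal[of r "1/2" ?H])
    show "r \<le> 1/2" using r by (auto simp: Pars_def)
    show "continuous_on {r..1/2} ?H" using r by (intro continuous_on_subset[OF Hcont]) auto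
    show "?H (1/2) < 1/2" using HP[of "1/2"] by (auto simp: Pars_def)
    show "?H s \<noteq> s" if "s \<in> {r..1/2}" for s
      using nf[of s] r that by (auto simp: H_fixed_points_def)
  qed
  show ?thesis
  proof (intro conjI impI allI)
    assume st: "stable_regime G"
    have f0: "r \<in> Pars \<and> ?H r = r \<longleftrightarrow> r = 0" for r
      using fp[of r] st by (simp add: stable_regime_def)
    have Hb: "?H r < r" if "r \<in> Pars" "0 < r" for r
      by (rule below[OF that]) (use st that in \<open>auto simp: stable_regime_def\<close>)
    show "fixed_density G (inv_dens 0)" using f0[of 0] by (intro fixed_density_inv_dens) auto
    show "ae_eq v (inv_dens 0)" if "fixed_density G v" for v
      using fixed_density_cases[OF that] f0 by metis
    show "\<forall>u\<in>densities. u \<in> basin G (inv_dens 0)"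
      using driven_stable[OF orbit_driven Hb] by (auto intro: basinI simp del: inv_dens_0)
  next
    fix rs assume "bistable_regime G rs"
    then have rs0: "0 < rs" and fps: "H_fixed_points G = {- rs, 0, rs}" by (auto simp: bistable_regime_def)
    have f3: "r \<in> Pars \<and> ?H r = r \<longleftrightarrow> r \<in> {- rs, 0, rs}" for r
      using fp[of r] fps by simp
    have rsP: "rs \<in> Pars" and Hrs: "?H rs = rs" and H0: "?H 0 = 0" using f3[of rs] f3[of 0] by auto
    have rsl: "rs \<le> 2/5" using rsP by (simp add: Pars_def)
    let ?D = "deriv_in ?S ?H" and ?c = "deriv_in X G 0"
    have ca: "1 < ?D 0" "\<And>r. 0 < r \<Longrightarrow> r < rs \<Longrightarrow> r < ?H r"
      using concave_above_diagonal[of rs ?H ?D] Hder Hdec rsl rs0 H0 Hrs by auto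
    have Hb: "?H r < r" if "r \<in> Pars" "rs < r" for r
      by (rule below) (use that rs0 in \<open>auto simp: fps\<close>)
    have G0: "G 0 = 0" using Godd[of 0] by (simp add: X_def)
    have Gd: "DERIV G 0 :> ?c" by (rule Gder) simp_all
    have Kd: "DERIV (\<lambda>y. G (kern_mean y)) 0 :> ?c * (1/6)"
      using DERIV_chain2[of G ?c kern_mean 0 "1/6" UNIV] Gd kern_mean_deriv by simp
    have bd: "DERIV (\<lambda>a::real. a / (1 - a)) 0 :> 1"
      by (auto intro!: derivative_eq_intros)
    have "DERIV (\<lambda>r. G (kern_mean (r / (1 - r)))) 0 :> ?c * (1/6) * 1"
      using DERIV_chain2[of "\<lambda>y. G (kern_mean y)" "?c * (1/6)" "\<lambda>r. r / (1 - r)" 0 1 UNIV] Kd bd by simp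
    \<comment> \<open>Both functions vanish at 0 and \<open>phi_inv_dens_le\<close> orders them to
      the right of it, so their slopes at 0 are ordered as well.\<close>
    then have "?D 0 \<le> ?c * (1/6) * 1"
    proof (rule deriv_le_of_le_right[rotated])
      show "DERIV ?H 0 :> ?D 0" by (rule Hder) simp
      show "?H 0 = G (kern_mean (0 / (1 - 0)))" using H0 G0 by simp
      show "(0::real) < 2/5" by simp
      fix h :: real assume h: "0 < h" "h < 2/5"
      then have hP: "h \<in> Pars" by (simp add: Pars_def)
      have "0 \<le> h / (1 - h)" "h / (1 - h) \<le> 2/3" using h by (auto simp: divide_le_eq)
      then have "h / (1 - h) \<in> Y" by (simp add: Y_def)
      then show "?H h \<le> G (kern_mean (h / (1 - h)))"
        unfolding H_fun_def using h hP
        by (intro G_mono phi_density_in_X inv_dens_Pars kern_mean_in_X phi_inv_dens_le) auto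
    qed
    then have c6: "6 < ?c" using ca(1) by simp
    \<comment> \<open>Near 0 the slope \<open>?c / 6 > 1\<close> of \<open>G (kern_mean a)\<close>
      beats the slope 1 of \<open>a / (1 - a)\<close>, which is the trapping inequality of the
      locale.\<close>
    have "\<exists>d>0. \<forall>h>0. h < d \<longrightarrow> G (kern_mean 0) - 0 / (1 - 0) < G (kern_mean (0 + h)) - (0 + h) / (1 - (0 + h))"
      by (rule DERIV_pos_inc_right[OF DERIV_diff[OF Kd bd]]) (use c6 in simp)
    then obtain d where d: "0 < d" "\<And>h. 0 < h \<Longrightarrow> h < d \<Longrightarrow> h / (1 - h) < G (kern_mean h)"
      using G0 by auto
    interpret bistable_coupling G rs "min d (1/2)"
      by unfold_locales (use rs0 rsP ca(2) Hb d in auto)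
    show "\<forall>r\<in>{- rs, 0, rs}. fixed_density G (inv_dens r)"
      using f3 fixed_density_inv_dens by blast
    show "\<exists>r\<in>{- rs, 0, rs}. ae_eq v (inv_dens r)" if "fixed_density G v" for v
      using fixed_density_cases[OF that] f3 by metis
    show "\<forall>r\<in>{- rs, rs}. L1_open_in_densities (basin G (inv_dens r))"
      using basin_open[of 1] basin_open[of "-1"] by simp
    show "\<forall>u\<in>densities. u \<notin> basin G (inv_dens (- rs)) \<and> u \<notin> basin G (inv_dens rs) \<longrightarrow> u \<in> basin G (inv_dens 0)"
      using basin_cases by blast
    show "\<not> L1_open_in_densities (basin G (inv_dens 0))"
      by (rule basin_0_not_open[OF H0 Hrs])
    show "\<forall>r\<in>{- rs, rs}. \<forall>\<epsilon>>0. \<exists>u\<in>basin G (inv_dens r).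
        convex_on X u \<and> real_analytic_on u X \<and> L1_dist u (inv_dens 0) < \<epsilon>"
      using approx_by_kern[of 1] approx_by_kern[of "-1"] by simp
    show "\<exists>Q. has_BV_L1_derivative (PF_sc G) Q (inv_dens 0) \<and> hyperbolic_one_dim_unstable Q"
      using has_derivative_at_one[OF Gd] linearization_hyperbolic[OF c6 refl] c6
      by (intro exI[of _ "linearization ?c"]) auto
  qed
qed

end
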